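(* There exist constants $c_1$, $c_2$ and $\alpha\ge 2$ and a probability space carrying a standard Brownian motion $(W(t))_{t\ge 0}$ and, for each $n\ge 1$, random variables $X_{k,n}$, $1\le k\le n$, such that for each $n\ge 1$: 1. the random variables $X_{1,n},\dots,X_{n,n}$ are mutually independent; 2. $\mathbb{P}\{X_{k,n}=1\}=\mathbb{P}\{X_{k,n}=-1\}=\frac12$ for $1\le k\le n$; 3. with $X^{(n)}=(X_{1,n},\dots,X_{n,n})$, $$\mathbb{P}\left\{\sup_{0\le t\le 1}|W(t)-\ell_{X^{(n)}}(t)|\ge c_1\frac{\log n}{\sqrt{n}}\right\}\le\frac{c_2}{n^{\alpha}}.$$
   Context: For $x=(x_1,\dots,x_n)\in\{\pm1\}^n$, $\ell_x:[0,1]\to\mathbb{R}$ is the continuous function with $\ell_x(0)=0$ that is linear on each interval $[\frac{i-1}{n},\frac{i}{n}]$, $1\le i\le n$, with slope $x_i\sqrt{n}$; equivalently $\ell_x(k/n)=n^{-1/2}\sum_{i=1}^k x_i$ for $0\le k\le n$, with linear interpolation. For a random vector $X$ with values in $\{\pm1\}^n$, $\ell_X$ is the corresponding random function. Standard Brownian motion has $W(0)=0$. *)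

theory Defs
  imports "HOL-Probability.Probability"
begin

text \<open>
  The paths are required to be continuous on the whole sample space (not only almost
  surely). Hence suprema of \<open>\<bar>W t - f t\<bar>\<close> over compact intervals, for continuous \<open>f\<close>, are
  suprema of bounded sets and are measurable; otherwise \<open>measure\<close> of an event involving such a
  supremum could be the default value 0. The index set is \<open>t \<ge> 0\<close>; values of \<open>W\<close> at negative
  times are irrelevant.
\<close>

definition standard_brownian_motion :: "'a measure \<Rightarrow> (real \<Rightarrow> 'a \<Rightarrow> real) \<Rightarrow> bool" where
  "standard_brownian_motion M W \<longleftrightarrow>
     prob_space M \<and>
     (\<forall>t\<ge>0. W t \<in> borel_measurable M) \<and>
     (\<forall>\<omega>\<in>space M. W 0 \<omega> = 0) \<and>
     (\<forall>\<omega>\<in>space M. continuous_on {0..} (\<lambda>t. W t \<omega>)) \<and>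
     (\<forall>s t. 0 \<le> s \<and> s < t \<longrightarrow>
        distributed M lborel (\<lambda>\<omega>. W t \<omega> - W s \<omega>) (normal_density 0 (sqrt (t - s)))) \<and>
     (\<forall>(m::nat) \<tau>. 0 \<le> \<tau> 0 \<and> mono_on {..m} \<tau> \<longrightarrow>
        prob_space.indep_vars M (\<lambda>_. borel) (\<lambda>i \<omega>. W (\<tau> (Suc i)) \<omega> - W (\<tau> i) \<omega>) {..<m})"

text \<open>
  The vector \<open>x = (x\<^sub>1, \<dots>, x\<^sub>n)\<close> is given by the values \<open>x 1, \<dots>, x n\<close>. At \<open>t = 1\<close> the
  meaningless value \<open>x (n + 1)\<close> occurs with factor 0. The lemmas below state the defining properties.
\<close>

definition ell :: "nat \<Rightarrow> (nat \<Rightarrow> real) \<Rightarrow> real \<Rightarrow> real" where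
  "ell n x t =
     (let k = nat \<lfloor>real n * t\<rfloor>
      in (\<Sum>i=1..k. x i) / sqrt (real n) + (t - real k / real n) * (x (Suc k) * sqrt (real n)))"

lemma ell_grid:
  assumes "n \<ge> 1"
  shows "ell n x (real k / real n) = (\<Sum>i=1..k. x i) / sqrt (real n)"
  using assms by (simp add: ell_def)

lemma ell_0: "ell n x 0 = 0"
  by (simp add: ell_def)

lemma ell_slope:
  assumes "i \<in> {1..n}" and t: "t \<in> {(real i - 1) / real n..real i / real n}"
  shows "ell n x t = ell n x ((real i - 1) / real n) + x i * sqrt (real n) * (t - (real i - 1) / real n)"
proof -
  have n: "n \<ge> 1" and i: "i \<ge> 1" using assms by auto
  obtain j where j: "i = Suc j" using i by (cases i) auto
  have g: "ell n x (real j / real n) = (\<Sum>i=1..j. x i) / sqrt (real n)"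
    using ell_grid[OF n] .
  show ?thesis
  proof (cases "t = real i / real n")
    case True
    have "sqrt (real n) * (real (Suc j) / real n - real j / real n) = 1 / sqrt (real n)"
      using n by (simp add: field_simps)
    then have "x i * sqrt (real n) * (real (Suc j) / real n - real j / real n) = x i / sqrt (real n)"
      by (simp add: mult.assoc)
    then show ?thesis
      using ell_grid[OF n, of x i] g by (simp add: True j add_divide_distrib)
  next
    case False
    with t have "real j / real n \<le> t" "t < real (Suc j) / real n"
      by (auto simp: j)
    then have "real j \<le> real n * t" "real n * t < real j + 1"
      using n by (simp_all add: field_simps)
    then have "\<lfloor>real n * t\<rfloor> = int j"
      by (simp add: floor_eq_iff)
    then show ?thesis
      using g by (simp add: j ell_def Let_def)
  qed
qed

lemma continuous_on_ell:
  assumes "n \<ge> 1"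
  shows "continuous_on {0..1} (ell n x)"
proof -
  let ?I = "\<lambda>i. {(real i - 1) / real n..real i / real n}"
  have c: "continuous_on (?I i) (ell n x)" if "i \<in> {1..n}" for i
  proof (subst continuous_on_cong[OF refl ell_slope[OF that]])
    show "continuous_on (?I i) (\<lambda>t. ell n x ((real i - 1) / real n)
        + x i * sqrt (real n) * (t - (real i - 1) / real n))"
      by (intro continuous_intros)
  qed
  have "continuous_on (\<Union>i\<in>{1..n}. ?I i) (ell n x)"
    by (rule continuous_on_closed_Union) (use c in auto)
  moreover have "{0..1} \<subseteq> (\<Union>i\<in>{1..n}. ?I i)"
  proof
    fix t :: real assume t: "t \<in> {0..1}"
    show "t \<in> (\<Union>i\<in>{1..n}. ?I i)"
    proof (cases "t = 0")
      case True
      then show ?thesis using assms by (intro UN_I[of 1]) auto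
    next
      case False
      define i where "i = nat \<lceil>real n * t\<rceil>"
      have p: "real n * t > 0" "real n * t \<le> real n" using t False assms by (auto simp: mult_left_le)
      then have "real i = of_int \<lceil>real n * t\<rceil>" by (simp add: i_def)
      then have "real i - 1 < real n * t" "real n * t \<le> real i" by linarith+
      moreover have "i \<in> {1..n}"
        using p calculation by (auto simp: Suc_le_eq)
      ultimately show ?thesis using assms by (intro UN_I[of i]) (auto simp: field_simps)
    qed
  qed
  ultimately show ?thesis by (rule continuous_on_subset)
qed

end

theory Submission
  imports Defs "HOL-Real_Asymp.Real_Asymp"
begin

text \<open>The proof is the dyadic coupling of Komlos, Major and Tusnady. The Haar coefficients of the
  increments of a Brownian motion over a grid of \<open>2 ^ J\<close> points are independent standard normal
  variables. Independent fair signs arise when these are fed, from the coarsest level to the finest,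
  into quantile transforms: of the binomial law for the total number of up-steps, then of
  hypergeometric laws for the way in which this number splits between the halves of a dyadic block.
  A quantile transform deviates from its normal argument \<open>z\<close>, suitably scaled, by at most a constant
  times \<open>1 + z\<^sup>2\<close> plus a term for the imbalance of the block. Hence the largest error over all branches
  of the dyadic tree has an exponential moment that grows by a bounded factor per level, and it is of
  order \<open>J\<close>, that is \<open>ln n\<close>, off an event of probability of order \<open>1 / n\<^sup>2\<close>. Between grid points, chaining
  over dyadic points bounds the oscillation of the Brownian path by a multiple of \<open>ln n / sqrt n\<close>.\<close>

section \<open>Independent standard Gaussian sequences\<close>

text \<open>For every \<open>n\<close> the signs are functions of one and the same path, so nothing
  has to be arranged between different \<open>n\<close>. When \<open>n\<close> is not a power of
  two, the tree gets \<open>2 ^ lev n\<close> leaves, and the surplus leaves are fed by increments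
  of the path after time 1. Joint normality is never expressed through multivariate densities: the
  Haar transform and the midpoint refinement are made of rotations of two coordinates and injective
  reindexings, and each of these preserves the law of an i.i.d. normal sequence. The obstacle is
  that an unbalanced block splits with a smaller variance than a balanced one. The quantile error
  therefore contains the squared imbalance over the block length, which is unbounded. Passing to a
  half-block, however, contracts this quantity by a factor 3/4, up to a constant and the square of
  the normal variable at the node. Hence an exponential moment weighted by the imbalance of the
  block can be carried through the tree, provided that its exponent is small enough to make the
  accumulated squares integrable. The constants are not optimised; they result from the choice
  \<open>\<epsilon> = 1 / 4\<close> in the quantile estimates.\<close>

definition gaussian :: "real measure" where
  "gaussian = density lborel std_normal_density"

lemma sets_gaussian [simp, measurable_cong]: "sets gaussian = sets borel"
  by (simp add: gaussian_def)

lemma space_gaussian [simp]: "space gaussian = UNIV"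
  by (simp add: gaussian_def)

interpretation gaussian: prob_space gaussian
  unfolding gaussian_def by (rule prob_space_normal_density) simp

definition gseq :: "(nat \<Rightarrow> real) measure" where
  "gseq = PiM UNIV (\<lambda>_. gaussian)"

interpretation gprod: product_prob_space "\<lambda>_::nat. gaussian" UNIV
  by unfold_locales

lemma sets_gseq [measurable_cong]: "sets gseq = sets (PiM UNIV (\<lambda>_::nat. borel :: real measure))"
  unfolding gseq_def by (intro sets_PiM_cong) auto

lemma space_gseq [simp]: "space gseq = UNIV"
  by (simp add: gseq_def space_PiM)

interpretation gseq: prob_space gseq
  unfolding gseq_def by (rule gprod.prob_space_axioms)

lemma measurable_gseq_iff:
  "f \<in> measurable N gseq \<longleftrightarrow> (\<forall>i. (\<lambda>x. f x i) \<in> borel_measurable N)"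
proof
  assume f [measurable]: "f \<in> measurable N gseq"
  have "(\<lambda>\<omega>. \<omega> i) \<in> borel_measurable gseq" for i
    unfolding measurable_cong_sets[OF sets_gseq refl] by (rule measurable_component_singleton) simp
  from measurable_compose[OF f this] show "\<forall>i. (\<lambda>x. f x i) \<in> borel_measurable N" by simp
next
  assume *: "\<forall>i. (\<lambda>x. f x i) \<in> borel_measurable N"
  show "f \<in> measurable N gseq"
    unfolding measurable_cong_sets[OF refl sets_gseq]
    by (rule measurable_PiM_single') (use * in \<open>auto simp: space_PiM\<close>)
qed

lemma measurable_gseq_coord [measurable]: "(\<lambda>\<omega>. \<omega> i) \<in> borel_measurable gseq"
  using measurable_gseq_iff[of "\<lambda>x. x" gseq] by simp

lemma sets_box [measurable]:
  assumes "finite J" "\<And>i. i \<in> J \<Longrightarrow> A i \<in> sets borel"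
  shows "{\<omega>. \<forall>i\<in>J. \<omega> i \<in> A i} \<in> sets gseq"
proof -
  have "{\<omega> \<in> space gseq. \<forall>i\<in>J. \<omega> i \<in> A i} \<in> sets gseq"
    using assms by measurable
  then show ?thesis by simp
qed

lemma prod_emb_box: "prod_emb UNIV (\<lambda>_. gaussian) J (Pi\<^sub>E J A) = {\<omega>. \<forall>i\<in>J. \<omega> i \<in> A i}"
  by (auto simp: prod_emb_def PiE_iff)

lemma emeasure_gseq_box:
  assumes "finite J" "\<And>i. i \<in> J \<Longrightarrow> A i \<in> sets borel"
  shows "emeasure gseq {\<omega>. \<forall>i\<in>J. \<omega> i \<in> A i} = (\<Prod>i\<in>J. emeasure gaussian (A i))"
  using gprod.emeasure_PiM_emb[of J A] assms unfolding prod_emb_box gseq_def[symmetric] by simp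

lemma gseq_eqI:
  assumes "sets N = sets gseq"
    and "\<And>A J. finite J \<Longrightarrow> (\<And>i. i \<in> J \<Longrightarrow> A i \<in> sets borel) \<Longrightarrow>
      emeasure N {\<omega>. \<forall>i\<in>J. \<omega> i \<in> A i} = (\<Prod>i\<in>J. emeasure gaussian (A i))"
  shows "N = gseq"
proof -
  have "gseq = N" unfolding gseq_def
  proof (rule measure_eqI_PiM_infinite)
    show "finite_measure (PiM UNIV (\<lambda>_::nat. gaussian))"
      unfolding gseq_def[symmetric] by unfold_locales
    show "sets N = sets (PiM UNIV (\<lambda>_::nat. gaussian))"
      using assms(1) by (simp add: gseq_def)
  qed (use assms(2) in \<open>auto simp: prod_emb_box emeasure_gseq_box gseq_def[symmetric]\<close>)
  then show ?thesis ..
qed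

text \<open>A box factors into its conditions inside and outside \<open>A\<close>. With Fubini this
  turns independence of the coordinates in \<open>A\<close> from the others into an iterated
  integral.\<close>

lemma distr_resample:
  "distr (gseq \<Otimes>\<^sub>M gseq) gseq (\<lambda>(x, y) i. if i \<in> A then x i else y i) = gseq"
proof (rule gseq_eqI)
  fix B :: "nat \<Rightarrow> real set" and J :: "nat set"
  assume J: "finite J" and B: "\<And>i. i \<in> J \<Longrightarrow> B i \<in> sets borel"
  have m: "(\<lambda>(x, y) i. if i \<in> A then x i else y i) \<in> measurable (gseq \<Otimes>\<^sub>M gseq) gseq"
    unfolding measurable_gseq_iff case_prod_beta
  proof
    fix i show "(\<lambda>x. if i \<in> A then fst x i else snd x i) \<in> borel_measurable (gseq \<Otimes>\<^sub>M gseq)"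
      by (cases "i \<in> A") simp_all
  qed
  have eq: "(\<lambda>(x, y) i. if i \<in> A then x i else y i) -` {\<omega>. \<forall>i\<in>J. \<omega> i \<in> B i} \<inter> space (gseq \<Otimes>\<^sub>M gseq)
     = {\<omega>. \<forall>i\<in>J \<inter> A. \<omega> i \<in> B i} \<times> {\<omega>. \<forall>i\<in>J - A. \<omega> i \<in> B i}"
    by (auto simp: space_pair_measure)
  have "emeasure (distr (gseq \<Otimes>\<^sub>M gseq) gseq (\<lambda>(x, y) i. if i \<in> A then x i else y i))
      {\<omega>. \<forall>i\<in>J. \<omega> i \<in> B i}
     = emeasure gseq {\<omega>. \<forall>i\<in>J \<inter> A. \<omega> i \<in> B i} * emeasure gseq {\<omega>. \<forall>i\<in>J - A. \<omega> i \<in> B i}"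
    using J B by (simp only: emeasure_distr[OF m sets_box[OF J B]] eq)
      (auto simp: gseq.emeasure_pair_measure_Times)
  also have "\<dots> = (\<Prod>i\<in>J. emeasure gaussian (B i))"
    using J B by (subst (1 2) emeasure_gseq_box)
      (auto simp: prod.union_disjoint[symmetric] Int_Diff_disjoint Int_Diff_Un)
  finally show "emeasure (distr (gseq \<Otimes>\<^sub>M gseq) gseq (\<lambda>(x, y) i. if i \<in> A then x i else y i))
      {\<omega>. \<forall>i\<in>J. \<omega> i \<in> B i} = (\<Prod>i\<in>J. emeasure gaussian (B i))" .
qed simp

lemma measurable_resample [measurable]:
  "(\<lambda>(x, y) i. if i \<in> A then x i else y i) \<in> measurable (gseq \<Otimes>\<^sub>M gseq) gseq"
  unfolding measurable_gseq_iff case_prod_beta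
proof
  fix i show "(\<lambda>x. if i \<in> A then fst x i else snd x i) \<in> borel_measurable (gseq \<Otimes>\<^sub>M gseq)"
    by (cases "i \<in> A") simp_all
qed

lemma nn_integral_resample:
  assumes [measurable]: "f \<in> borel_measurable gseq"
  shows "(\<integral>\<^sup>+\<omega>. f \<omega> \<partial>gseq) = (\<integral>\<^sup>+x. \<integral>\<^sup>+y. f (\<lambda>i. if i \<in> A then x i else y i) \<partial>gseq \<partial>gseq)"
proof -
  have "(\<integral>\<^sup>+\<omega>. f \<omega> \<partial>gseq) = (\<integral>\<^sup>+z. f ((\<lambda>(x, y) i. if i \<in> A then x i else y i) z) \<partial>(gseq \<Otimes>\<^sub>M gseq))"
    by (subst (1) distr_resample[of A, symmetric], subst nn_integral_distr) (use assms in measurable)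
  also have "\<dots> = (\<integral>\<^sup>+x. \<integral>\<^sup>+y. f (\<lambda>i. if i \<in> A then x i else y i) \<partial>gseq \<partial>gseq)"
  proof (subst gseq.nn_integral_fst[symmetric])
    show "(\<lambda>z. f ((\<lambda>(x, y) i. if i \<in> A then x i else y i) z)) \<in> borel_measurable (gseq \<Otimes>\<^sub>M gseq)"
      by (rule measurable_compose[OF measurable_resample]) simp
  qed simp
  finally show ?thesis .
qed

lemma distr_gseq_coord: "distr gseq borel (\<lambda>\<omega>. \<omega> i) = gaussian"
proof -
  have "distr (PiM UNIV (\<lambda>_::nat. gaussian)) gaussian (\<lambda>\<omega>. \<omega> i) = gaussian"
    by (rule distr_PiM_component) (auto intro: gaussian.prob_space_axioms)
  then show ?thesis
    by (simp add: gseq_def[symmetric] cong: distr_cong)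
qed

lemma nn_integral_gseq_coord:
  assumes [measurable]: "g \<in> borel_measurable borel"
  shows "(\<integral>\<^sup>+\<omega>. g (\<omega> i) \<partial>gseq) = (\<integral>\<^sup>+x. g x \<partial>gaussian)"
proof -
  have "g \<in> borel_measurable (distr gseq borel (\<lambda>\<omega>. \<omega> i))" by simp
  from nn_integral_distr[OF measurable_gseq_coord this] show ?thesis
    by (simp add: distr_gseq_coord)
qed

text \<open>As \<open>F x\<close> ignores coordinate \<open>i\<close>, this coordinate can be
  integrated separately. In the moment bounds this is conditioning on the normal variable at a node
  of the tree.\<close>

lemma nn_integral_gseq_freeze:
  assumes F: "case_prod F \<in> borel_measurable (borel \<Otimes>\<^sub>M gseq)"
    and dep: "\<And>x w y. F x (w(i := y)) = F x w"
  shows "(\<integral>\<^sup>+w. F (w i) w \<partial>gseq) = (\<integral>\<^sup>+x. \<integral>\<^sup>+w. F x w \<partial>gseq \<partial>gaussian)"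
proof -
  have m: "(\<lambda>w. F (w i) w) \<in> borel_measurable gseq"
    using measurable_compose[OF _ F, of "\<lambda>w. (w i, w)" gseq] by simp
  have [measurable]: "(\<lambda>x. \<integral>\<^sup>+w. F x w \<partial>gseq) \<in> borel_measurable borel"
    using gseq.borel_measurable_nn_integral_fst[OF F] by simp
  have "F ((\<lambda>j. if j \<in> {i} then x j else y j) i) (\<lambda>j. if j \<in> {i} then x j else y j) = F (x i) y" for x y
    using dep[of "x i" y "x i"] by (simp add: fun_upd_def if_distrib eq_commute[of _ i] cong: if_cong)
  then have "(\<integral>\<^sup>+w. F (w i) w \<partial>gseq) = (\<integral>\<^sup>+x. \<integral>\<^sup>+w. F (x i) w \<partial>gseq \<partial>gseq)"
    by (subst nn_integral_resample[OF m, of "{i}"]) simp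
  also have "\<dots> = (\<integral>\<^sup>+x. \<integral>\<^sup>+w. F x w \<partial>gseq \<partial>gaussian)"
    by (rule nn_integral_gseq_coord) simp
  finally show ?thesis .
qed

section \<open>Maps that preserve the law of the Gaussian sequence\<close>

definition preserving :: "((nat \<Rightarrow> real) \<Rightarrow> (nat \<Rightarrow> real)) \<Rightarrow> bool" where
  "preserving f \<longleftrightarrow> f \<in> measurable gseq gseq \<and> distr gseq gseq f = gseq"

lemma preserving_measurable: "preserving f \<Longrightarrow> f \<in> measurable gseq gseq"
  by (simp add: preserving_def)

lemma preserving_id: "preserving (\<lambda>\<omega>. \<omega>)"
  by (simp add: preserving_def)

lemma preserving_comp:
  assumes "preserving f" "preserving g" shows "preserving (\<lambda>\<omega>. f (g \<omega>))"
  using assms distr_distr[of f gseq gseq g gseq] by (auto simp: preserving_def comp_def)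

lemma preserving_nn_integral:
  assumes "preserving f" and [measurable]: "g \<in> borel_measurable gseq"
  shows "(\<integral>\<^sup>+\<omega>. g (f \<omega>) \<partial>gseq) = (\<integral>\<^sup>+\<omega>. g \<omega> \<partial>gseq)"
  using assms nn_integral_distr[of f gseq gseq g] by (simp add: preserving_def)

lemma preserving_reindex:
  assumes "inj f" shows "preserving (\<lambda>\<omega> i. \<omega> (f i))"
proof -
  have "distr (PiM UNIV (\<lambda>_::nat. gaussian)) (PiM UNIV (\<lambda>_::nat. gaussian)) (\<lambda>\<omega>. \<lambda>n\<in>UNIV. \<omega> (f n))
      = PiM UNIV (\<lambda>_::nat. gaussian)"
    by (rule distr_PiM_reindex) (auto intro: gaussian.prob_space_axioms assms)
  moreover have "(\<lambda>\<omega> i. \<omega> (f i)) \<in> measurable gseq gseq"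
    by (simp add: measurable_gseq_iff)
  ultimately show ?thesis by (simp add: preserving_def gseq_def restrict_UNIV)
qed

text \<open>A law on sequences is determined by finitely many coordinates at a time. This admits
  maps such as \<open>refine\<close>, which rotate infinitely many pairs and are no finite
  composition of rotations.\<close>

lemma preserving_local:
  assumes "\<And>J. finite J \<Longrightarrow> \<exists>g. preserving g \<and> (\<forall>\<omega>. \<forall>i\<in>J. f \<omega> i = g \<omega> i)"
  shows "preserving f"
proof -
  have m: "f \<in> measurable gseq gseq" unfolding measurable_gseq_iff
  proof
    fix i
    obtain g where g: "preserving g" "\<And>\<omega>. f \<omega> i = g \<omega> i" using assms[of "{i}"] by auto
    from g(1) have "(\<lambda>x. g x i) \<in> borel_measurable gseq"
      using preserving_measurable measurable_gseq_iff by blast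
    then show "(\<lambda>x. f x i) \<in> borel_measurable gseq" by (simp add: g(2))
  qed
  moreover have "distr gseq gseq f = gseq"
  proof (rule gseq_eqI)
    fix A :: "nat \<Rightarrow> real set" and J :: "nat set"
    assume J: "finite J" and A: "\<And>i. i \<in> J \<Longrightarrow> A i \<in> sets borel"
    obtain g where g: "preserving g" "\<And>\<omega> i. i \<in> J \<Longrightarrow> f \<omega> i = g \<omega> i" using assms[OF J] by auto
    let ?B = "{\<omega>. \<forall>i\<in>J. \<omega> i \<in> A i}"
    have "emeasure (distr gseq gseq f) ?B = emeasure (distr gseq gseq g) ?B"
      using J A m preserving_measurable[OF g(1)] g(2)
      by (auto simp: emeasure_distr intro!: arg_cong[where f = "emeasure gseq"])
    then show "emeasure (distr gseq gseq f) ?B = (\<Prod>i\<in>J. emeasure gaussian (A i))"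
      using g(1) emeasure_gseq_box[OF J A] by (simp add: preserving_def)
  qed simp
  ultimately show ?thesis by (simp add: preserving_def)
qed

section \<open>Rotation invariance of pairs of coordinates\<close>

lemma nn_integral_gaussian:
  assumes [measurable]: "f \<in> borel_measurable borel"
  shows "(\<integral>\<^sup>+x. f x \<partial>gaussian) = (\<integral>\<^sup>+x. ennreal (std_normal_density x) * f x \<partial>lborel)"
  unfolding gaussian_def by (subst nn_integral_density) auto

text \<open>The arguments on the left are \<open>(u + v) / sqrt 2\<close> and
  \<open>(u - v) / sqrt 2\<close>, whose squares have the same sum as those of \<open>u\<close> and
  \<open>v\<close>. They appear in the form that the substitutions in \<open>gaussian_rotate\<close>
  produce.\<close>

lemma std_normal_density_rotate:
  "std_normal_density (sqrt 2 * u - (u - v) / sqrt 2) * std_normal_density ((u - v) / sqrt 2)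
     = std_normal_density u * std_normal_density v"
proof -
  have e: "sqrt 2 * u - (u - v) / sqrt 2 = (u + v) / sqrt 2"
    by (simp add: field_simps)
  have "((u + v) / sqrt 2)\<^sup>2 + ((u - v) / sqrt 2)\<^sup>2 = u\<^sup>2 + v\<^sup>2"
    by (simp add: power_divide power2_eq_square field_simps)
  then have "- ((u + v) / sqrt 2)\<^sup>2 / 2 + - ((u - v) / sqrt 2)\<^sup>2 / 2 = - u\<^sup>2 / 2 + - v\<^sup>2 / 2"
    by simp
  then have "exp (- ((u + v) / sqrt 2)\<^sup>2 / 2) * exp (- ((u - v) / sqrt 2)\<^sup>2 / 2)
      = exp (- u\<^sup>2 / 2) * exp (- v\<^sup>2 / 2)"
    by (simp only: exp_add[symmetric])
  then show ?thesis
    unfolding e std_normal_density_def by (simp add: mult_ac)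
qed

text \<open>The orthogonal substitution is carried out one variable at a time:
  \<open>x = sqrt 2 * u - y\<close>, then \<open>y = (u - v) / sqrt 2\<close>. The two Jacobian
  factors cancel.\<close>

lemma gaussian_rotate:
  assumes f [measurable]: "case_prod f \<in> borel_measurable (borel \<Otimes>\<^sub>M borel)"
  shows "(\<integral>\<^sup>+x. \<integral>\<^sup>+y. f ((x + y) / sqrt 2) ((x - y) / sqrt 2) \<partial>gaussian \<partial>gaussian)
       = (\<integral>\<^sup>+x. \<integral>\<^sup>+y. f x y \<partial>gaussian \<partial>gaussian)"
proof -
  let ?d = "\<lambda>x. ennreal (std_normal_density x)"
  have f2: "(\<lambda>x. f (g x) (h x)) \<in> borel_measurable N"
    if "g \<in> borel_measurable N" "h \<in> borel_measurable N" for g h and N :: "'b measure"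
    using measurable_compose[OF measurable_Pair[OF that] f] by simp
  have [measurable]: "(\<lambda>(x, y). f ((x + y) / sqrt 2) ((x - y) / sqrt 2)) \<in> borel_measurable (borel \<Otimes>\<^sub>M borel)"
    "(\<lambda>(u, y). f u (u - sqrt 2 * y)) \<in> borel_measurable (borel \<Otimes>\<^sub>M borel)"
    unfolding case_prod_beta by (rule f2; measurable)+
  have "(\<integral>\<^sup>+x. \<integral>\<^sup>+y. f ((x + y) / sqrt 2) ((x - y) / sqrt 2) \<partial>gaussian \<partial>gaussian)
     = (\<integral>\<^sup>+x. \<integral>\<^sup>+y. ?d x * (?d y * f ((x + y) / sqrt 2) ((x - y) / sqrt 2)) \<partial>lborel \<partial>lborel)"
    by (simp add: nn_integral_gaussian nn_integral_cmult)
  also have "\<dots> = (\<integral>\<^sup>+y. \<integral>\<^sup>+x. ?d x * (?d y * f ((x + y) / sqrt 2) ((x - y) / sqrt 2)) \<partial>lborel \<partial>lborel)"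
    by (rule lborel_pair.Fubini') measurable
  also have "\<dots> = (\<integral>\<^sup>+y. \<integral>\<^sup>+u. ennreal (sqrt 2) * (?d (sqrt 2 * u - y) * (?d y * f u (u - sqrt 2 * y))) \<partial>lborel \<partial>lborel)"
  proof (rule nn_integral_cong)
    fix y :: real
    have e1: "(- y + sqrt 2 * u + y) / sqrt 2 = u" for u by simp
    have e2: "(- y + sqrt 2 * u - y) / sqrt 2 = u - sqrt 2 * y" for u
      by (simp add: field_simps)
    have e4: "(sqrt 2 * u - 2 * y) / sqrt 2 = u - sqrt 2 * y" for u
      by (simp add: field_simps)
    have e3: "- y + sqrt 2 * u = sqrt 2 * u - y" for u by simp
    have [measurable]: "(\<lambda>x. f ((x + y) / sqrt 2) ((x - y) / sqrt 2)) \<in> borel_measurable borel"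
      "(\<lambda>u. f u (u - sqrt 2 * y)) \<in> borel_measurable borel"
      by (rule f2; measurable)+
    show "(\<integral>\<^sup>+x. ?d x * (?d y * f ((x + y) / sqrt 2) ((x - y) / sqrt 2)) \<partial>lborel)
      = (\<integral>\<^sup>+u. ennreal (sqrt 2) * (?d (sqrt 2 * u - y) * (?d y * f u (u - sqrt 2 * y))) \<partial>lborel)"
      by (subst nn_integral_real_affine[where c = "sqrt 2" and t = "- y"])
        (simp_all add: e1 e2 e3 e4 nn_integral_cmult)
  qed
  also have "\<dots> = (\<integral>\<^sup>+u. \<integral>\<^sup>+y. ennreal (sqrt 2) * (?d (sqrt 2 * u - y) * (?d y * f u (u - sqrt 2 * y))) \<partial>lborel \<partial>lborel)"
    by (rule lborel_pair.Fubini') measurable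
  also have "\<dots> = (\<integral>\<^sup>+u. \<integral>\<^sup>+v. ?d u * (?d v * f u v) \<partial>lborel \<partial>lborel)"
  proof (rule nn_integral_cong)
    fix u :: real
    have e0: "u / sqrt 2 + (- 1 / sqrt 2) * v = (u - v) / sqrt 2" for v
      by (simp add: field_simps)
    have e1: "u - sqrt 2 * ((u - v) / sqrt 2) = v" for v by simp
    have e2: "?d (sqrt 2 * u - (u - v) / sqrt 2) * (?d ((u - v) / sqrt 2) * z) = ?d u * (?d v * z)" for v z
      using std_normal_density_rotate[of u v]
      by (simp add: mult.assoc[symmetric] ennreal_mult[symmetric])
    have e3: "ennreal (1 / sqrt 2) * (ennreal (sqrt 2) * z) = z" for z
      by (simp add: mult.assoc[symmetric] ennreal_mult[symmetric])
    have [measurable]: "(\<lambda>y. f u (u - sqrt 2 * y)) \<in> borel_measurable borel"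
      "(\<lambda>y. f u y) \<in> borel_measurable borel"
      by (rule f2; measurable)+
    have "(\<integral>\<^sup>+y. ennreal (sqrt 2) * (?d (sqrt 2 * u - y) * (?d y * f u (u - sqrt 2 * y))) \<partial>lborel)
      = ennreal (1 / sqrt 2) * (\<integral>\<^sup>+v. ennreal (sqrt 2) * (?d u * (?d v * f u v)) \<partial>lborel)"
      by (subst nn_integral_real_affine[where c = "- 1 / sqrt 2" and t = "u / sqrt 2"])
        (simp_all only: e0 e1 e2, simp_all)
    also have "\<dots> = (\<integral>\<^sup>+v. ?d u * (?d v * f u v) \<partial>lborel)"
      by (subst nn_integral_cmult) (simp_all add: e3)
    finally show "(\<integral>\<^sup>+y. ennreal (sqrt 2) * (?d (sqrt 2 * u - y) * (?d y * f u (u - sqrt 2 * y))) \<partial>lborel)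
      = (\<integral>\<^sup>+v. ?d u * (?d v * f u v) \<partial>lborel)" .
  qed
  also have "\<dots> = (\<integral>\<^sup>+x. \<integral>\<^sup>+y. f x y \<partial>gaussian \<partial>gaussian)"
    by (simp add: nn_integral_gaussian nn_integral_cmult)
  finally show ?thesis .
qed

definition rot :: "nat \<Rightarrow> nat \<Rightarrow> (nat \<Rightarrow> real) \<Rightarrow> nat \<Rightarrow> real" where
  "rot i j w = w(i := (w i + w j) / sqrt 2, j := (w i - w j) / sqrt 2)"

lemma preserving_rot:
  assumes ij: "i \<noteq> j" shows "preserving (rot i j)"
proof -
  have m [measurable]: "rot i j \<in> measurable gseq gseq"
    unfolding measurable_gseq_iff
  proof
    fix k
    consider "k = j" | "k = i" "k \<noteq> j" | "k \<noteq> i" "k \<noteq> j" by blast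
    then show "(\<lambda>x. rot i j x k) \<in> borel_measurable gseq"
      by cases (simp_all add: rot_def)
  qed
  have "distr gseq gseq (rot i j) = gseq"
  proof (rule measure_eqI)
    fix B assume "B \<in> sets (distr gseq gseq (rot i j))"
    then have B [measurable]: "B \<in> sets gseq" by simp
    \<comment> \<open>\<open>f x y\<close> overwrites both rotated coordinates, so freezing them one
      after the other in \<open>key\<close> reduces the claim to the planar identity
      \<open>gaussian_rotate\<close>.\<close>
    define f where "f x y w = (indicator B (w(i := x, j := y)) :: ennreal)" for x y w
    have upd [measurable]: "(\<lambda>(x, y, w). w(i := x, j := y)) \<in> measurable (borel \<Otimes>\<^sub>M borel \<Otimes>\<^sub>M gseq) gseq"
      unfolding measurable_gseq_iff
    proof
      fix k
      consider "k = j" | "k = i" "k \<noteq> j" | "k \<noteq> i" "k \<noteq> j" by blast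
      then show "(\<lambda>x. (case x of (x, y, w) \<Rightarrow> w(i := x, j := y)) k) \<in> borel_measurable (borel \<Otimes>\<^sub>M borel \<Otimes>\<^sub>M gseq)"
        by cases (simp_all add: case_prod_beta)
    qed
    have fm: "(\<lambda>z. f (a z) (b z) (c z)) \<in> borel_measurable N"
      if "a \<in> borel_measurable N" "b \<in> borel_measurable N" "c \<in> measurable N gseq" for a b c and N :: "'b measure"
      using measurable_compose[OF measurable_compose[OF measurable_Pair[OF that(1) measurable_Pair[OF that(2,3)]] upd],
          of "indicator B" "borel :: ennreal measure"]
      by (simp add: f_def)
    define g where "g x y = (\<integral>\<^sup>+w. f x y w \<partial>gseq)" for x y
    have gm: "case_prod g \<in> borel_measurable (borel \<Otimes>\<^sub>M borel)"
      unfolding g_def case_prod_beta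
      by (rule gseq.borel_measurable_nn_integral) (unfold case_prod_beta, rule fm; measurable)
    have key: "(\<integral>\<^sup>+w. f (a (w i) (w j)) (b (w i) (w j)) w \<partial>gseq)
        = (\<integral>\<^sup>+x. \<integral>\<^sup>+y. g (a x y) (b x y) \<partial>gaussian \<partial>gaussian)"
      if [measurable]: "case_prod a \<in> borel_measurable (borel \<Otimes>\<^sub>M borel)" "case_prod b \<in> borel_measurable (borel \<Otimes>\<^sub>M borel)"
      for a b :: "real \<Rightarrow> real \<Rightarrow> real"
    proof -
      have ab: "(\<lambda>z. a (u z) (v z)) \<in> borel_measurable N" "(\<lambda>z. b (u z) (v z)) \<in> borel_measurable N"
        if "u \<in> borel_measurable N" "v \<in> borel_measurable N" for u v and N :: "'b measure"
        using measurable_compose[OF measurable_Pair[OF that], of "case_prod a" borel]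
          measurable_compose[OF measurable_Pair[OF that], of "case_prod b" borel] by simp_all
      have up: "w(i := s, i := t, j := u) = w(i := t, j := u)" "w(j := s, i := t, j := u) = w(i := t, j := u)"
        for w :: "nat \<Rightarrow> real" and s t u using ij by auto
      have "(\<integral>\<^sup>+w. f (a (w i) (w j)) (b (w i) (w j)) w \<partial>gseq)
        = (\<integral>\<^sup>+x. \<integral>\<^sup>+w. f (a x (w j)) (b x (w j)) w \<partial>gseq \<partial>gaussian)"
        by (rule nn_integral_gseq_freeze)
          (use ij in \<open>auto simp: f_def up case_prod_beta' intro!: fm[unfolded f_def] ab\<close>)
      also have "\<dots> = (\<integral>\<^sup>+x. \<integral>\<^sup>+y. \<integral>\<^sup>+w. f (a x y) (b x y) w \<partial>gseq \<partial>gaussian \<partial>gaussian)"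
        by (intro nn_integral_cong nn_integral_gseq_freeze)
          (use ij in \<open>auto simp: f_def up case_prod_beta' intro!: fm[unfolded f_def] ab\<close>)
      finally show ?thesis by (simp add: g_def)
    qed
    have "emeasure (distr gseq gseq (rot i j)) B = (\<integral>\<^sup>+w. indicator B (rot i j w) \<partial>gseq)"
      using nn_integral_distr[OF m, of "indicator B"] nn_integral_indicator[of B "distr gseq gseq (rot i j)"]
      by simp
    also have "\<dots> = (\<integral>\<^sup>+w. f ((w i + w j) / sqrt 2) ((w i - w j) / sqrt 2) w \<partial>gseq)"
      by (simp add: f_def rot_def)
    also have "\<dots> = (\<integral>\<^sup>+x. \<integral>\<^sup>+y. g ((x + y) / sqrt 2) ((x - y) / sqrt 2) \<partial>gaussian \<partial>gaussian)"
      by (rule key) measurable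
    also have "\<dots> = (\<integral>\<^sup>+x. \<integral>\<^sup>+y. g x y \<partial>gaussian \<partial>gaussian)"
      by (rule gaussian_rotate[OF gm])
    also have "\<dots> = (\<integral>\<^sup>+w. f (w i) (w j) w \<partial>gseq)"
      by (rule key[symmetric]) measurable
    also have "\<dots> = emeasure gseq B"
      by (simp add: f_def)
    finally show "emeasure (distr gseq gseq (rot i j)) B = emeasure gseq B" .
  qed simp
  with m show ?thesis by (simp add: preserving_def)
qed

section \<open>The Gaussian tail function\<close>

text \<open>The complementary normal distribution function. It is decreasing, so a comparison of
  tail probabilities turns into the reversed comparison of arguments.\<close>

definition Psi :: "real \<Rightarrow> real" where
  "Psi x = measure gaussian {x<..}"

lemma Psi_nonneg: "0 \<le> Psi x" and Psi_le_1: "Psi x \<le> 1"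
  by (simp_all add: Psi_def)

lemma measure_gaussian:
  assumes "A \<in> sets borel"
  shows "measure gaussian A = (LINT x|lborel. std_normal_density x * indicator A x)"
proof -
  have "measure gaussian A = (LINT x|gaussian. indicator A x)" by simp
  also have "\<dots> = (LINT x|lborel. std_normal_density x * indicator A x)"
    unfolding gaussian_def using assms by (subst integral_density) auto
  finally show ?thesis .
qed

lemma Psi_diff:
  assumes "a \<le> b"
  shows "Psi a - Psi b = integral {a..b} std_normal_density"
proof -
  have "{a<..} = {a<..b} \<union> {b<..}" using assms by auto
  then have "Psi a = measure gaussian {a<..b} + Psi b"
    unfolding Psi_def by (simp add: gaussian.finite_measure_Union Int_def)
  moreover have "measure gaussian {a<..b} = (LINT x:{a<..b}|lborel. std_normal_density x)"
    by (simp add: measure_gaussian set_lebesgue_integral_def mult.commute)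
  moreover have "(LINT x:{a<..b}|lborel. std_normal_density x) = (LINT x:{a..b}|lborel. std_normal_density x)"
    unfolding set_lebesgue_integral_def
    by (rule integral_cong_AE) (use AE_lborel_singleton[of a] in \<open>auto elim!: eventually_mono simp: indicator_def\<close>)
  moreover have "(LINT x:{a..b}|lborel. std_normal_density x) = integral {a..b} std_normal_density"
    by (rule set_borel_integral_eq_integral) (auto simp: set_integrable_def intro!: integrable_mult_indicator[where 'b=real, simplified])
  ultimately show ?thesis by simp
qed

lemma continuous_on_std_normal_density: "continuous_on A std_normal_density"
  unfolding std_normal_density_def by (intro continuous_intros) auto

lemma DERIV_Psi: "(Psi has_real_derivative - std_normal_density x) (at x)"
proof -
  have "((\<lambda>y. integral {x - 1..y} std_normal_density) has_real_derivative std_normal_density x) (at x within {x - 1..x + 1})"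
    by (rule integral_has_real_derivative) (auto intro: continuous_on_std_normal_density)
  then have "((\<lambda>y. integral {x - 1..y} std_normal_density) has_real_derivative std_normal_density x) (at x)"
    by (subst (asm) at_within_Icc_at) auto
  then have "((\<lambda>y. Psi (x - 1) - integral {x - 1..y} std_normal_density) has_real_derivative - std_normal_density x) (at x)"
    by (auto intro!: derivative_eq_intros)
  then show ?thesis
  proof (rule DERIV_cong_ev[OF refl _ refl, THEN iffD1, rotated])
    have "eventually (\<lambda>y. y > x - 1) (nhds x)"
      by (rule eventually_nhds_in_open[of "{x - 1<..}", simplified]) auto
    then show "eventually (\<lambda>y. Psi (x - 1) - integral {x - 1..y} std_normal_density = Psi y) (nhds x)"
    proof (rule eventually_mono)
      fix y assume "y > x - 1"
      then have "x - 1 \<le> y" by simp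
      from Psi_diff[OF this]
      show "Psi (x - 1) - integral {x - 1..y} std_normal_density = Psi y" by linarith
    qed
  qed
qed

lemma Psi_strict_anti: "a < b \<Longrightarrow> Psi b < Psi a"
proof (rule DERIV_neg_imp_decreasing[where f = Psi])
  fix x
  show "\<exists>y. (Psi has_real_derivative y) (at x) \<and> y < 0"
    using DERIV_Psi[of x] normal_density_pos[of 1 0 x] by auto
qed

lemma Psi_le_iff: "Psi a \<le> Psi b \<longleftrightarrow> b \<le> a"
  using Psi_strict_anti[of a b] Psi_strict_anti[of b a] by (cases "a = b"; cases "a < b") auto

lemma Psi_minus: "Psi (- x) = 1 - Psi x"
proof -
  have "emeasure gaussian {x<..} = emeasure gaussian {..<- x}" for x :: real
  proof -
    have "emeasure gaussian {x<..} = (\<integral>\<^sup>+y. indicator {x<..} y \<partial>gaussian)" by simp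
    also have "\<dots> = (\<integral>\<^sup>+y. ennreal (std_normal_density y) * indicator {x<..} y \<partial>lborel)"
      by (rule nn_integral_gaussian) simp
    also have "\<dots> = (\<integral>\<^sup>+y. ennreal (std_normal_density y) * indicator {..<- x} y \<partial>lborel)"
      by (subst nn_integral_real_affine[where c = "-1" and t = 0])
        (auto intro!: nn_integral_cong simp: indicator_def std_normal_density_def)
    also have "\<dots> = (\<integral>\<^sup>+y. indicator {..<- x} y \<partial>gaussian)"
      by (rule nn_integral_gaussian[symmetric]) simp
    finally show ?thesis by simp
  qed
  from this[of x] have "Psi x = measure gaussian {..<- x}"
    by (simp add: Psi_def measure_def)
  moreover have "measure gaussian {- x} = 0"
    unfolding measure_gaussian[OF borel_singleton[OF sets.empty_sets]]
    by (rule integral_eq_zero_AE) (use AE_lborel_singleton[of "- x"] in \<open>auto elim!: eventually_mono simp: indicator_def\<close>)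
  moreover have "measure gaussian (UNIV - ({..<- x} \<union> {- x})) = 1 - (measure gaussian {..<- x} + measure gaussian {- x})"
    using gaussian.prob_compl[of "{..<- x} \<union> {- x}"] gaussian.finite_measure_Union[of "{..<- x}" "{- x}"]
    by (simp del: Un_insert_right)
  moreover have "UNIV - ({..<- x} \<union> {- x}) = {- x<..}" by auto
  ultimately show ?thesis by (simp add: Psi_def)
qed

lemma Psi_0: "Psi 0 = 1 / 2"
  using Psi_minus[of 0] by simp

lemma Psi_at_top: "(Psi \<longlongrightarrow> 0) at_top"
proof -
  interpret real_distribution gaussian
    unfolding gaussian_def by (rule real_dist_normal_dist)
  have "Psi = (\<lambda>x. 1 - cdf gaussian x)"
  proof
    fix x :: real
    have "UNIV - {..x} = {x<..}" by (auto simp: not_le)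
    then show "Psi x = 1 - cdf gaussian x"
      using gaussian.prob_compl[of "{..x}"] by (simp add: Psi_def cdf_def)
  qed
  moreover have "((\<lambda>x. 1 - cdf gaussian x) \<longlongrightarrow> 1 - 1) at_top"
    by (intro tendsto_intros cdf_lim_at_top_prob)
  ultimately show ?thesis by simp
qed

lemma Psi_pos: "0 < Psi x"
  using Psi_strict_anti[of x "x + 1"] Psi_nonneg[of "x + 1"] by linarith

lemma Psi_less_1: "Psi x < 1"
  using Psi_minus[of x] Psi_pos[of "- x"] by linarith

lemma Psi_surj:
  assumes "0 < u" "u < 1" obtains x where "Psi x = u"
proof -
  have ex: "\<exists>x. Psi x < e" if "e > 0" for e
    using order_tendstoD(2)[OF Psi_at_top that] by (auto dest: eventually_happens)
  obtain b where b: "Psi b < u" using ex assms by blast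
  obtain a where a: "Psi a < 1 - u" using ex[of "1 - u"] assms by auto
  then have "Psi (- a) > u" using Psi_minus[of a] by linarith
  then have "- a \<le> b" using b Psi_le_iff[of b "- a"] by linarith
  moreover have "continuous_on {- a..b} Psi"
    using DERIV_Psi by (intro DERIV_continuous_on) (auto intro: DERIV_subset)
  ultimately obtain x where "Psi x = u"
    using IVT2'[of Psi b u "- a"] b \<open>Psi (- a) > u\<close> by auto
  then show ?thesis by (rule that)
qed

lemma measurable_Psi [measurable]: "Psi \<in> borel_measurable borel"
  by (rule borel_measurable_continuous_onI) (rule DERIV_continuous_on, rule DERIV_subset[OF DERIV_Psi], simp)

text \<open>The probability integral transform: \<open>Psi\<close> of a standard normal variable is
  uniform, which is why \<open>quantile\<close> reproduces a prescribed law.\<close>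

lemma measure_Psi_ge:
  assumes "0 \<le> u" "u \<le> 1"
  shows "measure gaussian {z. u \<le> Psi z} = 1 - u"
proof -
  consider "u = 0" | "u = 1" | "0 < u" "u < 1" using assms by linarith
  then show ?thesis
  proof cases
    case 3
    then obtain x where x: "Psi x = u" by (rule Psi_surj)
    have "{z. u \<le> Psi z} = UNIV - {x<..}"
      unfolding x[symmetric] Psi_le_iff by auto
    then show ?thesis
      using gaussian.prob_compl[of "{x<..}"] x unfolding Psi_def by simp
  next
    case 2
    then have "{z. u \<le> Psi z} = {}" using Psi_less_1 by (auto simp: not_le)
    with 2 show ?thesis by simp
  qed (use gaussian.prob_space in \<open>auto simp: Psi_nonneg\<close>)
qed

text \<open>This replaces a local limit theorem: once ratios of consecutive masses are ordered, the tails are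
  ordered too, so no estimate of individual binomial coefficients is needed.\<close>

lemma single_crossing_tail:
  fixes \<alpha> \<beta> :: "nat \<Rightarrow> real"
  assumes sum: "sum \<alpha> {i0..K} = sum \<beta> {i0..K}"
    and cross: "\<And>j. i0 \<le> j \<Longrightarrow> j < K \<Longrightarrow> \<alpha> j \<le> \<beta> j \<Longrightarrow> \<alpha> (Suc j) \<le> \<beta> (Suc j)"
    and i: "i0 \<le> i" "i \<le> K"
  shows "sum \<alpha> {i..K} \<le> sum \<beta> {i..K}"
proof -
  have up': "j + d \<le> K \<longrightarrow> \<alpha> (j + d) \<le> \<beta> (j + d)" if "\<alpha> j \<le> \<beta> j" "i0 \<le> j" for j d
  proof (induction d)
    case (Suc d)
    show ?case using Suc cross[of "j + d"] that(2) by simp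
  qed (use that in simp)
  have up: "\<alpha> k \<le> \<beta> k" if "\<alpha> j \<le> \<beta> j" "i0 \<le> j" "j \<le> k" "k \<le> K" for j k
    using up'[OF that(1,2), of "k - j"] that(3,4) by simp
  show ?thesis
  proof (cases "\<alpha> i \<le> \<beta> i")
    case True
    then show ?thesis using up[of i] i by (intro sum_mono) auto
  next
    \<comment> \<open>If \<open>\<alpha>\<close> still exceeds \<open>\<beta>\<close> at
      \<open>i\<close>, it is at least \<open>\<beta>\<close> at every smaller index, and the
      equality of the totals transfers this to the complementary tail.\<close>
    case False
    have "\<beta> j \<le> \<alpha> j" if "j \<in> {i0..<i}" for j
      using up[of j i] that i False by force
    then have "sum \<beta> {i0..<i} \<le> sum \<alpha> {i0..<i}" by (rule sum_mono)
    moreover have "sum f {i0..K} = sum f {i0..<i} + sum f {i..K}" for f :: "nat \<Rightarrow> real"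
      using i sum.atLeastLessThan_concat[of i0 i "Suc K" f] by (simp add: atLeastLessThanSuc_atLeastAtMost)
    ultimately show ?thesis using sum by (simp add: sum.distrib)
  qed
qed

section \<open>Gaussian masses of neighbouring cells\<close>

lemma std_normal_density_scale:
  assumes "\<tau> > 0"
  shows "std_normal_density (y / sqrt \<tau>) = std_normal_density (x / sqrt \<tau>) * exp (- (y\<^sup>2 - x\<^sup>2) / (2 * \<tau>))"
proof -
  have sq: "(z / sqrt \<tau>)\<^sup>2 = z\<^sup>2 / \<tau>" for z
    using assms by (simp add: power_divide)
  have "- (y\<^sup>2 / \<tau>) / 2 = - (x\<^sup>2 / \<tau>) / 2 + - (y\<^sup>2 - x\<^sup>2) / (2 * \<tau>)"
    using assms by (simp add: field_simps)
  then show ?thesis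
    unfolding std_normal_density_def sq by (simp only: exp_add mult.assoc)
qed

lemma DERIV_Psi_scale:
  assumes "(f has_real_derivative f') (at x)"
  shows "((\<lambda>x. Psi (f x / c)) has_real_derivative - std_normal_density (f x / c) * (f' / c)) (at x)"
  using DERIV_chain2[OF DERIV_Psi DERIV_cdivide[OF assms, of c]] by simp

lemma DERIV_Psi_affine:
  "((\<lambda>x. Psi ((x + w) / c)) has_real_derivative - std_normal_density ((x + w) / c) * (1 / c)) (at x)"
  "((\<lambda>x. Psi (x / c)) has_real_derivative - std_normal_density (x / c) * (1 / c)) (at x)"
proof -
  have "((\<lambda>x. x + w) has_real_derivative 1) (at x)" "((\<lambda>x. x) has_real_derivative 1) (at x)"
    by (auto intro!: derivative_eq_intros)
  from this[THEN DERIV_Psi_scale]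
  show "((\<lambda>x. Psi ((x + w) / c)) has_real_derivative - std_normal_density ((x + w) / c) * (1 / c)) (at x)"
    "((\<lambda>x. Psi (x / c)) has_real_derivative - std_normal_density (x / c) * (1 / c)) (at x)" .
qed

text \<open>For variance \<open>\<tau>\<close> the normal density at \<open>x + 2\<close> is
  \<open>exp (- (2 * x + 2) / \<tau>)\<close> times that at \<open>x\<close>, and this factor is
  smallest at the right end \<open>b\<close>. The shift 2 is the spacing of the values
  \<open>2 * i - K\<close>.\<close>

lemma Psi_shift_lower:
  assumes \<tau>: "\<tau> > 0" and ab: "a \<le> b"
  shows "exp (- (2 * b + 2) / \<tau>) * (Psi (a / sqrt \<tau>) - Psi (b / sqrt \<tau>))
     \<le> Psi ((a + 2) / sqrt \<tau>) - Psi ((b + 2) / sqrt \<tau>)"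
proof -
  let ?c = "exp (- (2 * b + 2) / \<tau>)"
  let ?f = "\<lambda>x. Psi ((x + 2) / sqrt \<tau>) - ?c * Psi (x / sqrt \<tau>)"
  have "?f b \<le> ?f a"
  proof (rule DERIV_nonpos_imp_nonincreasing[OF ab, where f = ?f])
    fix x assume x: "a \<le> x" "x \<le> b"
    let ?D = "- std_normal_density ((x + 2) / sqrt \<tau>) * (1 / sqrt \<tau>) - ?c * (- std_normal_density (x / sqrt \<tau>) * (1 / sqrt \<tau>))"
    have "(?f has_real_derivative ?D) (at x)"
      by (intro DERIV_diff DERIV_cmult DERIV_Psi_affine)
    moreover have "?D \<le> 0"
    proof -
      have "?c \<le> exp (- ((x + 2)\<^sup>2 - x\<^sup>2) / (2 * \<tau>))"
      proof -
        have "- ((x + 2)\<^sup>2 - x\<^sup>2) / (2 * \<tau>) = - (2 * x + 2) / \<tau>"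
          using \<tau> by (simp add: power2_eq_square divide_simps) (simp add: algebra_simps)
        moreover have "- (2 * b + 2) / \<tau> \<le> - (2 * x + 2) / \<tau>"
          using x \<tau> by (intro divide_right_mono) auto
        ultimately show ?thesis by simp
      qed
      then have "?c * std_normal_density (x / sqrt \<tau>) \<le> std_normal_density ((x + 2) / sqrt \<tau>)"
        unfolding std_normal_density_scale[OF \<tau>, of "x + 2" x]
        by (subst mult.commute) (intro mult_left_mono, auto)
      then have "?c * std_normal_density (x / sqrt \<tau>) * (1 / sqrt \<tau>) \<le> std_normal_density ((x + 2) / sqrt \<tau>) * (1 / sqrt \<tau>)"
        using \<tau> by (intro mult_right_mono) auto
      then show ?thesis by simp
    qed
    ultimately show "\<exists>y. (?f has_real_derivative y) (at x) \<and> y \<le> 0" by blast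
  qed
  then show ?thesis by (simp add: algebra_simps)
qed

text \<open>For \<open>x \<ge> a\<close> the density at \<open>x + w\<close> is at most
  \<open>exp (- (a * w) / \<tau>)\<close> times that at \<open>x\<close>. So \<open>?f\<close>
  decreases towards its limit 0 at infinity and is nonnegative at \<open>a\<close>.\<close>

lemma Psi_shift_upper:
  assumes \<tau>: "\<tau> > 0" and w: "w \<ge> 0"
  shows "Psi ((a + w) / sqrt \<tau>) \<le> exp (- (a * w) / \<tau>) * Psi (a / sqrt \<tau>)"
proof -
  let ?c = "exp (- (a * w) / \<tau>)"
  let ?f = "\<lambda>x. ?c * Psi (x / sqrt \<tau>) - Psi ((x + w) / sqrt \<tau>)"
  have dec: "?f y \<le> ?f a" if "a \<le> y" for y
  proof (rule DERIV_nonpos_imp_nonincreasing[OF that, where f = ?f])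
    fix x assume x: "a \<le> x" "x \<le> y"
    let ?D = "?c * (- std_normal_density (x / sqrt \<tau>) * (1 / sqrt \<tau>)) - - std_normal_density ((x + w) / sqrt \<tau>) * (1 / sqrt \<tau>)"
    have "(?f has_real_derivative ?D) (at x)"
      by (intro DERIV_diff DERIV_cmult DERIV_Psi_affine)
    moreover have "?D \<le> 0"
    proof -
      have "a * w \<le> x * w" using x w by (intro mult_right_mono)
      then have "exp (- ((x + w)\<^sup>2 - x\<^sup>2) / (2 * \<tau>)) \<le> ?c"
      proof -
        have "a * w \<le> ((x + w)\<^sup>2 - x\<^sup>2) / 2"
        proof -
          have "((x + w)\<^sup>2 - x\<^sup>2) / 2 = x * w + w * w / 2"
            by (simp add: power2_eq_square algebra_simps)
          moreover have "0 \<le> w * w" by simp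
          ultimately show ?thesis using \<open>a * w \<le> x * w\<close> by linarith
        qed
        then have "(a * w) / \<tau> \<le> ((x + w)\<^sup>2 - x\<^sup>2) / 2 / \<tau>"
          using \<tau> by (intro divide_right_mono) auto
        then have "- ((x + w)\<^sup>2 - x\<^sup>2) / (2 * \<tau>) \<le> - (a * w) / \<tau>"
          unfolding minus_divide_left[symmetric] neg_le_iff_le divide_divide_eq_left by simp
        then show ?thesis by simp
      qed
      then have "std_normal_density ((x + w) / sqrt \<tau>) \<le> ?c * std_normal_density (x / sqrt \<tau>)"
        unfolding std_normal_density_scale[OF \<tau>, of "x + w" x]
        by (subst (2) mult.commute) (intro mult_left_mono, auto)
      then have "std_normal_density ((x + w) / sqrt \<tau>) * (1 / sqrt \<tau>) \<le> ?c * std_normal_density (x / sqrt \<tau>) * (1 / sqrt \<tau>)"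
        using \<tau> by (intro mult_right_mono) auto
      then show ?thesis by simp
    qed
    ultimately show "\<exists>y. (?f has_real_derivative y) (at x) \<and> y \<le> 0" by blast
  qed
  have "filterlim (\<lambda>x. x / sqrt \<tau>) at_top at_top" "filterlim (\<lambda>x. (x + w) / sqrt \<tau>) at_top at_top"
    using \<tau> by real_asymp+
  then have "(?f \<longlongrightarrow> ?c * 0 - 0) at_top"
    by (intro tendsto_intros filterlim_compose[OF Psi_at_top])
  then have "?c * 0 - 0 \<le> ?f a"
  proof (rule tendsto_upperbound)
    show "\<forall>\<^sub>F x in at_top. ?f x \<le> ?f a"
      using eventually_ge_at_top[of a] by (rule eventually_mono) (rule dec)
  qed simp
  then show ?thesis by simp
qed

text \<open>The number of up-steps is compared with a normal variable by integrating its law over the cells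
  between \<open>rho v\<close> and \<open>rho (v + 2)\<close>. The quadratic term makes the Gaussian mass of consecutive cells
  decay at least as fast as the discrete mass; the constant term compensates for the growth of the cells.\<close>

definition rho :: "real \<Rightarrow> real \<Rightarrow> real \<Rightarrow> real \<Rightarrow> real" where
  "rho \<kappa> \<delta> \<tau> x = (4 * \<kappa> + 4) + (1 + \<delta>) * x + \<kappa> * x\<^sup>2 / \<tau>"

lemma DERIV_rho: "(rho \<kappa> \<delta> \<tau> has_real_derivative (1 + \<delta>) + 2 * \<kappa> * x / \<tau>) (at x)"
proof -
  have "((\<lambda>x. a + b * x + k * x\<^sup>2) has_real_derivative b + 2 * k * x) (at x)" for a b k :: real
    by (auto intro!: derivative_eq_intros)
  from this[of "4 * \<kappa> + 4" "1 + \<delta>" "\<kappa> / \<tau>"] show ?thesis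
    by (simp add: rho_def[abs_def])
qed

lemma rho_diff: "rho \<kappa> \<delta> \<tau> (x + 2) - rho \<kappa> \<delta> \<tau> x = 2 * ((1 + \<delta>) + 2 * \<kappa> * (x + 1) / \<tau>)"
  by (simp add: rho_def power2_eq_square add_divide_distrib algebra_simps)

text \<open>The right side is the exponent by which the normal density drops from
  \<open>rho x\<close> to \<open>rho (x + 2)\<close>. It has to cover the discrete decay and in
  addition \<open>8 * \<kappa> / \<tau>\<close>, the price in \<open>rho_step\<close> for the growth
  of the derivative of \<open>rho\<close>.\<close>

lemma rho_square_diff:
  assumes \<tau>: "1 \<le> \<tau>" and \<kappa>: "1 \<le> \<kappa>" and \<delta>: "0 \<le> \<delta>" "\<delta> \<le> 1"
    and v: "1 \<le> v" and x: "v - 2 \<le> x" "x \<le> v"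
  shows "8 * \<kappa> / \<tau> + 2 * v / \<tau> * (1 + \<delta> + v / \<tau>) \<le> ((rho \<kappa> \<delta> \<tau> (x + 2))\<^sup>2 - (rho \<kappa> \<delta> \<tau> x)\<^sup>2) / (2 * \<tau>)"
proof -
  define y where "y = x + 1"
  have y: "0 \<le> y" "v \<le> y + 1" using v x by (auto simp: y_def)
  define A where "A = (1 + \<delta>) + 2 * \<kappa> * y / \<tau>"
  define B where "B = (4 * \<kappa> + 4) + (1 + \<delta>) * y"
  have pos: "0 \<le> \<kappa> * x\<^sup>2 / \<tau>" "0 \<le> \<kappa> * (x + 2)\<^sup>2 / \<tau>" "0 \<le> 2 * \<kappa> * y / \<tau>" using \<tau> \<kappa> y by auto
  have A: "1 + \<delta> \<le> A" "1 \<le> A" and B: "0 \<le> B"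
    using pos(3) \<delta> \<kappa> y by (auto simp: A_def B_def)
  have sum: "2 * B \<le> rho \<kappa> \<delta> \<tau> (x + 2) + rho \<kappa> \<delta> \<tau> x"
    using pos by (simp add: rho_def B_def y_def algebra_simps)
  have "(2 * A) * (2 * B) \<le> (2 * A) * (rho \<kappa> \<delta> \<tau> (x + 2) + rho \<kappa> \<delta> \<tau> x)"
    using sum A by (intro mult_left_mono) auto
  also have "\<dots> = (rho \<kappa> \<delta> \<tau> (x + 2))\<^sup>2 - (rho \<kappa> \<delta> \<tau> x)\<^sup>2"
    unfolding A_def y_def rho_diff[symmetric] by (simp add: power2_eq_square algebra_simps)
  finally have AB: "A * B \<le> ((rho \<kappa> \<delta> \<tau> (x + 2))\<^sup>2 - (rho \<kappa> \<delta> \<tau> x)\<^sup>2) / 4" by simp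
  \<comment> \<open>This explains the constant term \<open>4 * \<kappa> + 4\<close> of
    \<open>rho\<close>: the part \<open>4 * \<kappa>\<close> is kept, and 4 absorbs the two summands
    2 that arise when \<open>v\<close> is replaced by \<open>y + 1\<close>.\<close>
  have "4 * \<kappa> + v * (1 + \<delta> + v / \<tau>) \<le> A * B"
  proof -
    have "v * (1 + \<delta>) \<le> (y + 1) * (1 + \<delta>)" using y \<delta> by (intro mult_right_mono) auto
    also have "\<dots> \<le> (1 + \<delta>) * y + 2" using \<delta> by (simp add: algebra_simps)
    finally have 1: "v * (1 + \<delta>) \<le> (1 + \<delta>) * y + 2" .
    have "v * v \<le> (y + 1) * (y + 1)" using y v by (intro mult_mono) auto
    also have "\<dots> \<le> 2 * y\<^sup>2 + 2" using zero_le_power2[of "y - 1"] by (simp add: power2_eq_square algebra_simps)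
    finally have "v * v / \<tau> \<le> (2 * y\<^sup>2 + 2) / \<tau>" using \<tau> by (intro divide_right_mono) auto
    also have "\<dots> = 2 * (y\<^sup>2 / \<tau>) + 2 / \<tau>" by (simp add: add_divide_distrib)
    also have "\<dots> \<le> 2 * \<kappa> * (y\<^sup>2 / \<tau>) + 2"
      using \<tau> \<kappa> by (intro add_mono mult_right_mono) (auto simp: field_simps)
    finally have 2: "v * v / \<tau> \<le> 2 * \<kappa> * (y\<^sup>2 / \<tau>) + 2" .
    have 3: "1 * (4 * \<kappa> + 4) \<le> A * (4 * \<kappa> + 4)" using A \<kappa> by (intro mult_right_mono) auto
    have "1 * (2 * \<kappa> * y / \<tau> * y) \<le> (1 + \<delta>) * (2 * \<kappa> * y / \<tau> * y)"
      using \<delta> pos y by (intro mult_right_mono mult_nonneg_nonneg) auto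
    moreover have "1 * ((1 + \<delta>) * y) \<le> (1 + \<delta>) * ((1 + \<delta>) * y)"
      using \<delta> y by (intro mult_right_mono) auto
    ultimately have 4: "(1 + \<delta>) * y + 2 * \<kappa> * (y\<^sup>2 / \<tau>) \<le> A * ((1 + \<delta>) * y)"
      by (simp add: A_def power2_eq_square algebra_simps)
    have "A * B = A * (4 * \<kappa> + 4) + A * ((1 + \<delta>) * y)" by (simp add: B_def algebra_simps)
    moreover have "v * (1 + \<delta> + v / \<tau>) = v * (1 + \<delta>) + v * v / \<tau>" by (simp add: algebra_simps)
    ultimately have "4 * \<kappa> + v * (1 + \<delta> + v / \<tau>) = 4 * \<kappa> + v * (1 + \<delta>) + v * v / \<tau>" by simp
    also have "\<dots> \<le> 4 * \<kappa> + ((1 + \<delta>) * y + 2) + (2 * \<kappa> * (y\<^sup>2 / \<tau>) + 2)"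
      using 1 2 by (intro add_mono) auto
    also have "\<dots> = (4 * \<kappa> + 4) + ((1 + \<delta>) * y + 2 * \<kappa> * (y\<^sup>2 / \<tau>))" by simp
    also have "\<dots> \<le> A * (4 * \<kappa> + 4) + A * ((1 + \<delta>) * y)"
      using 3 4 by (intro add_mono) auto
    finally show ?thesis by (simp add: B_def algebra_simps)
  qed
  with AB have "4 * \<kappa> + v * (1 + \<delta> + v / \<tau>) \<le> ((rho \<kappa> \<delta> \<tau> (x + 2))\<^sup>2 - (rho \<kappa> \<delta> \<tau> x)\<^sup>2) / 4" by linarith
  then have "(4 * \<kappa> + v * (1 + \<delta> + v / \<tau>)) * (2 / \<tau>) \<le> ((rho \<kappa> \<delta> \<tau> (x + 2))\<^sup>2 - (rho \<kappa> \<delta> \<tau> x)\<^sup>2) / 4 * (2 / \<tau>)"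
    using \<tau> by (intro mult_right_mono) auto
  moreover have "(4 * \<kappa> + v * (1 + \<delta> + v / \<tau>)) * (2 / \<tau>) = 8 * \<kappa> / \<tau> + 2 * v / \<tau> * (1 + \<delta> + v / \<tau>)"
    by (simp add: algebra_simps add_divide_distrib)
  moreover have "((rho \<kappa> \<delta> \<tau> (x + 2))\<^sup>2 - (rho \<kappa> \<delta> \<tau> x)\<^sup>2) / 4 * (2 / \<tau>) = ((rho \<kappa> \<delta> \<tau> (x + 2))\<^sup>2 - (rho \<kappa> \<delta> \<tau> x)\<^sup>2) / (2 * \<tau>)"
    by (simp add: diff_divide_distrib)
  ultimately show ?thesis by linarith
qed

text \<open>Both cell masses are integrals over \<open>x\<close> in \<open>[v - 2, v]\<close>, so it
  is enough to compare, at \<open>x + 2\<close> and at \<open>x\<close>, the density at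
  \<open>rho\<close> times the derivative of \<open>rho\<close>.\<close>

lemma rho_step:
  assumes \<tau>: "1 \<le> \<tau>" and \<kappa>: "1 \<le> \<kappa>" "4 * \<kappa> \<le> \<tau>" and \<delta>: "0 \<le> \<delta>" "\<delta> \<le> 1" and v: "1 \<le> v"
  shows "Psi (rho \<kappa> \<delta> \<tau> v / sqrt \<tau>) - Psi (rho \<kappa> \<delta> \<tau> (v + 2) / sqrt \<tau>)
    \<le> exp (- (2 * v / \<tau> * (1 + \<delta> + v / \<tau>))) * (Psi (rho \<kappa> \<delta> \<tau> (v - 2) / sqrt \<tau>) - Psi (rho \<kappa> \<delta> \<tau> v / sqrt \<tau>))"
proof -
  let ?r = "rho \<kappa> \<delta> \<tau>"
  let ?c = "exp (- (2 * v / \<tau> * (1 + \<delta> + v / \<tau>)))"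
  let ?f = "\<lambda>x. Psi (?r (x + 2) / sqrt \<tau>) - ?c * Psi (?r x / sqrt \<tau>)"
  define r' where "r' x = (1 + \<delta>) + 2 * \<kappa> * x / \<tau>" for x
  have "?f (v - 2) \<le> ?f v"
  proof (rule DERIV_nonneg_imp_nondecreasing[where f = ?f])
    fix x assume x: "v - 2 \<le> x" "x \<le> v"
    let ?D = "- std_normal_density (?r (x + 2) / sqrt \<tau>) * (r' (x + 2) / sqrt \<tau>)
        - ?c * (- std_normal_density (?r x / sqrt \<tau>) * (r' x / sqrt \<tau>))"
    have "((\<lambda>x. ?r (x + 2)) has_real_derivative r' (x + 2)) (at x)"
      using DERIV_shift[of ?r "r' (x + 2)" x 2] DERIV_rho[of \<kappa> \<delta> \<tau> "x + 2"] by (simp add: r'_def)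
    moreover have "(?r has_real_derivative r' x) (at x)"
      unfolding r'_def by (rule DERIV_rho)
    ultimately have "(?f has_real_derivative ?D) (at x)"
      by (intro DERIV_diff DERIV_cmult DERIV_Psi_scale)
    moreover have "0 \<le> ?D"
    proof -
      let ?E = "exp (- ((?r (x + 2))\<^sup>2 - (?r x)\<^sup>2) / (2 * \<tau>))"
      \<comment> \<open>The leftmost point is \<open>x = - 1\<close>; there
        \<open>4 * \<kappa> \<le> \<tau>\<close> keeps the derivative \<open>r'\<close> at least
        1/2.\<close>
      have "- (1 / 2) \<le> 2 * \<kappa> * x / \<tau>"
      proof -
        have "- (2 * \<kappa>) \<le> 2 * \<kappa> * x"
        proof -
          have "2 * \<kappa> * (- 1) \<le> 2 * \<kappa> * x" using x v \<kappa> by (intro mult_left_mono) auto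
          then show ?thesis by simp
        qed
        then have "- \<tau> / 2 \<le> 2 * \<kappa> * x" using \<kappa> by linarith
        then have "- \<tau> / 2 / \<tau> \<le> 2 * \<kappa> * x / \<tau>" using \<tau> by (intro divide_right_mono) auto
        then show ?thesis using \<tau> by simp
      qed
      then have r': "1 / 2 \<le> r' x" using \<delta> by (simp add: r'_def)
      have "r' (x + 2) = r' x + (1 / 2) * (8 * \<kappa> / \<tau>)"
        by (simp add: r'_def add_divide_distrib algebra_simps)
      also have "\<dots> \<le> r' x + r' x * (8 * \<kappa> / \<tau>)"
        using r' \<kappa> \<tau> by (intro add_left_mono mult_right_mono) auto
      also have "\<dots> = r' x * (1 + 8 * \<kappa> / \<tau>)" by (simp add: algebra_simps)
      also have "\<dots> \<le> r' x * exp (8 * \<kappa> / \<tau>)"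
        using r' by (intro mult_left_mono) auto
      finally have 1: "r' (x + 2) \<le> r' x * exp (8 * \<kappa> / \<tau>)" .
      have "- ((?r (x + 2))\<^sup>2 - (?r x)\<^sup>2) / (2 * \<tau>) + 8 * \<kappa> / \<tau> \<le> - (2 * v / \<tau> * (1 + \<delta> + v / \<tau>))"
        using rho_square_diff[OF \<tau> \<kappa>(1) \<delta> v x] by linarith
      then have 2: "?E * exp (8 * \<kappa> / \<tau>) \<le> ?c"
        unfolding exp_add[symmetric] by simp
      have "?E * r' (x + 2) \<le> ?E * (r' x * exp (8 * \<kappa> / \<tau>))"
        using 1 by (intro mult_left_mono) auto
      also have "\<dots> = (?E * exp (8 * \<kappa> / \<tau>)) * r' x" by simp
      also have "\<dots> \<le> ?c * r' x" using 2 r' by (intro mult_right_mono) auto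
      finally have 3: "?E * r' (x + 2) \<le> ?c * r' x" .
      have "std_normal_density (?r (x + 2) / sqrt \<tau>) * (r' (x + 2) / sqrt \<tau>)
          = std_normal_density (?r x / sqrt \<tau>) / sqrt \<tau> * (?E * r' (x + 2))"
        using \<tau> by (subst std_normal_density_scale[of \<tau> "?r (x + 2)" "?r x"]) auto
      also have "\<dots> \<le> std_normal_density (?r x / sqrt \<tau>) / sqrt \<tau> * (?c * r' x)"
        using \<tau> by (intro mult_left_mono[OF 3]) auto
      also have "\<dots> = ?c * (std_normal_density (?r x / sqrt \<tau>) * (r' x / sqrt \<tau>))" by simp
      finally show ?thesis by simp
    qed
    ultimately show "\<exists>y. (?f has_real_derivative y) (at x) \<and> 0 \<le> y" by blast
  qed simp
  then show ?thesis by (simp add: algebra_simps)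
qed

text \<open>The last cell receives the whole remaining Gaussian tail. The choice
  \<open>\<kappa> = 4 / \<epsilon>\<^sup>2\<close> makes the decay exponent of this tail exceed the
  discrete exponent by at least 1, and the gained factor \<open>exp (- 1) \<le> 1 / 2\<close> allows
  the tail to be bounded by the preceding cell alone.\<close>

lemma rho_last:
  assumes \<epsilon>: "0 < \<epsilon>" "\<epsilon> \<le> 1" and \<tau>: "16 / \<epsilon>\<^sup>2 \<le> \<tau>" and \<delta>: "0 \<le> \<delta>" "\<delta> \<le> 1"
    and v: "1 \<le> v" "\<epsilon> * \<tau> - 2 < v" "v \<le> \<epsilon> * \<tau>"
  defines "\<kappa> \<equiv> 4 / \<epsilon>\<^sup>2"
  shows "Psi (rho \<kappa> \<delta> \<tau> v / sqrt \<tau>)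
    \<le> exp (- (2 * v / \<tau> * (1 + \<delta> + v / \<tau>))) * (Psi (rho \<kappa> \<delta> \<tau> (v - 2) / sqrt \<tau>) - Psi (rho \<kappa> \<delta> \<tau> v / sqrt \<tau>))"
proof -
  let ?r = "rho \<kappa> \<delta> \<tau>"
  let ?c = "exp (- (2 * v / \<tau> * (1 + \<delta> + v / \<tau>)))"
  define x where "x = v - 2"
  define a where "a = ?r x"
  define w where "w = ?r v - ?r x"
  have \<epsilon>2: "\<epsilon>\<^sup>2 \<le> \<epsilon>" "\<epsilon>\<^sup>2 \<le> 1" "0 < \<epsilon>\<^sup>2"
    using \<epsilon> by (auto simp: power2_eq_square mult_le_one mult_left_le)
  have \<kappa>: "4 \<le> \<kappa>" using \<epsilon>2 by (simp add: \<kappa>_def field_simps)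
  have "16 \<le> \<tau> * \<epsilon>\<^sup>2" using \<tau> \<epsilon>2 by (simp add: field_simps)
  also have "\<dots> \<le> \<tau> * \<epsilon>" using \<epsilon>2 \<tau> by (intro mult_left_mono) (auto intro: order_trans[rotated])
  finally have \<epsilon>\<tau>: "16 \<le> \<epsilon> * \<tau>" by (simp add: mult.commute)
  have \<tau>1: "1 \<le> \<tau>"
  proof -
    have "16 \<le> 16 / \<epsilon>\<^sup>2" using \<epsilon>2 by (simp add: le_divide_eq)
    with \<tau> show ?thesis by linarith
  qed
  have x: "\<epsilon> * \<tau> / 2 \<le> x" "0 \<le> x" "\<epsilon> * \<tau> / 2 \<le> v" "0 \<le> v" using v \<epsilon>\<tau> by (auto simp: x_def)
  have w: "w = 2 * ((1 + \<delta>) + 2 * \<kappa> * (x + 1) / \<tau>)"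
    using rho_diff[of \<kappa> \<delta> \<tau> x] by (simp add: w_def x_def)
  have a: "(1 + \<delta>) * v \<le> a"
  proof -
    have "0 \<le> \<kappa> * x\<^sup>2 / \<tau>" using \<kappa> \<tau>1 by auto
    then show ?thesis using \<delta> \<kappa> by (simp add: a_def rho_def x_def algebra_simps)
  qed
  have w2: "2 + 4 * \<kappa> * x / \<tau> \<le> w"
  proof -
    have "2 * \<kappa> * x / \<tau> \<le> 2 * \<kappa> * (x + 1) / \<tau>" using \<kappa> \<tau>1 by (intro divide_right_mono) auto
    then show ?thesis using \<delta> by (simp add: w)
  qed
  have w0: "0 \<le> w" using w2 \<kappa> x \<tau>1 by (auto intro: order_trans[rotated])
  have "(1 + \<delta>) * v * (2 + 4 * \<kappa> * x / \<tau>) \<le> a * w"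
    using a w2 \<delta> x \<kappa> \<tau>1 by (intro mult_mono) (auto intro: order_trans[rotated])
  then have "(1 + \<delta>) * v * (2 + 4 * \<kappa> * x / \<tau>) / \<tau> \<le> a * w / \<tau>"
    using \<tau>1 by (intro divide_right_mono) auto
  moreover have "1 + 2 * v / \<tau> * (1 + \<delta> + v / \<tau>) \<le> (1 + \<delta>) * v * (2 + 4 * \<kappa> * x / \<tau>) / \<tau>"
  proof -
    have q: "\<epsilon> / 2 \<le> x / \<tau>" "\<epsilon> / 2 \<le> v / \<tau>" "v / \<tau> \<le> \<epsilon>"
      using x v \<tau>1 by (auto simp: field_simps)
    have "4 = 4 * \<kappa> * ((\<epsilon> / 2) * (\<epsilon> / 2))" using \<epsilon> by (simp add: \<kappa>_def power2_eq_square)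
    also have "\<dots> \<le> 4 * \<kappa> * ((v / \<tau>) * (x / \<tau>))"
      using q \<epsilon> \<kappa> x \<tau>1 by (intro mult_left_mono mult_mono divide_nonneg_nonneg) auto
    also have "\<dots> \<le> (1 + \<delta>) * (4 * \<kappa> * ((v / \<tau>) * (x / \<tau>)))"
      using \<delta> \<kappa> x \<tau>1 by (intro mult_right_mono[of 1 "1 + \<delta>", simplified]) auto
    finally have 1: "4 \<le> (1 + \<delta>) * (4 * \<kappa> * ((v / \<tau>) * (x / \<tau>)))" .
    have "v / \<tau> \<le> 1" using q \<epsilon> by linarith
    moreover have "0 \<le> v / \<tau>" using x \<tau>1 by simp
    ultimately have vv: "(v / \<tau>) * (v / \<tau>) \<le> 1 * 1" by (intro mult_mono) simp_all
    have E1: "1 + 2 * v / \<tau> * (1 + \<delta> + v / \<tau>) = 1 + 2 * (1 + \<delta>) * (v / \<tau>) + 2 * ((v / \<tau>) * (v / \<tau>))"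
      by (simp add: algebra_simps add_divide_distrib)
    have E2: "(1 + \<delta>) * v * (2 + 4 * \<kappa> * x / \<tau>) / \<tau> = 2 * (1 + \<delta>) * (v / \<tau>) + (1 + \<delta>) * (4 * \<kappa> * ((v / \<tau>) * (x / \<tau>)))"
      by (simp add: algebra_simps add_divide_distrib)
    show ?thesis unfolding E1 E2 using 1 vv by linarith
  qed
  ultimately have e: "1 + 2 * v / \<tau> * (1 + \<delta> + v / \<tau>) \<le> a * w / \<tau>" by linarith
  have "Psi (?r v / sqrt \<tau>) \<le> exp (- (a * w) / \<tau>) * Psi (?r x / sqrt \<tau>)"
    using Psi_shift_upper[of \<tau> w a] \<tau>1 w0 by (simp add: a_def w_def)
  also have "\<dots> \<le> (?c / 2) * Psi (?r x / sqrt \<tau>)"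
  proof (rule mult_right_mono[OF _ Psi_nonneg])
    have "exp (- (a * w) / \<tau>) \<le> exp (- (2 * v / \<tau> * (1 + \<delta> + v / \<tau>)) + - 1)"
      using e by simp
    also have "\<dots> = ?c * exp (- 1)" by (simp only: exp_add)
    also have "\<dots> \<le> ?c * (1 / 2)"
      using exp_ge_add_one_self[of 1] by (intro mult_left_mono) (auto simp: exp_minus field_simps)
    finally show "exp (- (a * w) / \<tau>) \<le> ?c / 2" by simp
  qed
  finally have 1: "2 * Psi (?r v / sqrt \<tau>) \<le> ?c * Psi (?r x / sqrt \<tau>)" by simp
  \<comment> \<open>With \<open>P\<close> and \<open>Q\<close> for the tails at \<open>v\<close> and
    at \<open>x\<close>, the bounds \<open>2 * P \<le> ?c * Q\<close> and
    \<open>?c * P \<le> P\<close> give \<open>P \<le> ?c * (Q - P)\<close>.\<close>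
  have "?c * Psi (?r v / sqrt \<tau>) \<le> 1 * Psi (?r v / sqrt \<tau>)"
    using \<delta> x \<tau>1 Psi_nonneg by (intro mult_right_mono) auto
  with 1 show ?thesis by (simp add: x_def algebra_simps)
qed

section \<open>Quantile transforms of symmetric distributions\<close>

lemma sum_telescope_down:
  fixes g :: "nat \<Rightarrow> real"
  shows "i \<le> Suc K \<Longrightarrow> (\<Sum>j=i..K. g j - g (Suc j)) = g i - g (Suc K)"
  by (induction K) (auto simp: le_Suc_eq)

text \<open>\<open>p\<close> is the law of a count \<open>X\<close> symmetric about
  \<open>K / 2\<close>, and \<open>\<tau>\<close> stands for the variance of
  \<open>2 * X - K\<close>. The exponent in \<open>ratio_le\<close> is the exact logarithmic
  decrement of a normal density of variance \<open>\<tau>\<close> from \<open>2 * j - K\<close> to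
  \<open>2 * j + 2 - K\<close>.\<close>

locale symmetric_pmf =
  fixes p :: "nat \<Rightarrow> real" and K :: nat and \<tau> :: real
  assumes p_nonneg: "0 \<le> p i"
    and p_sum: "sum p {..K} = 1"
    and p_sym: "i \<le> K \<Longrightarrow> p (K - i) = p i"
    and tau_ge_1: "1 \<le> \<tau>"
    and ratio_le: "j < K \<Longrightarrow> K \<le> 2 * j \<Longrightarrow>
      p (Suc j) \<le> exp (- (2 * (2 * real j + 1 - real K) / \<tau>)) * p j"
begin

definition T :: "nat \<Rightarrow> real" where "T i = sum p {i..K}"

lemma sum_lessThan_eq_T: "i \<le> Suc K \<Longrightarrow> sum p {..<i} = T (Suc K - i)"
  unfolding T_def
  by (rule sum.reindex_bij_witness[of _ "\<lambda>j. K - j" "\<lambda>j. K - j"]) (auto simp: p_sym)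

lemma T_split: "i \<le> Suc K \<Longrightarrow> sum p {..<i} + T i = 1"
  using sum.atLeastLessThan_concat[of 0 i "Suc K" p] p_sum
  by (simp add: T_def atLeast0LessThan atLeastLessThanSuc_atLeastAtMost lessThan_Suc_atMost atMost_atLeast0)

lemma T_antimono: "i \<le> j \<Longrightarrow> T j \<le> T i"
  unfolding T_def by (rule sum_mono2) (auto simp: p_nonneg)

lemma T_le_half: "K < 2 * i \<Longrightarrow> i \<le> Suc K \<Longrightarrow> 2 * T i \<le> 1"
proof -
  assume i: "K < 2 * i" "i \<le> Suc K"
  then have "Suc K - i \<le> i" by arith
  from T_antimono[OF this] show ?thesis
    using T_split[OF i(2)] sum_lessThan_eq_T[OF i(2)] by linarith
qed

text \<open>On the indices with \<open>K \<le> 2 * j\<close> this is the law of the larger of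
  \<open>X\<close> and \<open>K - X\<close>. Folding gives total mass 1, comparable with twice the
  upper Gaussian tail, which is 1 at the point 0.\<close>

definition half_mass :: "nat \<Rightarrow> real" where
  "half_mass j = (if 2 * j = K then 1 else 2) * p j"

lemma half_mass_nonneg: "0 \<le> half_mass j" and half_mass_le: "half_mass j \<le> 2 * p j"
  by (simp_all add: half_mass_def p_nonneg)

lemma half_mass_tail: "K < 2 * i \<Longrightarrow> sum half_mass {i..K} = 2 * T i"
  unfolding T_def sum_distrib_left by (rule sum.cong) (auto simp: half_mass_def)

lemma half_mass_total: "sum half_mass {Suc K div 2..K} = 1"
proof (cases "even K")
  case True
  then obtain c where c: "2 * c = K" by (metis evenE)
  have "sum half_mass {c..K} = half_mass c + sum half_mass {Suc c..K}"
    using c by (simp add: sum.atLeast_Suc_atMost)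
  also have "\<dots> = p c + 2 * T (Suc c)"
    using c half_mass_tail[of "Suc c"] by (simp add: half_mass_def)
  also have "\<dots> = 1"
  proof -
    have "c \<le> Suc K" "Suc c \<le> Suc K" "Suc K - c = Suc c" using c by auto
    then show ?thesis using T_split[of "Suc c"] sum_lessThan_eq_T[of c] by simp
  qed
  finally show ?thesis using c by auto
next
  case False
  then obtain c where c: "2 * c + 1 = K" by (metis oddE)
  then have "Suc c \<le> Suc K" "Suc K - Suc c = Suc c" "K < 2 * Suc c" "Suc K div 2 = Suc c" by auto
  then show ?thesis
    using half_mass_tail[of "Suc c"] T_split[of "Suc c"] sum_lessThan_eq_T[of "Suc c"] by simp
qed

text \<open>\<open>single_crossing_tail\<close> compares the folded law with the modulus of a normal
  variable of variance \<open>\<tau>\<close>, cut at the points \<open>w j\<close>. The cell of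
  \<open>j\<close> ends at \<open>v - 1\<close> with \<open>v = 2 * j + 1 - K\<close>, so the factor
  in \<open>Psi_shift_lower\<close> is \<open>exp (- (2 * v / \<tau>))\<close>, the same as in
  \<open>ratio_le\<close>.\<close>

lemma upper_tail:
  assumes i: "K < 2 * i" "i \<le> K"
  shows "T i \<le> Psi ((2 * real i - 2 - real K) / sqrt \<tau>)"
proof -
  define i0 where "i0 = Suc K div 2"
  define w where "w j = max 0 (2 * real j - 2 - real K)" for j
  define g where "g j = (if j \<le> K then 2 * Psi (w j / sqrt \<tau>) else 0)" for j
  have i0: "i0 \<le> i" "2 * i0 \<le> Suc K" using i by (auto simp: i0_def)
  have "w i0 = 0" using i0 by (simp add: w_def)
  have "sum half_mass {i..K} \<le> (\<Sum>j=i..K. g j - g (Suc j))"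
  proof (rule single_crossing_tail[of half_mass i0 K "\<lambda>j. g j - g (Suc j)"])
    have "(\<Sum>j=i0..K. g j - g (Suc j)) = g i0 - g (Suc K)"
      using i0 i by (intro sum_telescope_down) auto
    also have "\<dots> = 1" using i0 i \<open>w i0 = 0\<close> by (simp add: g_def Psi_0)
    finally show "sum half_mass {i0..K} = (\<Sum>j=i0..K. g j - g (Suc j))"
      using half_mass_total by (simp add: i0_def)
  next
    fix j assume j: "i0 \<le> j" "j < K" and le: "half_mass j \<le> g j - g (Suc j)"
    have Kj: "K \<le> 2 * j" using j by (auto simp: i0_def)
    let ?v = "2 * real j + 1 - real K"
    have wS: "w (Suc j) = ?v - 1" using Kj by (auto simp: w_def)
    have wSS: "w (Suc (Suc j)) = w (Suc j) + 2" using Kj by (auto simp: w_def)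
    have wj: "w j \<le> w (Suc j)" "w (Suc j) \<le> w j + 2" by (auto simp: w_def)
    let ?c = "exp (- (2 * ?v / \<tau>))"
    have next_ge: "2 * (Psi (w (Suc j) / sqrt \<tau>) - Psi (w (Suc (Suc j)) / sqrt \<tau>)) \<le> g (Suc j) - g (Suc (Suc j))"
      using j Psi_nonneg by (simp add: g_def)
    have gj: "g j - g (Suc j) = 2 * (Psi (w j / sqrt \<tau>) - Psi (w (Suc j) / sqrt \<tau>))"
      using j by (simp add: g_def)
    show "half_mass (Suc j) \<le> g (Suc j) - g (Suc (Suc j))"
    proof (cases "2 * j = K")
      \<comment> \<open>At the centre the cell of \<open>j\<close> is empty, so the crossing
        hypothesis forces \<open>p j = 0\<close>.\<close>
      case True
      then have "w j = w (Suc j)" by (auto simp: w_def)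
      then have "half_mass j \<le> 0" using le gj by simp
      then have "p j = 0" using True p_nonneg[of j] by (simp add: half_mass_def)
      then have "p (Suc j) = 0" using ratio_le[OF j(2) Kj] p_nonneg[of "Suc j"] by simp
      moreover have "Psi (w (Suc (Suc j)) / sqrt \<tau>) \<le> Psi (w (Suc j) / sqrt \<tau>)"
        using tau_ge_1 by (simp add: Psi_le_iff wSS divide_right_mono)
      ultimately show ?thesis using next_ge by (simp add: half_mass_def)
    next
      case False
      then have "half_mass (Suc j) \<le> ?c * half_mass j"
        using ratio_le[OF j(2) Kj] Kj by (simp add: half_mass_def)
      also have "\<dots> \<le> ?c * (g j - g (Suc j))" using le by (intro mult_left_mono) auto
      also have "\<dots> = 2 * (exp (- (2 * w (Suc j) + 2) / \<tau>) * (Psi (w j / sqrt \<tau>) - Psi (w (Suc j) / sqrt \<tau>)))"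
      proof -
        have "2 * ?v = 2 * w (Suc j) + 2" using wS by simp
        then have "?c = exp (- (2 * w (Suc j) + 2) / \<tau>)" by (simp only: minus_divide_left)
        then show ?thesis by (simp only: gj mult.left_commute)
      qed
      also have "\<dots> \<le> 2 * (Psi ((w j + 2) / sqrt \<tau>) - Psi ((w (Suc j) + 2) / sqrt \<tau>))"
        using Psi_shift_lower[OF _ wj(1), of \<tau>] tau_ge_1 by simp
      \<comment> \<open>The cell shifted by 2 lies inside the next cell because
        \<open>w (Suc j) \<le> w j + 2\<close>.\<close>
      also have "\<dots> \<le> 2 * (Psi (w (Suc j) / sqrt \<tau>) - Psi (w (Suc (Suc j)) / sqrt \<tau>))"
        using wj(2) tau_ge_1 by (simp add: wSS Psi_le_iff divide_right_mono)
      finally show ?thesis using next_ge by linarith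
    qed
  qed (use i i0 in auto)
  also have "(\<Sum>j=i..K. g j - g (Suc j)) = g i - g (Suc K)"
    using i by (intro sum_telescope_down) auto
  also have "\<dots> = 2 * Psi (w i / sqrt \<tau>)" using i by (simp add: g_def)
  finally have "T i \<le> Psi (w i / sqrt \<tau>)" using half_mass_tail[OF i(1)] by simp
  also have "\<dots> \<le> Psi ((2 * real i - 2 - real K) / sqrt \<tau>)"
    using tau_ge_1 by (simp add: Psi_le_iff w_def divide_right_mono)
  finally show ?thesis .
qed

end

text \<open>\<open>\<delta>\<close> measures how much faster than normal the masses may decay near
  the centre, and \<open>ratio_ge\<close> concerns moderate deviations
  \<open>v \<le> \<epsilon> * \<tau>\<close> only. The binomial law has \<open>\<delta> = 0\<close>;
  for a hypergeometric law \<open>\<delta>\<close> is twice a squared relative imbalance.\<close>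

locale symmetric_pmf_lower = symmetric_pmf +
  fixes \<delta> \<epsilon> :: real
  assumes delta: "0 \<le> \<delta>" "\<delta> \<le> 1" and eps: "0 < \<epsilon>" "\<epsilon> \<le> 1"
    and range: "\<epsilon> * \<tau> < real K + 1" and tau_large: "16 / \<epsilon>\<^sup>2 \<le> \<tau>"
    and ratio_ge: "K \<le> 2 * j \<Longrightarrow> v = 2 * real j + 1 - real K \<Longrightarrow> v \<le> \<epsilon> * \<tau> \<Longrightarrow>
      exp (- (2 * v / \<tau> * (1 + \<delta> + v / \<tau>))) * p j \<le> p (Suc j)"
begin

text \<open>The comparison of \<open>upper_tail\<close> with the roles exchanged and cells bounded
  by values of \<open>rho\<close>. As the ratio bound ends at \<open>\<epsilon> * \<tau>\<close>,
  the cell of the last admissible index \<open>I\<close> takes all remaining Gaussian mass, which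
  \<open>rho_last\<close> permits.\<close>

lemma lower_tail:
  assumes i: "K < 2 * i" "2 * real i - 1 - real K \<le> \<epsilon> * \<tau>"
  shows "Psi (rho (4 / \<epsilon>\<^sup>2) \<delta> \<tau> (2 * real i - 1 - real K) / sqrt \<tau>) \<le> T i"
proof -
  define \<kappa> where "\<kappa> = 4 / \<epsilon>\<^sup>2"
  have \<epsilon>2: "\<epsilon>\<^sup>2 \<le> 1" "0 < \<epsilon>\<^sup>2"
    using eps by (auto simp: power2_eq_square mult_le_one)
  have \<kappa>: "4 \<le> \<kappa>" "4 * \<kappa> \<le> \<tau>" using \<epsilon>2 tau_large by (auto simp: \<kappa>_def field_simps)
  define i0 where "i0 = Suc K div 2"
  define E where "E = \<epsilon> * \<tau>"
  define I where "I = nat \<lfloor>(E + 1 + real K) / 2\<rfloor>"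
  have x0: "0 \<le> (E + 1 + real K) / 2" using eps tau_ge_1 by (simp add: E_def)
  have I: "2 * real I - 1 - real K \<le> \<epsilon> * \<tau>" "\<epsilon> * \<tau> - 2 < 2 * real I - 1 - real K"
  proof -
    have "real I = of_int \<lfloor>(E + 1 + real K) / 2\<rfloor>" using x0 by (simp add: I_def)
    then have 1: "real I \<le> (E + 1 + real K) / 2" and 2: "(E + 1 + real K) / 2 < real I + 1" by linarith+
    show "2 * real I - 1 - real K \<le> \<epsilon> * \<tau>" unfolding E_def[symmetric] using 1 by (simp add: field_simps)
    show "\<epsilon> * \<tau> - 2 < 2 * real I - 1 - real K" unfolding E_def[symmetric] using 2 by (simp add: field_simps)
  qed
  have IK: "I \<le> K"
  proof -
    have "real I < real K + 1" using I(1) range by linarith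
    then show ?thesis by linarith
  qed
  have iI: "i \<le> I"
  proof -
    have "real i < real I + 1" using I(2) i(2) by linarith
    then show ?thesis by linarith
  qed
  \<comment> \<open>Starting the first cell at 0 gives the cells total mass 1. Since
    \<open>rho\<close> is nonnegative there, this can only enlarge the first cell.\<close>
  define z where "z j = (if j = i0 then 0 else rho \<kappa> \<delta> \<tau> (2 * real j - 1 - real K))" for j
  define g where "g j = (if j \<le> I then 2 * Psi (z j / sqrt \<tau>) else 0)" for j
  have i0: "i0 \<le> i" "K \<le> 2 * i0" using i by (auto simp: i0_def)
  have rho_nonneg: "0 \<le> rho \<kappa> \<delta> \<tau> x" if "-1 \<le> x" for x
  proof -
    have "(1 + \<delta>) * (- 1) \<le> (1 + \<delta>) * x" using that delta by (intro mult_left_mono) auto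
    moreover have "0 \<le> \<kappa> * x\<^sup>2 / \<tau>" using \<kappa> tau_ge_1 by auto
    ultimately show ?thesis using delta \<kappa> by (simp add: rho_def)
  qed
  have "(\<Sum>j=i..K. g j - g (Suc j)) \<le> sum half_mass {i..K}"
  proof (rule single_crossing_tail[of "\<lambda>j. g j - g (Suc j)" i0 K half_mass])
    have "(\<Sum>j=i0..K. g j - g (Suc j)) = g i0 - g (Suc K)"
      using i0 iI IK by (intro sum_telescope_down) auto
    also have "\<dots> = 1" using i0 iI IK by (simp add: g_def Psi_0 z_def)
    finally show "(\<Sum>j=i0..K. g j - g (Suc j)) = sum half_mass {i0..K}"
      using half_mass_total by (simp add: i0_def)
  next
    fix j assume j: "i0 \<le> j" "j < K" and le: "g j - g (Suc j) \<le> half_mass j"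
    show "g (Suc j) - g (Suc (Suc j)) \<le> half_mass (Suc j)"
    proof (cases "Suc j \<le> I")
      case False
      then show ?thesis using half_mass_nonneg by (simp add: g_def)
    next
      case True
      define v where "v = 2 * real j + 1 - real K"
      have Kj: "K \<le> 2 * j" using j i0 by simp
      then have v1: "1 \<le> v" by (simp add: v_def)
      have vI: "v \<le> \<epsilon> * \<tau>" using True I(1) by (simp add: v_def)
      let ?c = "exp (- (2 * v / \<tau> * (1 + \<delta> + v / \<tau>)))"
      let ?P = "\<lambda>x. Psi (rho \<kappa> \<delta> \<tau> x / sqrt \<tau>)"
      have zS: "z (Suc j) = rho \<kappa> \<delta> \<tau> v" using j by (simp add: z_def v_def algebra_simps)
      have zSS: "z (Suc (Suc j)) = rho \<kappa> \<delta> \<tau> (v + 2)" using j by (simp add: z_def v_def algebra_simps)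
      have "z j \<le> rho \<kappa> \<delta> \<tau> (v - 2)"
        using rho_nonneg[of "v - 2"] v1 by (simp add: z_def) (simp add: v_def algebra_simps)
      then have zj: "?P (v - 2) \<le> Psi (z j / sqrt \<tau>)"
        using tau_ge_1 by (simp add: Psi_le_iff divide_right_mono)
      have "(g (Suc j) - g (Suc (Suc j))) \<le> ?c * (2 * (?P (v - 2) - ?P v))"
      proof (cases "Suc (Suc j) \<le> I")
        case True
        have "1 \<le> \<kappa>" using \<kappa> by simp
        have "g (Suc j) - g (Suc (Suc j)) = 2 * (?P v - ?P (v + 2))"
          using True by (simp add: g_def zS zSS)
        also have "\<dots> \<le> 2 * (?c * (?P (v - 2) - ?P v))"
          using rho_step[OF tau_ge_1 \<open>1 \<le> \<kappa>\<close> \<kappa>(2) delta v1] by (intro mult_left_mono) auto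
        finally show ?thesis by (simp only: mult.left_commute)
      next
        case False
        then have "Suc j = I" using \<open>Suc j \<le> I\<close> by simp
        then have "\<epsilon> * \<tau> - 2 < v" using I(2) by (auto simp: v_def)
        have "g (Suc j) - g (Suc (Suc j)) = 2 * ?P v"
          using False \<open>Suc j \<le> I\<close> by (simp add: g_def zS)
        also have "\<dots> \<le> 2 * (?c * (?P (v - 2) - ?P v))"
          using rho_last[OF eps tau_large delta v1 \<open>\<epsilon> * \<tau> - 2 < v\<close> vI] unfolding \<kappa>_def[symmetric]
          by (intro mult_left_mono) auto
        finally show ?thesis by (simp only: mult.left_commute)
      qed
      also have "\<dots> \<le> ?c * (g j - g (Suc j))"
        using True zj by (intro mult_left_mono) (simp_all add: g_def zS)
      also have "\<dots> \<le> ?c * (2 * p j)"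
        using le half_mass_le[of j] by (intro mult_left_mono) auto
      also have "\<dots> \<le> 2 * p (Suc j)"
        using ratio_ge[OF Kj v_def vI] by simp
      also have "\<dots> = half_mass (Suc j)"
        using Kj by (simp add: half_mass_def)
      finally show ?thesis .
    qed
  qed (use iI IK i0 in auto)
  also have "(\<Sum>j=i..K. g j - g (Suc j)) = g i - g (Suc K)"
    using iI IK by (intro sum_telescope_down) auto
  also have "\<dots> = 2 * Psi (z i / sqrt \<tau>)" using iI IK by (simp add: g_def)
  finally have "Psi (z i / sqrt \<tau>) \<le> T i" using half_mass_tail[OF i(1)] by simp
  moreover have "z i \<le> rho \<kappa> \<delta> \<tau> (2 * real i - 1 - real K)"
    using rho_nonneg[of "2 * real i - 1 - real K"] i by (auto simp: z_def)
  then have "Psi (rho \<kappa> \<delta> \<tau> (2 * real i - 1 - real K) / sqrt \<tau>) \<le> Psi (z i / sqrt \<tau>)"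
    using tau_ge_1 by (simp add: Psi_le_iff divide_right_mono)
  ultimately show ?thesis by (simp add: \<kappa>_def)
qed

end

text \<open>For a law of total mass 1 this is the least \<open>i\<close> at which the distribution
  function reaches \<open>1 - Psi z\<close>, the usual quantile transform of a normal variable,
  phrased by upper tails.\<close>

definition quantile :: "(nat \<Rightarrow> real) \<Rightarrow> nat \<Rightarrow> real \<Rightarrow> nat" where
  "quantile p K z = (LEAST i. sum p {Suc i..K} \<le> Psi z)"

lemma quantile_le: "quantile p K z \<le> K"
  unfolding quantile_def by (rule Least_le) (simp add: Psi_nonneg)

lemma quantile_tail: "sum p {Suc (quantile p K z)..K} \<le> Psi z"
  unfolding quantile_def by (rule LeastI[of _ K]) (simp add: Psi_nonneg)

lemma quantile_tail_less: "i < quantile p K z \<Longrightarrow> Psi z < sum p {Suc i..K}"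
  unfolding quantile_def by (drule not_less_Least) simp

lemma quantile_le_iff:
  assumes "\<And>i. 0 \<le> p i"
  shows "quantile p K z \<le> i \<longleftrightarrow> sum p {Suc i..K} \<le> Psi z"
proof
  assume "quantile p K z \<le> i"
  then have "sum p {Suc i..K} \<le> sum p {Suc (quantile p K z)..K}"
    using assms by (intro sum_mono2) auto
  then show "sum p {Suc i..K} \<le> Psi z" using quantile_tail[of p K z] by linarith
next
  assume "sum p {Suc i..K} \<le> Psi z"
  then show "quantile p K z \<le> i"
    using quantile_tail_less[of i p K z] by (cases "i < quantile p K z") auto
qed

lemma measurable_quantile [measurable]:
  assumes "\<And>i. 0 \<le> p i"
  shows "quantile p K \<in> measurable borel (count_space UNIV)"
proof (rule measurable_count_space_eq_countable[THEN iffD2], simp, safe)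
  fix i
  have "quantile p K -` {i} = {z. sum p {Suc i..K} \<le> Psi z} - (if i = 0 then {} else {z. sum p {i..K} \<le> Psi z})"
  proof (cases i)
    case 0
    have "quantile p K z = 0 \<longleftrightarrow> sum p {Suc 0..K} \<le> Psi z" for z
      using quantile_le_iff[OF assms, where i = 0] by simp
    then show ?thesis using 0 by auto
  next
    case (Suc k)
    have "quantile p K z = i \<longleftrightarrow> quantile p K z \<le> i \<and> \<not> quantile p K z \<le> k" for z using Suc by auto
    then show ?thesis using Suc by (auto simp: quantile_le_iff[OF assms])
  qed
  also have "\<dots> \<in> sets borel" by auto
  finally show "quantile p K -` {i} \<inter> space borel \<in> sets borel" by simp
qed simp_all

lemma measure_quantile:
  assumes p: "\<And>i. 0 \<le> p i" and sum: "sum p {..K} = 1" and i: "i \<le> K"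
  shows "measure gaussian {z. quantile p K z = i} = p i"
proof -
  have le: "measure gaussian {z. quantile p K z \<le> i} = sum p {..i}" if "i \<le> K" for i
  proof -
    have split: "sum p {..i} + sum p {Suc i..K} = 1"
      using sum.atLeastLessThan_concat[of 0 "Suc i" "Suc K" p] sum that
      by (simp add: atLeast0LessThan atLeastLessThanSuc_atLeastAtMost lessThan_Suc_atMost atMost_atLeast0)
    moreover have "0 \<le> sum p {..i}" "0 \<le> sum p {Suc i..K}" using p by (auto intro: sum_nonneg)
    ultimately show ?thesis
      unfolding quantile_le_iff[OF p] by (subst measure_Psi_ge) auto
  qed
  show ?thesis
  proof (cases i)
    case 0
    then show ?thesis using le[of 0] by simp
  next
    case (Suc k)
    have "{z. quantile p K z = i} = {z. quantile p K z \<le> i} - {z. quantile p K z \<le> k}" using Suc by auto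
    moreover have "measure gaussian ({z. quantile p K z \<le> i} - {z. quantile p K z \<le> k})
       = measure gaussian {z. quantile p K z \<le> i} - measure gaussian {z. quantile p K z \<le> k}"
    proof (intro gaussian.finite_measure_Diff)
      have "{z. quantile p K z \<le> j} \<in> sets borel" for j
        unfolding quantile_le_iff[OF p] by measurable
      then show "{z. quantile p K z \<le> i} \<in> sets gaussian" "{z. quantile p K z \<le> k} \<in> sets gaussian"
        by simp_all
    qed (use Suc in auto)
    ultimately show ?thesis using le[of i] le[of k] i Suc by simp
  qed
qed

section \<open>Distance of a quantile transform from its normal argument\<close>

context symmetric_pmf
begin

text \<open>Replacing \<open>i\<close> by \<open>K - i\<close> and \<open>z\<close> by
  \<open>- z\<close> preserves both laws, so the estimates below need only the upper half. A
  quantile exactly at the centre is reflected according to the sign of \<open>z\<close>.\<close>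

lemma quantile_reflect:
  obtains s i z' where "s = 1 \<or> s = - 1" "2 * real (quantile p K z) - real K = s * (2 * real i - real K)"
    "z = s * z'" "i \<le> K" "K \<le> 2 * i" "0 \<le> z'" "T (Suc i) \<le> Psi z'" "K < 2 * i \<Longrightarrow> Psi z' \<le> T i"
proof -
  define q where "q = quantile p K z"
  have q: "q \<le> K" "T (Suc q) \<le> Psi z"
    unfolding q_def T_def by (rule quantile_le quantile_tail)+
  have qT: "Psi z \<le> T q"
  proof (cases q)
    case 0
    then show ?thesis using T_split[of 0] Psi_le_1[of z] by simp
  next
    case (Suc k)
    then show ?thesis using quantile_tail_less[of k p K z] by (simp add: q_def T_def)
  qed
  have refl: "T (Suc (K - q)) = 1 - T q" "q \<noteq> 0 \<or> True \<Longrightarrow> T (K - q) = 1 - T (Suc q)"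
    using T_split[of q] sum_lessThan_eq_T[of q] T_split[of "Suc q"] sum_lessThan_eq_T[of "Suc q"] q(1)
    by (simp_all add: Suc_diff_le)
  have pos: "0 \<le> y" if "Psi y \<le> T i" "K < 2 * i" "i \<le> K" for y i
    using T_le_half[of i] that Psi_le_iff[of y 0] by (simp add: Psi_0)
  consider "K < 2 * q" | "2 * q < K" | "2 * q = K" "0 \<le> z" | "2 * q = K" "z < 0" by linarith
  then show ?thesis
  proof cases
    case 1
    show ?thesis
      by (rule that[of 1 q z]) (use 1 q qT pos[OF qT 1 q(1)] in \<open>auto simp: q_def\<close>)
  next
    case 2
    have T1: "T (Suc (K - q)) \<le> Psi (- z)" "Psi (- z) \<le> T (K - q)"
      using refl q qT by (auto simp: Psi_minus)
    show ?thesis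
      by (rule that[of "- 1" "K - q" "- z"]) (use 2 q T1 pos[OF T1(2)] in \<open>auto simp: q_def[symmetric] of_nat_diff\<close>)
  next
    case 3
    show ?thesis
      by (rule that[of 1 q z]) (use 3 q in \<open>auto simp: q_def\<close>)
  next
    case 4
    have T1: "T (Suc (K - q)) \<le> Psi (- z)"
      using refl q qT by (auto simp: Psi_minus)
    show ?thesis
      by (rule that[of "- 1" "K - q" "- z"]) (use 4 q T1 in \<open>auto simp: q_def[symmetric] of_nat_diff\<close>)
  qed
qed

lemma upper_bound:
  assumes "i \<le> K" "K \<le> 2 * i" "0 \<le> z" "K < 2 * i \<Longrightarrow> Psi z \<le> T i"
  shows "2 * real i - real K \<le> 2 + sqrt \<tau> * z"
proof (cases "K = 2 * i")
  case True
  then show ?thesis using assms tau_ge_1 by simp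
next
  case False
  then have "Psi z \<le> Psi ((2 * real i - 2 - real K) / sqrt \<tau>)"
    using assms upper_tail[of i] by simp
  then have "(2 * real i - 2 - real K) / sqrt \<tau> \<le> z" by (simp add: Psi_le_iff)
  then show ?thesis using tau_ge_1 by (simp add: field_simps)
qed

lemma quantile_bound: "\<bar>2 * real (quantile p K z) - real K\<bar> \<le> 2 + sqrt \<tau> * \<bar>z\<bar>"
proof -
  obtain s i z' where h: "s = 1 \<or> s = - 1" "2 * real (quantile p K z) - real K = s * (2 * real i - real K)"
    "z = s * z'" "i \<le> K" "K \<le> 2 * i" "0 \<le> z'" "K < 2 * i \<Longrightarrow> Psi z' \<le> T i"
    by (rule quantile_reflect[of z]) blast
  have "\<bar>2 * real (quantile p K z) - real K\<bar> = 2 * real i - real K" "\<bar>z\<bar> = z'"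
    using h by (auto simp: abs_if)
  then show ?thesis using upper_bound[OF h(4-7)] by simp
qed

end

context symmetric_pmf_lower
begin

text \<open>With \<open>\<kappa> = 4 / \<epsilon>\<^sup>2\<close> the constant is
  \<open>22 * \<kappa> + 5\<close>. Here \<open>4 * \<kappa> + 5\<close> comes from the affine part
  of \<open>rho (u + 1)\<close> after subtraction of \<open>u\<close>, and
  \<open>18 * \<kappa>\<close> from its quadratic part, because
  \<open>(u + 1)\<^sup>2 \<le> 18 + 2 * (\<tau> * z\<^sup>2)\<close>.\<close>

lemma lower_bound:
  assumes i: "i \<le> K" "K \<le> 2 * i" and z: "0 \<le> z" "K < 2 * i \<Longrightarrow> Psi z \<le> T i" "T (Suc i) \<le> Psi z"
  shows "sqrt \<tau> * z - (2 * real i - real K) \<le> (88 / \<epsilon>\<^sup>2 + 5) * (1 + z\<^sup>2) + \<delta> * \<tau>"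
proof -
  define \<kappa> where "\<kappa> = 4 / \<epsilon>\<^sup>2"
  define u where "u = 2 * real i - real K"
  have \<epsilon>2: "\<epsilon>\<^sup>2 \<le> \<epsilon>" "\<epsilon>\<^sup>2 \<le> 1" "0 < \<epsilon>\<^sup>2"
    using eps by (auto simp: power2_eq_square mult_le_one mult_left_le)
  have \<kappa>: "4 \<le> \<kappa>" using \<epsilon>2 by (simp add: \<kappa>_def field_simps)
  have "16 \<le> \<tau> * \<epsilon>\<^sup>2" using tau_large \<epsilon>2 by (simp add: field_simps)
  also have "\<dots> \<le> \<tau> * \<epsilon>" using \<epsilon>2 tau_ge_1 by (intro mult_left_mono) auto
  finally have \<epsilon>\<tau>: "16 \<le> \<epsilon> * \<tau>" by (simp add: mult.commute)
  have u0: "0 \<le> u" and up: "u \<le> 2 + sqrt \<tau> * z"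
    using i upper_bound[OF i z(1,2)] by (auto simp: u_def)
  have sq: "sqrt \<tau> * sqrt \<tau> = \<tau>" using tau_ge_1 by simp
  have "sqrt \<tau> * z - u \<le> (22 * \<kappa> + 5) * (1 + z\<^sup>2) + \<delta> * \<tau>"
  proof (cases "u + 1 \<le> \<epsilon> * \<tau>")
    case True
    have "Psi (rho \<kappa> \<delta> \<tau> (u + 1) / sqrt \<tau>) \<le> Psi z"
      using lower_tail[of "Suc i"] True i z(3) by (simp add: u_def \<kappa>_def algebra_simps)
    then have "sqrt \<tau> * z \<le> rho \<kappa> \<delta> \<tau> (u + 1)"
      using tau_ge_1 by (simp add: Psi_le_iff field_simps)
    then have 1: "sqrt \<tau> * z - u \<le> 4 * \<kappa> + 5 + \<delta> * (u + 1) + \<kappa> * ((u + 1)\<^sup>2 / \<tau>)"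
      by (simp add: rho_def algebra_simps)
    have "\<epsilon> * \<tau> \<le> 1 * \<tau>" using eps tau_ge_1 by (intro mult_right_mono) auto
    then have "u + 1 \<le> \<tau>" using True by simp
    then have 2: "\<delta> * (u + 1) \<le> \<delta> * \<tau>" using delta by (intro mult_left_mono) auto
    have "(u + 1)\<^sup>2 \<le> (3 + sqrt \<tau> * z)\<^sup>2" using u0 up by (intro power_mono) auto
    also have "\<dots> \<le> 18 + 2 * (sqrt \<tau> * z)\<^sup>2"
      using zero_le_power2[of "3 - sqrt \<tau> * z"] by (simp add: power2_eq_square algebra_simps)
    also have "(sqrt \<tau> * z)\<^sup>2 = \<tau> * z\<^sup>2" using tau_ge_1 by (simp add: power_mult_distrib)
    finally have "(u + 1)\<^sup>2 / \<tau> \<le> (18 + 2 * (\<tau> * z\<^sup>2)) / \<tau>"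
      using tau_ge_1 by (intro divide_right_mono) auto
    also have "\<dots> = 18 / \<tau> + 2 * z\<^sup>2" using tau_ge_1 by (simp add: add_divide_distrib)
    also have "\<dots> \<le> 18 + 2 * z\<^sup>2" using tau_ge_1 by (simp add: field_simps)
    finally have "\<kappa> * ((u + 1)\<^sup>2 / \<tau>) \<le> \<kappa> * (18 + 2 * z\<^sup>2)" using \<kappa> by (intro mult_left_mono) auto
    with 1 2 have "sqrt \<tau> * z - u \<le> 4 * \<kappa> + 5 + \<delta> * \<tau> + \<kappa> * (18 + 2 * z\<^sup>2)" by linarith
    also have "\<dots> = 22 * \<kappa> + 5 + 2 * (\<kappa> * z\<^sup>2) + \<delta> * \<tau>" by (simp add: algebra_simps)
    also have "\<dots> \<le> 22 * \<kappa> + 5 + (22 * (\<kappa> * z\<^sup>2) + 5 * z\<^sup>2) + \<delta> * \<tau>"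
      using \<kappa> by (intro add_mono order_refl) auto
    also have "\<dots> = (22 * \<kappa> + 5) * (1 + z\<^sup>2) + \<delta> * \<tau>" by (simp add: algebra_simps)
    finally show ?thesis .
  next
    \<comment> \<open>Beyond the range of \<open>lower_tail\<close>, \<open>z\<close> is at least of
      order \<open>sqrt \<tau>\<close>, so \<open>sqrt \<tau> * z\<close> is already bounded by a
      multiple of \<open>z\<^sup>2\<close>.\<close>
    case False
    then have "\<epsilon> * \<tau> / 2 \<le> sqrt \<tau> * z" using up \<epsilon>\<tau> by linarith
    then have "sqrt \<tau> * (\<epsilon> / 2 * sqrt \<tau>) \<le> sqrt \<tau> * z" using sq by (simp add: algebra_simps)
    then have "\<epsilon> / 2 * sqrt \<tau> \<le> z" using tau_ge_1 by simp
    then have "sqrt \<tau> \<le> 2 / \<epsilon> * z" using eps by (simp add: field_simps)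
    then have "sqrt \<tau> * z \<le> 2 / \<epsilon> * z * z" using z by (intro mult_right_mono) auto
    also have "\<dots> = 2 / \<epsilon> * z\<^sup>2" by (simp add: power2_eq_square)
    also have "\<dots> \<le> \<kappa> * z\<^sup>2"
      using \<epsilon>2 eps by (intro mult_right_mono) (auto simp: \<kappa>_def field_simps)
    also have "\<dots> \<le> (22 * \<kappa> + 5) * (1 + z\<^sup>2)"
      using \<kappa> by (intro mult_mono) auto
    moreover have "0 \<le> \<delta> * \<tau>" using delta tau_ge_1 by simp
    ultimately show ?thesis using u0 by linarith
  qed
  then show ?thesis by (simp add: \<kappa>_def u_def)
qed

lemma quantile_close:
  "\<bar>2 * real (quantile p K z) - real K - sqrt \<tau> * z\<bar> \<le> (88 / \<epsilon>\<^sup>2 + 5) * (1 + z\<^sup>2) + \<delta> * \<tau>"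
proof -
  obtain s i z' where h: "s = 1 \<or> s = - 1" "2 * real (quantile p K z) - real K = s * (2 * real i - real K)"
    "z = s * z'" "i \<le> K" "K \<le> 2 * i" "0 \<le> z'" "K < 2 * i \<Longrightarrow> Psi z' \<le> T i" "T (Suc i) \<le> Psi z'"
    by (rule quantile_reflect[of z]) blast
  have "2 * real (quantile p K z) - real K - sqrt \<tau> * z = s * ((2 * real i - real K) - sqrt \<tau> * z')"
    unfolding h(2) by (simp add: h(3) algebra_simps)
  then have "\<bar>2 * real (quantile p K z) - real K - sqrt \<tau> * z\<bar> = \<bar>s\<bar> * \<bar>(2 * real i - real K) - sqrt \<tau> * z'\<bar>"
    by (simp only: abs_mult)
  then have e: "\<bar>2 * real (quantile p K z) - real K - sqrt \<tau> * z\<bar> = \<bar>(2 * real i - real K) - sqrt \<tau> * z'\<bar>" "z\<^sup>2 = z'\<^sup>2"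
    using h(1,3) by auto
  have "(2 * real i - real K) - sqrt \<tau> * z' \<le> 2 * 1"
    using upper_bound[OF h(4-7)] by simp
  also have "\<dots> \<le> (88 / \<epsilon>\<^sup>2 + 5) * (1 + z'\<^sup>2)"
    by (intro mult_mono) auto
  also have "\<dots> \<le> (88 / \<epsilon>\<^sup>2 + 5) * (1 + z'\<^sup>2) + \<delta> * \<tau>"
    using delta tau_ge_1 by simp
  finally show ?thesis
    unfolding e using lower_bound[OF h(4,5,6,7,8)] by (simp add: abs_le_iff)
qed

end

section \<open>Hypergeometric and binomial distributions\<close>

text \<open>With \<open>x = v / X\<close> the logarithm of the left side is
  \<open>- 2 * artanh x\<close>, which is at most \<open>- 2 * x\<close>.\<close>

lemma ratio_le_exp:
  fixes X v :: real
  assumes "0 \<le> v" "v < X"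
  shows "(X - v) / (X + v) \<le> exp (- (2 * (v / X)))"
proof -
  define x where "x = v / X"
  have x: "0 \<le> x" "x < 1" using assms by (auto simp: x_def)
  let ?f = "\<lambda>t::real. ln (1 - t) - ln (1 + t) + 2 * t"
  have "?f x \<le> ?f 0"
  proof (rule DERIV_nonpos_imp_nonincreasing[OF x(1), where f = ?f])
    fix t assume t: "0 \<le> t" "t \<le> x"
    have "(?f has_real_derivative (- 1 / (1 - t) - 1 / (1 + t) + 2)) (at t)"
      using t x by (auto intro!: derivative_eq_intros simp: divide_simps)
    moreover have "- 1 / (1 - t) - 1 / (1 + t) + 2 \<le> 0"
    proof -
      have "- 1 / (1 - t) - 1 / (1 + t) + 2 = - (2 * t\<^sup>2) / ((1 - t) * (1 + t))"
        using t x by (simp add: power2_eq_square divide_simps) (simp add: algebra_simps)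
      also have "\<dots> \<le> 0" using t x by (intro divide_nonpos_nonneg) auto
      finally show ?thesis .
    qed
    ultimately show "\<exists>y. (?f has_real_derivative y) (at t) \<and> y \<le> 0" by blast
  qed
  then have "ln (1 - x) - ln (1 + x) \<le> - (2 * x)" by simp
  then have "ln ((1 - x) / (1 + x)) \<le> - (2 * x)" using x by (simp add: ln_div)
  then have "(1 - x) / (1 + x) \<le> exp (- (2 * x))"
    using x by (subst (asm) ln_le_cancel_iff[symmetric, of _ "exp (- (2 * x))", simplified] | simp add: ln_le_cancel_iff[symmetric])+
  moreover have "(1 - x) / (1 + x) = (X - v) / (X + v)"
    using assms by (simp add: x_def divide_simps)
  ultimately show ?thesis by (simp add: x_def)
qed

text \<open>The reverse estimate with a cubic correction: \<open>artanh x \<le> x + x ^ 3\<close>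
  for \<open>0 \<le> x \<le> 1 / 2\<close>.\<close>

lemma exp_le_ratio:
  fixes X v :: real
  assumes "0 \<le> v" "2 * v \<le> X" "0 < X"
  shows "exp (- (2 * (v / X) * (1 + (v / X)\<^sup>2))) \<le> (X - v) / (X + v)"
proof -
  define x where "x = v / X"
  have x: "0 \<le> x" "x \<le> 1 / 2" using assms by (auto simp: x_def field_simps)
  let ?f = "\<lambda>t::real. ln (1 - t) - ln (1 + t) + 2 * t + 2 * t ^ 3"
  have "?f 0 \<le> ?f x"
  proof (rule DERIV_nonneg_imp_nondecreasing[OF x(1), where f = ?f])
    fix t assume t: "0 \<le> t" "t \<le> x"
    have "(?f has_real_derivative (- 1 / (1 - t) - 1 / (1 + t) + 2 + 6 * t\<^sup>2)) (at t)"
      using t x by (auto intro!: derivative_eq_intros simp: divide_simps)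
    moreover have "0 \<le> - 1 / (1 - t) - 1 / (1 + t) + 2 + 6 * t\<^sup>2"
    proof -
      have t2: "t * t \<le> (1 / 2) * (1 / 2)" using t x by (intro mult_mono) auto
      have "- 1 / (1 - t) - 1 / (1 + t) + 2 + 6 * t\<^sup>2 = t\<^sup>2 * (4 - 6 * (t * t)) / ((1 - t) * (1 + t))"
        using t x by (simp add: power2_eq_square divide_simps) (simp add: algebra_simps)
      also have "0 \<le> \<dots>" using t x t2 by (intro divide_nonneg_nonneg mult_nonneg_nonneg) auto
      finally show ?thesis .
    qed
    ultimately show "\<exists>y. (?f has_real_derivative y) (at t) \<and> 0 \<le> y" by blast
  qed
  then have "- (2 * x * (1 + x\<^sup>2)) \<le> ln (1 - x) - ln (1 + x)"
    by (simp add: power2_eq_square power3_eq_cube algebra_simps)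
  also have "\<dots> = ln ((1 - x) / (1 + x))" using x by (simp add: ln_div)
  finally have "exp (- (2 * x * (1 + x\<^sup>2))) \<le> (1 - x) / (1 + x)"
    using x by (subst (asm) ln_ge_iff) auto
  moreover have "(1 - x) / (1 + x) = (X - v) / (X + v)"
    using assms by (simp add: x_def divide_simps)
  ultimately show ?thesis by (simp add: x_def)
qed

definition binom_pmf :: "nat \<Rightarrow> nat \<Rightarrow> real" where
  "binom_pmf n i = real (n choose i) / 2 ^ n"

definition hyper_pmf :: "nat \<Rightarrow> nat \<Rightarrow> nat \<Rightarrow> real" where
  "hyper_pmf m K i = (if i \<le> K then real (m choose i) * real (m choose (K - i)) / real (2 * m choose K) else 0)"

lemma choose_step: "real (n choose Suc j) * (real j + 1) = real (n choose j) * (real n - real j)"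
proof (cases "j \<le> n")
  case True
  have "real (Suc j * (n choose Suc j)) = real ((n - j) * (n choose j))"
    using binomial_absorb_comp[of n j] times_binomial_minus1_eq[of "Suc j" n] by simp
  then show ?thesis using True by (simp add: of_nat_diff algebra_simps)
qed (simp add: binomial_eq_0)

lemma binom_pmf_step:
  "binom_pmf n (Suc j) = binom_pmf n j * ((real n - real j) / (real j + 1))"
proof -
  have "real (n choose Suc j) = real (n choose j) * ((real n - real j) / (real j + 1))"
    using choose_step[of n j] by (simp add: field_simps)
  then show ?thesis by (simp add: binom_pmf_def)
qed

text \<open>The scale is \<open>n + 1\<close> and not the variance \<open>n\<close>, because the
  ratio of consecutive masses is exactly \<open>(X - v) / (X + v)\<close> with
  \<open>X = n + 1\<close>.\<close>

lemma binom_symmetric_pmf: "symmetric_pmf (binom_pmf n) n (real n + 1)"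
proof
  show "sum (binom_pmf n) {..n} = 1"
    using choose_row_sum[of n] unfolding binom_pmf_def sum_divide_distrib[symmetric]
    by (simp flip: of_nat_sum)
  show "binom_pmf n (Suc j) \<le> exp (- (2 * (2 * real j + 1 - real n) / (real n + 1))) * binom_pmf n j"
    if "j < n" "n \<le> 2 * j" for j
  proof -
    define v where "v = 2 * real j + 1 - real n"
    have v: "0 \<le> v" "v < real n + 1" using that by (auto simp: v_def)
    have "(real n - real j) / (real j + 1) = (real n + 1 - v) / (real n + 1 + v)"
      by (simp add: v_def divide_simps) (simp add: algebra_simps)
    also have "\<dots> \<le> exp (- (2 * (v / (real n + 1))))" by (rule ratio_le_exp[OF v])
    finally show ?thesis
      unfolding binom_pmf_step by (subst mult.commute) (intro mult_right_mono, auto simp: v_def binom_pmf_def)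
  qed
qed (auto simp: binom_pmf_def binomial_symmetric[symmetric])

text \<open>For \<open>\<epsilon> = 1 / 4\<close> the requirement
  \<open>16 / \<epsilon>\<^sup>2 \<le> \<tau>\<close> reads \<open>256 \<le> n + 1\<close>. The
  cubic correction is absorbed by the quadratic term of \<open>ratio_ge\<close>, since
  \<open>x\<^sup>2 \<le> x\<close>.\<close>

lemma binom_symmetric_pmf_lower:
  assumes "255 \<le> n"
  shows "symmetric_pmf_lower (binom_pmf n) n (real n + 1) 0 (1 / 4)"
proof -
  interpret symmetric_pmf "binom_pmf n" n "real n + 1" by (rule binom_symmetric_pmf)
  show ?thesis
  proof
    fix j v assume j: "n \<le> 2 * j" and v: "v = 2 * real j + 1 - real n" and le: "v \<le> 1 / 4 * (real n + 1)"
    define x where "x = v / (real n + 1)"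
    have v0: "0 \<le> v" "2 * v \<le> real n + 1" using j v le by auto
    have x: "0 \<le> x" "x \<le> 1" using v0 by (auto simp: x_def)
    have "x * x \<le> x * 1" using x by (intro mult_left_mono) auto
    then have "2 * x * (1 + x\<^sup>2) \<le> 2 * x * (1 + 0 + x)"
      using x by (intro mult_left_mono) (auto simp: power2_eq_square)
    then have "exp (- (2 * x * (1 + 0 + x))) \<le> exp (- (2 * x * (1 + x\<^sup>2)))" by simp
    also have "\<dots> \<le> (real n + 1 - v) / (real n + 1 + v)"
      unfolding x_def by (rule exp_le_ratio) (use v0 in auto)
    also have "\<dots> = (real n - real j) / (real j + 1)"
      by (simp add: v divide_simps) (simp add: algebra_simps)
    finally have "binom_pmf n j * exp (- (2 * x * (1 + 0 + x))) \<le> binom_pmf n (Suc j)"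
      unfolding binom_pmf_step by (intro mult_left_mono p_nonneg)
    then show "exp (- (2 * v / (real n + 1) * (1 + 0 + v / (real n + 1)))) * binom_pmf n j \<le> binom_pmf n (Suc j)"
      by (simp add: x_def mult.commute)
  qed (use assms in \<open>auto simp: power2_eq_square\<close>)
qed

lemma hyper_pmf_step:
  assumes j: "j < K" and m: "real K - real j - 1 < real m"
  shows "hyper_pmf m K (Suc j) = hyper_pmf m K j *
    ((real m - real j) / (real j + 1) * ((real K - real j) / (real m - real K + real j + 1)))"
proof -
  obtain l where l: "K = Suc (j + l)" using less_imp_Suc_add[OF j] by blast
  have 1: "real (m choose Suc j) = real (m choose j) * ((real m - real j) / (real j + 1))"
    using choose_step[of m j] by (simp add: field_simps)
  have pos: "real m - real l > 0" using m l by simp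
  then have 2: "real (m choose l) = real (m choose Suc l) * ((real l + 1) / (real m - real l))"
    using choose_step[of m l] by (simp add: field_simps)
  have e: "K - j = Suc l" "K - Suc j = l" "real K - real j = real l + 1"
    "real m - real K + real j + 1 = real m - real l" using l by auto
  show ?thesis
    using j unfolding e hyper_pmf_def by (simp add: 1 2 mult_ac)
qed

lemma hyper_pmf_nonneg: "0 \<le> hyper_pmf m K i"
  by (simp add: hyper_pmf_def)

text \<open>With \<open>M = m + 1\<close> and \<open>h = K - m\<close>, the ratio of consecutive
  masses is a product of two factors \<open>(X - v) / (X + v)\<close>, for \<open>X = M - h\<close>
  and \<open>X = M + h\<close>. Because \<open>1 / (M - h) + 1 / (M + h)\<close> is at least
  \<open>2 / M\<close>, the scale \<open>M / 2\<close> serves for every \<open>K\<close>.\<close>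

lemma hyper_symmetric_pmf:
  assumes m: "1 \<le> m" and K: "K \<le> 2 * m"
  shows "symmetric_pmf (hyper_pmf m K) K ((real m + 1) / 2)"
proof
  have "(\<Sum>k\<le>K. (m choose k) * (m choose (K - k))) = (2 * m choose K)"
    using vandermonde[of m m K] by (simp add: mult_2)
  then have "(\<Sum>k\<le>K. real (m choose k) * real (m choose (K - k))) = real (2 * m choose K)"
    by (simp flip: of_nat_sum of_nat_mult)
  moreover have "sum (hyper_pmf m K) {..K} = (\<Sum>k\<le>K. real (m choose k) * real (m choose (K - k))) / real (2 * m choose K)"
    unfolding sum_divide_distrib by (rule sum.cong) (auto simp: hyper_pmf_def)
  ultimately show "sum (hyper_pmf m K) {..K} = 1"
    using K by simp
  show "hyper_pmf m K (K - i) = hyper_pmf m K i" if "i \<le> K" for i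
    using that by (simp add: hyper_pmf_def)
  show "hyper_pmf m K (Suc j) \<le> exp (- (2 * (2 * real j + 1 - real K) / ((real m + 1) / 2))) * hyper_pmf m K j"
    if j: "j < K" "K \<le> 2 * j" for j
  proof (cases "j < m")
    case False
    then show ?thesis by (simp add: hyper_pmf_def binomial_eq_0)
  next
    case True
    define M where "M = real m + 1"
    define h where "h = real K - real m"
    define v where "v = 2 * real j + 1 - real K"
    have v: "0 \<le> v" "v < M - h" "v < M + h" using j True by (auto simp: v_def M_def h_def)
    have h: "0 < M - h" "0 < M + h" using v by linarith+
    have "(real m - real j) / (real j + 1) = (M - h - v) / (M + h + v)"
      "(real K - real j) / (real m - real K + real j + 1) = (M + h - v) / (M - h + v)"
      using j True by (simp_all add: M_def h_def v_def divide_simps) (simp_all add: algebra_simps)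
    \<comment> \<open>The denominators of the two factors are exchanged, so that each quotient has a
      single \<open>X\<close>.\<close>
    then have "(real m - real j) / (real j + 1) * ((real K - real j) / (real m - real K + real j + 1))
       = ((M - h - v) / (M - h + v)) * ((M + h - v) / (M + h + v))" by simp
    also have "\<dots> \<le> exp (- (2 * (v / (M - h)))) * exp (- (2 * (v / (M + h))))"
      using v h by (intro mult_mono ratio_le_exp) auto
    also have "\<dots> = exp (- (2 * (v / (M - h) + v / (M + h))))"
      by (simp flip: exp_add)
    also have "\<dots> \<le> exp (- (2 * v / (M / 2)))"
    proof -
      have "2 / M \<le> 1 / (M - h) + 1 / (M + h)"
      proof -
        have pos: "0 < M * M - h * h" using mult_pos_pos[OF h] by (simp add: algebra_simps)
        then have "1 / (M - h) + 1 / (M + h) = 2 * M / (M * M - h * h)"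
          using h by (simp add: divide_simps) (simp add: algebra_simps)
        moreover note pos
        moreover have "2 * (M * M - h * h) \<le> 2 * M * M" by simp
        ultimately show ?thesis using h by (simp add: divide_simps M_def)
      qed
      then have "v * (2 / M) \<le> v * (1 / (M - h) + 1 / (M + h))" using v by (intro mult_left_mono)
      moreover have "2 * v / (M / 2) = 2 * (v * (2 / M))" by simp
      moreover have "2 * (v / (M - h) + v / (M + h)) = 2 * (v * (1 / (M - h) + 1 / (M + h)))"
        by (simp add: algebra_simps)
      ultimately show ?thesis by simp
    qed
    finally have "hyper_pmf m K j * ((real m - real j) / (real j + 1) * ((real K - real j) / (real m - real K + real j + 1)))
      \<le> hyper_pmf m K j * exp (- (2 * v / (M / 2)))"
      by (rule mult_left_mono[OF _ hyper_pmf_nonneg])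
    then show ?thesis
      using j True by (subst hyper_pmf_step) (auto simp: v_def M_def mult.commute)
  qed
qed (use m hyper_pmf_nonneg in auto)

text \<open>Imbalance speeds up the decay: \<open>1 / (M - h) + 1 / (M + h)\<close> equals
  \<open>(2 / M) / (1 - a)\<close> with \<open>a = (h / M)\<^sup>2\<close>, and
  \<open>1 / (1 - a) \<le> 1 + 2 * a\<close> yields \<open>\<delta> = 2 * a\<close>. The bound 511
  gives \<open>\<tau> \<ge> 256\<close>, as required for \<open>\<epsilon> = 1 / 4\<close>.\<close>

lemma hyper_symmetric_pmf_lower:
  assumes m: "511 \<le> m" and K: "K \<le> 2 * m" and h: "\<bar>real K - real m\<bar> \<le> (real m + 1) / 4"
  shows "symmetric_pmf_lower (hyper_pmf m K) K ((real m + 1) / 2)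
    (2 * (real K - real m)\<^sup>2 / (real m + 1)\<^sup>2) (1 / 4)"
proof -
  interpret symmetric_pmf "hyper_pmf m K" K "(real m + 1) / 2"
    by (rule hyper_symmetric_pmf) (use m K in auto)
  define M where "M = real m + 1"
  define h where "h = real K - real m"
  define a where "a = (h / M)\<^sup>2"
  have M: "512 \<le> M" using m by (simp add: M_def)
  have hM: "\<bar>h\<bar> \<le> M / 4" using assms(3) by (simp add: h_def M_def)
  have a: "0 \<le> a" "a \<le> 1 / 16"
  proof -
    have "\<bar>h\<bar> / M \<le> 1 / 4" using hM M by (simp add: pos_divide_le_eq)
    then have "(\<bar>h\<bar> / M)\<^sup>2 \<le> (1 / 4)\<^sup>2" using M by (intro power_mono) auto
    then show "0 \<le> a" "a \<le> 1 / 16" by (simp_all add: a_def power_divide)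
  qed
  have \<delta>: "2 * (real K - real m)\<^sup>2 / (real m + 1)\<^sup>2 = 2 * a"
    by (simp add: a_def h_def M_def power_divide)
  show ?thesis unfolding \<delta>
  proof
    show "1 / 4 * ((real m + 1) / 2) < real K + 1"
      using hM M unfolding h_def M_def by argo
    fix j v assume j: "K \<le> 2 * j" and v: "v = 2 * real j + 1 - real K" and le: "v \<le> 1 / 4 * ((real m + 1) / 2)"
    have vM: "v \<le> M / 8" using le by (simp add: M_def)
    have v0: "1 \<le> v" using j v by simp
    have X: "3 / 4 * M \<le> M - h" "3 / 4 * M \<le> M + h" using hM by (auto simp: abs_le_iff)
    define b where "b = v / M"
    have b: "0 \<le> b" "b \<le> 1 / 8" using v0 vM M by (auto simp: b_def field_simps)
    have sq: "(v / X)\<^sup>2 \<le> 2 * b\<^sup>2" if "3 / 4 * M \<le> X" for X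
    proof -
      have "v / X \<le> v / (3 / 4 * M)" using that v0 M by (intro divide_left_mono) auto
      then have "(v / X)\<^sup>2 \<le> (4 / 3 * b)\<^sup>2" using v0 that M by (intro power_mono) (auto simp: b_def)
      also have "\<dots> \<le> 2 * b\<^sup>2" by (simp add: power2_eq_square)
      finally show ?thesis .
    qed
    have jm: "j < m"
    proof -
      have "2 * real j + 1 = real K + v" using v by simp
      also have "\<dots> < 2 * real m" using vM hM M unfolding h_def M_def by argo
      finally show ?thesis by linarith
    qed
    have jK: "j < K"
    proof -
      have "2 * real j + 1 = real K + v" using v by simp
      also have "\<dots> < 2 * real K" using vM hM M unfolding h_def M_def by argo
      finally show ?thesis by linarith
    qed
    have "2 * (v / (M - h)) * (1 + (v / (M - h))\<^sup>2) + 2 * (v / (M + h)) * (1 + (v / (M + h))\<^sup>2)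
       \<le> 2 * (v / (M - h)) * (1 + 2 * b\<^sup>2) + 2 * (v / (M + h)) * (1 + 2 * b\<^sup>2)"
      using sq[OF X(1)] sq[OF X(2)] v0 X M by (intro add_mono mult_left_mono) auto
    also have "\<dots> = 2 * (v / (M - h) + v / (M + h)) * (1 + 2 * b\<^sup>2)"
      by (simp add: algebra_simps)
    also have "v / (M - h) + v / (M + h) = 2 * b * (1 / (1 - a))"
    proof -
      have ne: "M - h \<noteq> 0" "M + h \<noteq> 0" "M \<noteq> 0" "a \<noteq> 1" using X M a by auto
      have "1 - a = (M - h) * (M + h) / (M * M)"
        using ne by (simp add: a_def power2_eq_square divide_simps) (simp add: algebra_simps)
      then show ?thesis
        using ne by (simp add: b_def divide_simps) (simp add: algebra_simps)
    qed
    also have "2 * (2 * b * (1 / (1 - a))) * (1 + 2 * b\<^sup>2) \<le> 2 * (2 * b * (1 + 2 * a)) * (1 + 2 * b\<^sup>2)"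
    proof -
      have "a * (2 * a) \<le> a * 1" using a by (intro mult_left_mono) auto
      then have "1 / (1 - a) \<le> 1 + 2 * a" using a by (simp add: divide_simps algebra_simps)
      then show ?thesis using b by (intro mult_right_mono mult_left_mono) auto
    qed
    also have "\<dots> = 4 * b * ((1 + 2 * a) * (1 + 2 * b\<^sup>2))" by simp
    also have "\<dots> \<le> 4 * b * (1 + 2 * a + 2 * b)"
    proof -
      have "(1 + 2 * a) * (2 * b\<^sup>2) \<le> 2 * (2 * b\<^sup>2)"
        using a by (intro mult_right_mono) auto
      also have "\<dots> = 2 * (b * (2 * b))" by (simp add: power2_eq_square)
      also have "\<dots> \<le> 2 * (b * 1)" using b by (intro mult_left_mono) auto
      finally have "(1 + 2 * a) * (1 + 2 * b\<^sup>2) \<le> 1 + 2 * a + 2 * b" by (simp add: algebra_simps)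
      then show ?thesis using b by (intro mult_left_mono) auto
    qed
    finally have "exp (- (4 * b * (1 + 2 * a + 2 * b)))
        \<le> exp (- (2 * (v / (M - h)) * (1 + (v / (M - h))\<^sup>2) + 2 * (v / (M + h)) * (1 + (v / (M + h))\<^sup>2)))"
      by simp
    also have "\<dots> = exp (- (2 * (v / (M - h)) * (1 + (v / (M - h))\<^sup>2))) * exp (- (2 * (v / (M + h)) * (1 + (v / (M + h))\<^sup>2)))"
      by (simp flip: exp_add)
    also have "\<dots> \<le> ((M - h - v) / (M - h + v)) * ((M + h - v) / (M + h + v))"
      using v0 vM X M by (intro mult_mono exp_le_ratio) auto
    also have "\<dots> = (real m - real j) / (real j + 1) * ((real K - real j) / (real m - real K + real j + 1))"
    proof -
      have "(real m - real j) / (real j + 1) = (M - h - v) / (M + h + v)"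
        "(real K - real j) / (real m - real K + real j + 1) = (M + h - v) / (M - h + v)"
        using j jm by (simp_all add: M_def h_def v divide_simps) (simp_all add: algebra_simps)
      then show ?thesis by simp
    qed
    finally have r: "exp (- (4 * b * (1 + 2 * a + 2 * b)))
      \<le> (real m - real j) / (real j + 1) * ((real K - real j) / (real m - real K + real j + 1))" .
    have step: "hyper_pmf m K (Suc j) = hyper_pmf m K j *
      ((real m - real j) / (real j + 1) * ((real K - real j) / (real m - real K + real j + 1)))"
      using jm jK j by (intro hyper_pmf_step) auto
    have "hyper_pmf m K j * exp (- (4 * b * (1 + 2 * a + 2 * b))) \<le> hyper_pmf m K (Suc j)"
      unfolding step by (rule mult_left_mono[OF r hyper_pmf_nonneg])
    moreover have "4 * b * (1 + 2 * a + 2 * b) = 2 * v / ((real m + 1) / 2) * (1 + 2 * a + v / ((real m + 1) / 2))"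
      by (simp add: b_def M_def)
    ultimately show "exp (- (2 * v / ((real m + 1) / 2) * (1 + 2 * a + v / ((real m + 1) / 2)))) * hyper_pmf m K j \<le> hyper_pmf m K (Suc j)"
      by (simp add: mult.commute)
  qed (use a M in \<open>auto simp: power2_eq_square M_def\<close>)
qed

section \<open>Explicit quantile estimates for binomial and hypergeometric laws\<close>

lemma sqrt_scale_close:
  assumes "0 \<le> a" "a \<le> b" "b \<le> a + 1"
  shows "\<bar>sqrt b * z - sqrt a * z\<bar> \<le> 1 + z\<^sup>2"
proof -
  have "sqrt b \<le> sqrt (a + 1)" "sqrt a \<le> sqrt b" using assms by auto
  moreover have "sqrt (a + 1) \<le> sqrt a + 1" using sqrt_add_le_add_sqrt[of a 1] assms by simp
  ultimately have "\<bar>sqrt b - sqrt a\<bar> \<le> 1" by linarith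
  then have "\<bar>sqrt b - sqrt a\<bar> * \<bar>z\<bar> \<le> 1 * \<bar>z\<bar>" by (intro mult_right_mono) auto
  also have "\<dots> \<le> 1 + z\<^sup>2"
    using zero_le_power2[of "\<bar>z\<bar> - 1"] zero_le_power2[of z] by (simp add: power2_eq_square algebra_simps)
  finally show ?thesis by (simp only: abs_mult[symmetric] left_diff_distrib)
qed

lemma sqrt_scale_le: "0 \<le> a \<Longrightarrow> 2 * (sqrt a * \<bar>z\<bar>) \<le> a + z\<^sup>2"
  using zero_le_power2[of "sqrt a - \<bar>z\<bar>"] by (simp add: power2_eq_square algebra_simps)

lemma binom_quantile_bound:
  "\<bar>2 * real (quantile (binom_pmf n) n z) - real n\<bar> \<le> 2 + sqrt (real n + 1) * \<bar>z\<bar>"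
  by (rule symmetric_pmf.quantile_bound[OF binom_symmetric_pmf])

text \<open>\<open>1413 = 88 * 16 + 5\<close> is the constant for \<open>\<epsilon> = 1 / 4\<close>;
  one more unit pays for replacing \<open>sqrt (n + 1)\<close> by \<open>sqrt n\<close>. For small
  \<open>n\<close> both terms are bounded separately.\<close>

lemma binom_quantile_close:
  "\<bar>2 * real (quantile (binom_pmf n) n z) - real n - sqrt (real n) * z\<bar> \<le> 1414 * (1 + z\<^sup>2)"
proof -
  let ?Q = "2 * real (quantile (binom_pmf n) n z) - real n"
  have c: "\<bar>sqrt (real n + 1) * z - sqrt (real n) * z\<bar> \<le> 1 + z\<^sup>2" by (rule sqrt_scale_close) auto
  have "\<bar>?Q - sqrt (real n + 1) * z\<bar> \<le> 1413 * (1 + z\<^sup>2)"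
  proof (cases "255 \<le> n")
    case True
    have "88 / (1 / 4)\<^sup>2 + 5 = (1413 :: real)" by (simp add: power2_eq_square)
    with symmetric_pmf_lower.quantile_close[OF binom_symmetric_pmf_lower[OF True], of z]
    show ?thesis by simp
  next
    case False
    have "\<bar>?Q - sqrt (real n + 1) * z\<bar> \<le> \<bar>?Q\<bar> + sqrt (real n + 1) * \<bar>z\<bar>"
      using abs_triangle_ineq4[of ?Q "sqrt (real n + 1) * z"] by (simp add: abs_mult)
    also have "\<dots> \<le> 2 + 2 * (sqrt (real n + 1) * \<bar>z\<bar>)" using binom_quantile_bound[of n z] by linarith
    also have "\<dots> \<le> 2 + (real n + 1 + z\<^sup>2)" using sqrt_scale_le[of "real n + 1" z] by simp
    also have "\<dots> \<le> 1413 + 1413 * z\<^sup>2" using False zero_le_power2[of z] by linarith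
    finally show ?thesis by simp
  qed
  with c show ?thesis by (simp add: abs_le_iff)
qed

lemma hyper_quantile_bound:
  assumes "1 \<le> m" "K \<le> 2 * m"
  shows "\<bar>2 * real (quantile (hyper_pmf m K) K z) - real K\<bar> \<le> 2 + sqrt (real m) * \<bar>z\<bar>"
proof -
  have "\<bar>2 * real (quantile (hyper_pmf m K) K z) - real K\<bar> \<le> 2 + sqrt ((real m + 1) / 2) * \<bar>z\<bar>"
    by (rule symmetric_pmf.quantile_bound[OF hyper_symmetric_pmf[OF assms]])
  also have "\<dots> \<le> 2 + sqrt (real m) * \<bar>z\<bar>"
    using assms by (intro add_left_mono mult_right_mono) auto
  finally show ?thesis .
qed

text \<open>The imbalance term has two sources. For moderate imbalance it bounds
  \<open>\<delta> * \<tau>\<close>; for large imbalance it exceeds \<open>m / 2\<close> and so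
  covers the sum of the trivial bounds of both terms.\<close>

lemma hyper_quantile_close:
  assumes m: "1 \<le> m" and K: "K \<le> 2 * m"
  shows "\<bar>2 * real (quantile (hyper_pmf m K) K z) - real K - sqrt (real m / 2) * z\<bar>
    \<le> 1414 * (1 + z\<^sup>2) + 8 * ((real K - real m)\<^sup>2 / real m)"
proof -
  define h where "h = real K - real m"
  define \<tau> where "\<tau> = (real m + 1) / 2"
  let ?Q = "2 * real (quantile (hyper_pmf m K) K z) - real K"
  have c: "\<bar>sqrt \<tau> * z - sqrt (real m / 2) * z\<bar> \<le> 1 + z\<^sup>2"
    by (rule sqrt_scale_close) (auto simp: \<tau>_def)
  have hm: "0 \<le> h\<^sup>2 / real m" using m by simp
  have triv: "\<bar>?Q - sqrt \<tau> * z\<bar> \<le> 2 + (\<tau> + z\<^sup>2)"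
  proof -
    have "\<bar>?Q - sqrt \<tau> * z\<bar> \<le> \<bar>?Q\<bar> + sqrt \<tau> * \<bar>z\<bar>"
      using abs_triangle_ineq4[of ?Q "sqrt \<tau> * z"] by (simp add: abs_mult \<tau>_def)
    also have "\<dots> \<le> 2 + 2 * (sqrt \<tau> * \<bar>z\<bar>)"
      using symmetric_pmf.quantile_bound[OF hyper_symmetric_pmf[OF m K], of z] unfolding \<tau>_def by linarith
    also have "\<dots> \<le> 2 + (\<tau> + z\<^sup>2)" using sqrt_scale_le[of \<tau> z] by (simp add: \<tau>_def)
    finally show ?thesis .
  qed
  have "\<bar>?Q - sqrt \<tau> * z\<bar> \<le> 1413 * (1 + z\<^sup>2) + 8 * (h\<^sup>2 / real m)"
  proof (cases "m < 511")
    case True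
    then have "\<tau> \<le> 256" by (simp add: \<tau>_def)
    then have "2 + (\<tau> + z\<^sup>2) \<le> 1413 + 1413 * z\<^sup>2" using zero_le_power2[of z] by linarith
    then show ?thesis using triv hm unfolding distrib_left by linarith
  next
    case m511: False
    show ?thesis
    proof (cases "\<bar>h\<bar> \<le> (real m + 1) / 4")
      case True
      have 1: "88 / (1 / 4)\<^sup>2 + 5 = (1413 :: real)" by (simp add: power2_eq_square)
      have "2 * h\<^sup>2 / (real m + 1)\<^sup>2 * \<tau> = h\<^sup>2 / (real m + 1)"
        by (simp add: \<tau>_def power2_eq_square divide_simps)
      also have "\<dots> \<le> h\<^sup>2 / real m" using m by (intro divide_left_mono) auto
      also have "\<dots> \<le> 8 * (h\<^sup>2 / real m)" using hm by linarith
      finally have 2: "2 * h\<^sup>2 / (real m + 1)\<^sup>2 * \<tau> \<le> 8 * (h\<^sup>2 / real m)" .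
      have "\<bar>?Q - sqrt \<tau> * z\<bar> \<le> (88 / (1 / 4)\<^sup>2 + 5) * (1 + z\<^sup>2) + 2 * h\<^sup>2 / (real m + 1)\<^sup>2 * \<tau>"
        unfolding \<tau>_def h_def
        by (rule symmetric_pmf_lower.quantile_close[OF hyper_symmetric_pmf_lower])
          (use m511 K True in \<open>auto simp: h_def\<close>)
      with 1 2 show ?thesis by simp
    next
      case False
      have "real m / 4 \<le> \<bar>h\<bar>" using False by (simp add: field_simps)
      then have "(real m / 4) * (real m / 4) \<le> \<bar>h\<bar> * \<bar>h\<bar>" by (intro mult_mono) auto
      then have "real m / 16 \<le> h\<^sup>2 / real m"
        using m by (simp add: power2_eq_square field_simps)
      then have "real m / 2 \<le> 8 * (h\<^sup>2 / real m)" by linarith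
      then have "\<tau> \<le> 1 + 8 * (h\<^sup>2 / real m)" by (simp add: \<tau>_def add_divide_distrib)
      then have "2 + (\<tau> + z\<^sup>2) \<le> 1413 + 1413 * z\<^sup>2 + 8 * (h\<^sup>2 / real m)"
        using zero_le_power2[of z] by linarith
      then show ?thesis using triv unfolding distrib_left by linarith
    qed
  qed
  with c show ?thesis unfolding h_def by (simp add: abs_le_iff)
qed

section \<open>The dyadic coupling\<close>

text \<open>If the least index had mass 0, the preceding index would satisfy the same tail
  condition. Hence no half of a block is ever given more up-steps than it has places, see
  \<open>split_up_le\<close>.\<close>

lemma quantile_pos:
  assumes "sum p {..K} = 1" "\<And>i. 0 \<le> p i"
  shows "0 < p (quantile p K z)"
proof (rule ccontr)
  define q where "q = quantile p K z"
  assume "\<not> 0 < p (quantile p K z)"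
  then have q0: "p q = 0" using assms(2)[of q] by (simp add: q_def)
  have "sum p {q..K} = p q + sum p {Suc q..K}"
    using quantile_le[of p K z] by (simp add: q_def sum.atLeast_Suc_atMost)
  then have *: "sum p {q..K} \<le> Psi z" using q0 quantile_tail[of p K z] by (simp add: q_def)
  show False
  proof (cases q)
    case 0
    then show False using * assms(1) Psi_less_1[of z] by (simp add: atMost_atLeast0)
  next
    case (Suc k)
    then show False using * quantile_tail_less[of k p K z] by (simp add: q_def)
  qed
qed

definition split_up :: "nat \<Rightarrow> nat \<Rightarrow> real \<Rightarrow> nat" where
  "split_up m K z = quantile (hyper_pmf m K) K z"

lemma split_up_le:
  assumes "1 \<le> m" "K \<le> 2 * m"
  shows "split_up m K z \<le> K" "split_up m K z \<le> m" "K - split_up m K z \<le> m"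
proof -
  show qK: "split_up m K z \<le> K" unfolding split_up_def by (rule quantile_le)
  have "0 < hyper_pmf m K (split_up m K z)"
    unfolding split_up_def
    using symmetric_pmf.p_sum[OF hyper_symmetric_pmf[OF assms]] hyper_pmf_nonneg by (rule quantile_pos)
  then have "m choose (split_up m K z) \<noteq> 0" "m choose (K - split_up m K z) \<noteq> 0"
    using qK by (auto simp: hyper_pmf_def binomial_eq_0)
  then show "split_up m K z \<le> m" "K - split_up m K z \<le> m"
    by (auto simp: binomial_eq_0_iff)
qed

lemma measurable_split_up [measurable]: "split_up m K \<in> measurable borel (count_space UNIV)"
  unfolding split_up_def[abs_def] by (rule measurable_quantile) (rule hyper_pmf_nonneg)

text \<open>\<open>walk J a K \<zeta>\<close> distributes \<open>K\<close> up-steps over the \<open>2 ^ J\<close> places from \<open>a\<close> on, and \<open>gtree J a t \<zeta>\<close>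
  distributes a Gaussian sum \<open>t\<close> over the same places. Both split a dyadic block with the normal
  variable stored at its midpoint, so \<open>err\<close> bounds their distance at all places at once.\<close>

fun walk :: "nat \<Rightarrow> nat \<Rightarrow> nat \<Rightarrow> (nat \<Rightarrow> real) \<Rightarrow> nat \<Rightarrow> nat" where
  "walk 0 a K \<zeta> i = K"
| "walk (Suc J) a K \<zeta> i =
    (if i < a + 2 ^ J then walk J a (split_up (2 ^ J) K (\<zeta> (a + 2 ^ J))) \<zeta> i
     else walk J (a + 2 ^ J) (K - split_up (2 ^ J) K (\<zeta> (a + 2 ^ J))) \<zeta> i)"

fun gtree :: "nat \<Rightarrow> nat \<Rightarrow> real \<Rightarrow> (nat \<Rightarrow> real) \<Rightarrow> nat \<Rightarrow> real" where
  "gtree 0 a t \<zeta> i = t"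
| "gtree (Suc J) a t \<zeta> i =
    (if i < a + 2 ^ J then gtree J a (t / 2 + sqrt (2 ^ J / 2) * \<zeta> (a + 2 ^ J)) \<zeta> i
     else gtree J (a + 2 ^ J) (t / 2 - sqrt (2 ^ J / 2) * \<zeta> (a + 2 ^ J)) \<zeta> i)"

text \<open>Here \<open>m\<close> is the length of a half-block. Given the Gaussian sum
  \<open>t\<close> of all \<open>2 * m\<close> places, the left half has mean \<open>t / 2\<close>
  and variance \<open>m / 2\<close>, hence the factor \<open>sqrt (m / 2)\<close>. The left half of
  the walk deviates from half its total by \<open>2 * q - K\<close>, where \<open>q\<close> is its
  number of up-steps.\<close>

definition split_err :: "nat \<Rightarrow> nat \<Rightarrow> real \<Rightarrow> real" where
  "split_err m K z = 2 * real (split_up m K z) - real K - sqrt (real m / 2) * z"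

fun err :: "nat \<Rightarrow> nat \<Rightarrow> nat \<Rightarrow> (nat \<Rightarrow> real) \<Rightarrow> real" where
  "err 0 a K \<zeta> = 0"
| "err (Suc J) a K \<zeta> = \<bar>split_err (2 ^ J) K (\<zeta> (a + 2 ^ J))\<bar> +
    max (err J a (split_up (2 ^ J) K (\<zeta> (a + 2 ^ J))) \<zeta>)
        (err J (a + 2 ^ J) (K - split_up (2 ^ J) K (\<zeta> (a + 2 ^ J))) \<zeta>)"

lemma measurable_walk [measurable]: "(\<lambda>\<zeta>. walk J a K \<zeta> i) \<in> measurable gseq (count_space UNIV)"
proof (induction J arbitrary: a K)
  case (Suc J)
  have [measurable]: "(\<lambda>\<zeta>. walk J a (split_up (2 ^ J) K (\<zeta> (a + 2 ^ J))) \<zeta> i) \<in> measurable gseq (count_space UNIV)"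
    "(\<lambda>\<zeta>. walk J (a + 2 ^ J) (K - split_up (2 ^ J) K (\<zeta> (a + 2 ^ J))) \<zeta> i) \<in> measurable gseq (count_space UNIV)"
    by (rule measurable_compose_countable[OF Suc]; measurable)+
  show ?case by simp
qed simp

lemma measurable_err [measurable]: "(\<lambda>\<zeta>. err J a K \<zeta>) \<in> borel_measurable gseq"
proof (induction J arbitrary: a K)
  case (Suc J)
  have [measurable]: "(\<lambda>\<zeta>. err J a (split_up (2 ^ J) K (\<zeta> (a + 2 ^ J))) \<zeta>) \<in> borel_measurable gseq"
    "(\<lambda>\<zeta>. err J (a + 2 ^ J) (K - split_up (2 ^ J) K (\<zeta> (a + 2 ^ J))) \<zeta>) \<in> borel_measurable gseq"
    by (rule measurable_compose_countable[OF Suc]; measurable)+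
  have [measurable]: "split_err (2 ^ J) K \<in> borel_measurable borel"
    unfolding split_err_def[abs_def] by measurable
  show ?case by simp
next
  case 0
  have "err 0 a K = (\<lambda>_. 0)" by (simp add: fun_eq_iff)
  then show ?case by simp
qed

lemma walk_cong:
  "(\<And>j. a < j \<Longrightarrow> j < a + 2 ^ J \<Longrightarrow> \<zeta> j = \<zeta>' j) \<Longrightarrow> walk J a K \<zeta> i = walk J a K \<zeta>' i"
proof (induction J arbitrary: a K)
  case (Suc J)
  have "walk J a K \<zeta> i = walk J a K \<zeta>' i" "walk J (a + 2 ^ J) K \<zeta> i = walk J (a + 2 ^ J) K \<zeta>' i" for K
    by (rule Suc.IH, rule Suc.prems; simp)+
  moreover have "\<zeta> (a + 2 ^ J) = \<zeta>' (a + 2 ^ J)" by (rule Suc.prems) simp_all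
  ultimately show ?case by simp
qed simp

lemma gtree_cong:
  "(\<And>j. a < j \<Longrightarrow> j < a + 2 ^ J \<Longrightarrow> \<zeta> j = \<zeta>' j) \<Longrightarrow> gtree J a t \<zeta> i = gtree J a t \<zeta>' i"
proof (induction J arbitrary: a t)
  case (Suc J)
  have "gtree J a t \<zeta> i = gtree J a t \<zeta>' i" "gtree J (a + 2 ^ J) t \<zeta> i = gtree J (a + 2 ^ J) t \<zeta>' i" for t
    by (rule Suc.IH, rule Suc.prems; simp)+
  moreover have "\<zeta> (a + 2 ^ J) = \<zeta>' (a + 2 ^ J)" by (rule Suc.prems) simp_all
  ultimately show ?case by simp
qed simp

lemma err_cong:
  "(\<And>j. a < j \<Longrightarrow> j < a + 2 ^ J \<Longrightarrow> \<zeta> j = \<zeta>' j) \<Longrightarrow> err J a K \<zeta> = err J a K \<zeta>'"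
proof (induction J arbitrary: a K)
  case (Suc J)
  have "err J a K \<zeta> = err J a K \<zeta>'" "err J (a + 2 ^ J) K \<zeta> = err J (a + 2 ^ J) K \<zeta>'" for K
    by (rule Suc.IH, rule Suc.prems; simp)+
  moreover have "\<zeta> (a + 2 ^ J) = \<zeta>' (a + 2 ^ J)" by (rule Suc.prems) simp_all
  ultimately show ?case by simp
qed simp

lemma sum_double_block:
  fixes f :: "nat \<Rightarrow> 'b :: comm_monoid_add"
  shows "sum f {a..<a + 2 ^ Suc J} = sum f {a..<a + 2 ^ J} + sum f {a + 2 ^ J..<(a + 2 ^ J) + 2 ^ J}"
  using sum.atLeastLessThan_concat[of a "a + 2 ^ J" "a + 2 ^ Suc J" f] by (simp add: add.assoc mult_2)

lemma walk_sum: "K \<le> 2 ^ J \<Longrightarrow> (\<Sum>i=a..<a + 2 ^ J. walk J a K \<zeta> i) = K"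
proof (induction J arbitrary: a K)
  case (Suc J)
  define q where "q = split_up (2 ^ J) K (\<zeta> (a + 2 ^ J))"
  have q: "q \<le> K" "q \<le> 2 ^ J" "K - q \<le> 2 ^ J"
    using split_up_le[of "2 ^ J" K "\<zeta> (a + 2 ^ J)"] Suc.prems by (auto simp: q_def)
  have "(\<Sum>i=a..<a + 2 ^ J. walk (Suc J) a K \<zeta> i) = (\<Sum>i=a..<a + 2 ^ J. walk J a q \<zeta> i)"
    "(\<Sum>i=a + 2 ^ J..<(a + 2 ^ J) + 2 ^ J. walk (Suc J) a K \<zeta> i)
      = (\<Sum>i=a + 2 ^ J..<(a + 2 ^ J) + 2 ^ J. walk J (a + 2 ^ J) (K - q) \<zeta> i)"
    by (auto intro!: sum.cong simp: q_def)
  then show ?case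
    unfolding sum_double_block using Suc.IH q by simp
qed simp

lemma gtree_linear: "gtree J a t \<zeta> i = t / 2 ^ J + gtree J a 0 \<zeta> i"
proof (induction J arbitrary: a t)
  case (Suc J)
  let ?c = "sqrt (2 ^ J / 2) * \<zeta> (a + 2 ^ J)"
  have 1: "gtree J a (t / 2 + ?c) \<zeta> i = t / 2 ^ Suc J + gtree J a ?c \<zeta> i"
    unfolding Suc.IH[of a "t / 2 + ?c"] Suc.IH[of a ?c] by (simp add: add_divide_distrib)
  have 2: "gtree J (a + 2 ^ J) (t / 2 - ?c) \<zeta> i = t / 2 ^ Suc J + gtree J (a + 2 ^ J) (- ?c) \<zeta> i"
    unfolding Suc.IH[of "a + 2 ^ J" "t / 2 - ?c"] Suc.IH[of "a + 2 ^ J" "- ?c"] by (simp add: diff_divide_distrib)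
  show ?case using 1 2 by simp
qed simp

lemma gtree_shift: "gtree J a t \<zeta> i = (t - t') / 2 ^ J + gtree J a t' \<zeta> i"
  unfolding gtree_linear[of J a t] gtree_linear[of J a t'] by (simp add: diff_divide_distrib)

lemma gtree_sum: "(\<Sum>i=a..<a + 2 ^ J. gtree J a t \<zeta> i) = t"
proof (induction J arbitrary: a t)
  case (Suc J)
  let ?c = "sqrt (2 ^ J / 2) * \<zeta> (a + 2 ^ J)"
  have "(\<Sum>i=a..<a + 2 ^ J. gtree (Suc J) a t \<zeta> i) = (\<Sum>i=a..<a + 2 ^ J. gtree J a (t / 2 + ?c) \<zeta> i)"
    "(\<Sum>i=a + 2 ^ J..<(a + 2 ^ J) + 2 ^ J. gtree (Suc J) a t \<zeta> i)
      = (\<Sum>i=a + 2 ^ J..<(a + 2 ^ J) + 2 ^ J. gtree J (a + 2 ^ J) (t / 2 - ?c) \<zeta> i)"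
    by (auto intro!: sum.cong)
  then show ?case
    unfolding sum_double_block using Suc.IH by simp
qed simp

text \<open>Inside the left half the error \<open>d\<close> of the node enters with weight at most
  1; a completed left half contributes exactly \<open>d\<close>, and the right half gradually takes
  it back. So each node costs at most its own error, and only the half in which the partial sum ends
  matters further: hence the maximum in \<open>err\<close>.\<close>

lemma walk_gtree_err:
  assumes "K \<le> 2 ^ J" "k \<le> 2 ^ J"
  shows "\<bar>\<Sum>i=a..<a + k. 2 * real (walk J a K \<zeta> i) - 1 - gtree J a (2 * real K - 2 ^ J) \<zeta> i\<bar> \<le> err J a K \<zeta>"
  using assms
proof (induction J arbitrary: a K k)
  case 0
  then have "k = 0 \<or> k = 1" by auto
  then show ?case by auto
next
  case (Suc J)
  define m where "m = (2::nat) ^ J"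
  define z where "z = \<zeta> (a + m)"
  define q where "q = split_up m K z"
  define d where "d = split_err m K z"
  define t where "t = real K - real m"
  have m: "1 \<le> m" "real m = 2 ^ J" by (auto simp: m_def)
  have q: "q \<le> K" "q \<le> m" "K - q \<le> m"
    using split_up_le[of m K z] Suc.prems m by (auto simp: q_def m_def)
  have tt: "2 * real K - 2 ^ Suc J = 2 * t" using m by (simp add: t_def)
  have d: "d = 2 * real q - real K - sqrt (real m / 2) * z" by (simp add: d_def split_err_def q_def)
  let ?f = "\<lambda>i. 2 * real (walk (Suc J) a K \<zeta> i) - 1 - gtree (Suc J) a (2 * real K - 2 ^ Suc J) \<zeta> i"
  let ?l = "\<lambda>i. 2 * real (walk J a q \<zeta> i) - 1 - gtree J a (2 * real q - 2 ^ J) \<zeta> i"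
  let ?r = "\<lambda>i. 2 * real (walk J (a + m) (K - q) \<zeta> i) - 1 - gtree J (a + m) (2 * real (K - q) - 2 ^ J) \<zeta> i"
  have fl: "?f i = ?l i + d / real m" if "i < a + m" for i
  proof -
    have "gtree (Suc J) a (2 * real K - 2 ^ Suc J) \<zeta> i = gtree J a (t + sqrt (real m / 2) * z) \<zeta> i"
      unfolding tt using that m by (simp add: z_def m_def)
    also have "\<dots> = ((t + sqrt (real m / 2) * z) - (2 * real q - 2 ^ J)) / 2 ^ J + gtree J a (2 * real q - 2 ^ J) \<zeta> i"
      by (rule gtree_shift)
    also have "(t + sqrt (real m / 2) * z) - (2 * real q - 2 ^ J) = - d" using m by (simp add: d t_def)
    finally show ?thesis using that m by (simp add: q_def z_def m_def)
  qed
  have fr: "?f i = ?r i - d / real m" if "\<not> i < a + m" for i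
  proof -
    have "gtree (Suc J) a (2 * real K - 2 ^ Suc J) \<zeta> i = gtree J (a + m) (t - sqrt (real m / 2) * z) \<zeta> i"
      unfolding tt using that m by (simp add: z_def m_def)
    also have "\<dots> = ((t - sqrt (real m / 2) * z) - (2 * real (K - q) - 2 ^ J)) / 2 ^ J + gtree J (a + m) (2 * real (K - q) - 2 ^ J) \<zeta> i"
      by (rule gtree_shift)
    also have "(t - sqrt (real m / 2) * z) - (2 * real (K - q) - 2 ^ J) = d" using m q by (simp add: d t_def of_nat_diff)
    finally show ?thesis using that m by (simp add: q_def z_def m_def)
  qed
  have err: "err (Suc J) a K \<zeta> = \<bar>d\<bar> + max (err J a q \<zeta>) (err J (a + m) (K - q) \<zeta>)"
    by (simp add: d_def q_def z_def m_def)
  show ?case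
  proof (cases "k \<le> m")
    case True
    have "(\<Sum>i=a..<a + k. ?f i) = (\<Sum>i=a..<a + k. ?l i + d / real m)"
      using True by (intro sum.cong fl) auto
    also have "\<dots> = (\<Sum>i=a..<a + k. ?l i) + real k / real m * d"
      by (simp add: sum.distrib)
    finally have e: "(\<Sum>i=a..<a + k. ?f i) = (\<Sum>i=a..<a + k. ?l i) + real k / real m * d" .
    have "real k / real m * \<bar>d\<bar> \<le> 1 * \<bar>d\<bar>" using True m by (intro mult_right_mono) auto
    then have "\<bar>real k / real m * d\<bar> \<le> \<bar>d\<bar>" by (simp add: abs_mult)
    moreover have "\<bar>\<Sum>i=a..<a + k. ?l i\<bar> \<le> err J a q \<zeta>"
      using Suc.IH[of q k a] q True by (simp add: m_def)
    ultimately show ?thesis unfolding e err by linarith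
  next
    case False
    define k' where "k' = k - m"
    have k': "k = m + k'" "k' \<le> m" using False Suc.prems by (auto simp: k'_def m_def)
    have "(\<Sum>i=a..<a + k. ?f i) = (\<Sum>i=a..<a + m. ?f i) + (\<Sum>i=a + m..<(a + m) + k'. ?f i)"
      using sum.atLeastLessThan_concat[of a "a + m" "a + k" ?f] by (simp add: k' add.assoc)
    also have "(\<Sum>i=a..<a + m. ?f i) = (\<Sum>i=a..<a + m. ?l i + d / real m)"
      by (intro sum.cong fl) auto
    also have "\<dots> = (\<Sum>i=a..<a + m. ?l i) + d" using m by (simp add: sum.distrib)
    \<comment> \<open>The Gaussian tree of the left half is started from the total
      \<open>2 * q - 2 ^ J\<close> of the walk itself, so over the full half both have the same
      sum.\<close>
    also have "(\<Sum>i=a..<a + m. ?l i) = 2 * real (\<Sum>i=a..<a + m. walk J a q \<zeta> i) - real m - (\<Sum>i=a..<a + m. gtree J a (2 * real q - 2 ^ J) \<zeta> i)"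
      by (simp add: sum_subtractf sum_distrib_left)
    also have "\<dots> = 0"
      using walk_sum[of q J a \<zeta>] gtree_sum[of J a "2 * real q - 2 ^ J" \<zeta>] q m unfolding m_def by simp
    also have "(\<Sum>i=a + m..<(a + m) + k'. ?f i) = (\<Sum>i=a + m..<(a + m) + k'. ?r i - d / real m)"
      by (intro sum.cong fr) auto
    also have "\<dots> = (\<Sum>i=a + m..<(a + m) + k'. ?r i) - real k' / real m * d"
      by (simp add: sum_subtractf)
    finally have e: "(\<Sum>i=a..<a + k. ?f i) = (\<Sum>i=a + m..<(a + m) + k'. ?r i) + (1 - real k' / real m) * d"
      by (simp add: algebra_simps)
    have "(1 - real k' / real m) * \<bar>d\<bar> \<le> 1 * \<bar>d\<bar>" using m by (intro mult_right_mono) auto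
    then have "\<bar>(1 - real k' / real m) * d\<bar> \<le> \<bar>d\<bar>" using k' m by (simp add: abs_mult)
    moreover have "\<bar>\<Sum>i=a + m..<(a + m) + k'. ?r i\<bar> \<le> err J (a + m) (K - q) \<zeta>"
      using Suc.IH[of "K - q" k' "a + m"] q k' by (simp add: m_def)
    ultimately show ?thesis unfolding e err by linarith
  qed
qed

section \<open>Uniform law of the sign configurations\<close>

lemma emeasure_gseq_indep:
  assumes [measurable]: "X \<in> sets gseq" "Y \<in> sets gseq"
    and X: "\<And>\<omega> \<omega>'. (\<And>i. i \<in> A \<Longrightarrow> \<omega> i = \<omega>' i) \<Longrightarrow> \<omega> \<in> X \<longleftrightarrow> \<omega>' \<in> X"
    and Y: "\<And>\<omega> \<omega>'. (\<And>i. i \<notin> A \<Longrightarrow> \<omega> i = \<omega>' i) \<Longrightarrow> \<omega> \<in> Y \<longleftrightarrow> \<omega>' \<in> Y"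
  shows "emeasure gseq (X \<inter> Y) = emeasure gseq X * emeasure gseq Y"
proof -
  have "emeasure gseq (X \<inter> Y) = (\<integral>\<^sup>+\<omega>. indicator (X \<inter> Y) \<omega> \<partial>gseq)"
    by (rule nn_integral_indicator[symmetric]) measurable
  also have "\<dots> = (\<integral>\<^sup>+x. \<integral>\<^sup>+y. indicator (X \<inter> Y) (\<lambda>i. if i \<in> A then x i else y i) \<partial>gseq \<partial>gseq)"
    by (rule nn_integral_resample) measurable
  also have "\<dots> = (\<integral>\<^sup>+x. \<integral>\<^sup>+y. indicator X x * indicator Y y \<partial>gseq \<partial>gseq)"
  proof (intro nn_integral_cong)
    fix x y
    have "(\<lambda>i. if i \<in> A then x i else y i) \<in> X \<longleftrightarrow> x \<in> X" by (rule X) simp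
    moreover have "(\<lambda>i. if i \<in> A then x i else y i) \<in> Y \<longleftrightarrow> y \<in> Y" by (rule Y) simp
    ultimately show "(indicator (X \<inter> Y) (\<lambda>i. if i \<in> A then x i else y i) :: ennreal) = indicator X x * indicator Y y"
      by (simp add: indicator_def)
  qed
  also have "\<dots> = emeasure gseq X * emeasure gseq Y"
    by (simp add: nn_integral_cmult nn_integral_multc)
  finally show ?thesis .
qed

lemma emeasure_gseq_coord:
  "B \<in> sets borel \<Longrightarrow> emeasure gseq {\<omega>. \<omega> i \<in> B} = emeasure gaussian B"
  using emeasure_gseq_box[of "{i}" "\<lambda>_. B"] by simp

lemma sets_walk_eq [measurable]: "{\<zeta>. \<forall>i\<in>I. walk J a K \<zeta> i = b i} \<in> sets gseq" if "finite I"
proof -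
  have "{\<zeta> \<in> space gseq. \<forall>i\<in>I. walk J a K \<zeta> i = b i} \<in> sets gseq"
    using that by measurable
  then show ?thesis by simp
qed

lemma measure_split_up:
  assumes "1 \<le> m" "K \<le> 2 * m" "k \<le> K"
  shows "emeasure gaussian {z. split_up m K z = k} = ennreal (hyper_pmf m K k)"
  unfolding split_up_def gaussian.emeasure_eq_measure
  using measure_quantile[OF hyper_pmf_nonneg symmetric_pmf.p_sum[OF hyper_symmetric_pmf[OF assms(1,2)]] assms(3)]
  by simp

text \<open>The variables at the node, in the left half and in the right half have disjoint indices,
  so the probabilities multiply. The hypergeometric mass of the split cancels the binomial
  coefficients of the halves, which leaves all placements of the \<open>K\<close> up-steps equally
  likely.\<close>

lemma walk_law:
  assumes "K \<le> 2 ^ J" "\<And>i. b i \<le> 1" "sum b {a..<a + 2 ^ J} = K"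
  shows "emeasure gseq {\<zeta>. \<forall>i\<in>{a..<a + 2 ^ J}. walk J a K \<zeta> i = b i} = ennreal (1 / real (2 ^ J choose K))"
  using assms(1,3)
proof (induction J arbitrary: a K)
  case 0
  then have "K = 0 \<or> K = 1" by auto
  then have "real (2 ^ 0 choose K) = 1" by auto
  moreover have "{\<zeta>. \<forall>i\<in>{a..<a + 2 ^ 0}. walk 0 a K \<zeta> i = b i} = space gseq" using 0 by auto
  ultimately show ?case by (simp only: gseq.emeasure_space_1) simp
next
  case (Suc J)
  define m where "m = (2::nat) ^ J"
  have m: "1 \<le> m" by (simp add: m_def)
  define k where "k = sum b {a..<a + m}"
  have K: "K = k + sum b {a + m..<(a + m) + m}"
    using Suc.prems(2) unfolding sum_double_block by (simp add: k_def m_def)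
  have k_le: "k \<le> m" "sum b {a + m..<(a + m) + m} \<le> m"
    using sum_bounded_above[of "{a..<a + m}" b 1] sum_bounded_above[of "{a + m..<(a + m) + m}" b 1] assms(2)
    by (auto simp: k_def)
  have Kk: "K - k = sum b {a + m..<(a + m) + m}" "k \<le> K" using K by auto
  let ?E = "\<lambda>J a K. {\<zeta>. \<forall>i\<in>{a..<a + 2 ^ J}. walk J a K \<zeta> i = b i}"
  let ?C = "{\<zeta>. \<zeta> (a + m) \<in> {z. split_up m K z = k}}"
  have [measurable]: "{z. split_up m K z = k} \<in> sets borel"
    using measurable_sets[OF measurable_split_up, of "{k}" m K] by (simp add: vimage_def)
  have C [measurable]: "?C \<in> sets gseq"
    using measurable_sets[OF measurable_gseq_coord[of "a + m"], of "{z. split_up m K z = k}"] by (simp add: vimage_def)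
  have eq: "?E (Suc J) a K = ?C \<inter> (?E J a k \<inter> ?E J (a + m) (K - k))"
  proof (rule set_eqI)
    fix \<zeta>
    define q where "q = split_up m K (\<zeta> (a + m))"
    have q: "q \<le> m" using split_up_le[OF m, of K] Suc.prems by (simp add: q_def m_def)
    have 1: "(\<forall>i\<in>{a..<a + 2 ^ Suc J}. walk (Suc J) a K \<zeta> i = b i) \<longleftrightarrow>
      (\<forall>i\<in>{a..<a + m}. walk J a q \<zeta> i = b i) \<and> (\<forall>i\<in>{a + m..<(a + m) + m}. walk J (a + m) (K - q) \<zeta> i = b i)"
      (is "?l = (?r1 \<and> ?r2)")
    proof
      assume l: ?l
      show "?r1 \<and> ?r2"
      proof (intro conjI ballI)
        fix i assume "i \<in> {a..<a + m}"
        then show "walk J a q \<zeta> i = b i" using l[rule_format, of i] by (auto simp: q_def m_def)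
      next
        fix i assume "i \<in> {a + m..<(a + m) + m}"
        then show "walk J (a + m) (K - q) \<zeta> i = b i" using l[rule_format, of i] by (auto simp: q_def m_def)
      qed
    next
      assume r: "?r1 \<and> ?r2"
      show ?l
      proof
        fix i assume "i \<in> {a..<a + 2 ^ Suc J}"
        then show "walk (Suc J) a K \<zeta> i = b i"
          using r by (cases "i < a + m") (auto simp: q_def m_def)
      qed
    qed
    \<comment> \<open>A prescribed configuration fixes the split, because \<open>q\<close> is the
      number of up-steps in the left half.\<close>
    have "q = k" if "\<forall>i\<in>{a..<a + m}. walk J a q \<zeta> i = b i"
    proof -
      have "q = (\<Sum>i=a..<a + 2 ^ J. walk J a q \<zeta> i)" using walk_sum[of q J a \<zeta>] q by (simp add: m_def)
      also have "\<dots> = k" unfolding k_def m_def using that by (intro sum.cong) (auto simp: m_def)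
      finally show ?thesis .
    qed
    then show "\<zeta> \<in> ?E (Suc J) a K \<longleftrightarrow> \<zeta> \<in> ?C \<inter> (?E J a k \<inter> ?E J (a + m) (K - k))"
      unfolding mem_Collect_eq Int_iff 1 by (auto simp: q_def m_def)
  qed
  have cong: "walk J a' K' \<omega> i = walk J a' K' \<omega>' i"
    if "\<And>j. a' < j \<Longrightarrow> j < a' + m \<Longrightarrow> \<omega> j = \<omega>' j" for a' K' \<omega> \<omega>' i
    using that unfolding m_def by (rule walk_cong)
  have "emeasure gseq (?E (Suc J) a K) = emeasure gseq ?C * emeasure gseq (?E J a k \<inter> ?E J (a + m) (K - k))"
    unfolding eq
  proof (rule emeasure_gseq_indep[where A = "{a + m}"])
    fix \<omega> \<omega>' :: "nat \<Rightarrow> real" assume "\<And>i. i \<notin> {a + m} \<Longrightarrow> \<omega> i = \<omega>' i"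
    then have "walk J a k \<omega> i = walk J a k \<omega>' i" "walk J (a + m) (K - k) \<omega> i = walk J (a + m) (K - k) \<omega>' i" for i
      by (auto intro!: cong)
    then show "\<omega> \<in> ?E J a k \<inter> ?E J (a + m) (K - k) \<longleftrightarrow> \<omega>' \<in> ?E J a k \<inter> ?E J (a + m) (K - k)" by simp
  qed (use C in auto)
  also have "emeasure gseq (?E J a k \<inter> ?E J (a + m) (K - k)) = emeasure gseq (?E J a k) * emeasure gseq (?E J (a + m) (K - k))"
  proof (rule emeasure_gseq_indep[where A = "{a..<a + m}"])
    fix \<omega> \<omega>' :: "nat \<Rightarrow> real" assume "\<And>i. i \<in> {a..<a + m} \<Longrightarrow> \<omega> i = \<omega>' i"
    then have "walk J a k \<omega> i = walk J a k \<omega>' i" for i by (auto intro!: cong)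
    then show "\<omega> \<in> ?E J a k \<longleftrightarrow> \<omega>' \<in> ?E J a k" by simp
  next
    fix \<omega> \<omega>' :: "nat \<Rightarrow> real" assume "\<And>i. i \<notin> {a..<a + m} \<Longrightarrow> \<omega> i = \<omega>' i"
    then have "walk J (a + m) (K - k) \<omega> i = walk J (a + m) (K - k) \<omega>' i" for i by (auto intro!: cong)
    then show "\<omega> \<in> ?E J (a + m) (K - k) \<longleftrightarrow> \<omega>' \<in> ?E J (a + m) (K - k)" by simp
  qed auto
  also have "emeasure gseq (?E J a k) = ennreal (1 / real (m choose k))"
  proof -
    have "k \<le> 2 ^ J" "sum b {a..<a + 2 ^ J} = k" using k_le(1) by (auto simp: k_def m_def)
    then show ?thesis unfolding m_def by (rule Suc.IH)
  qed
  also have "emeasure gseq (?E J (a + m) (K - k)) = ennreal (1 / real (m choose (K - k)))"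
  proof -
    have "K - k \<le> 2 ^ J" "sum b {a + m..<(a + m) + 2 ^ J} = K - k" using k_le(2) Kk(1) by (auto simp: m_def)
    then show ?thesis unfolding m_def by (rule Suc.IH)
  qed
  also have "emeasure gseq ?C = ennreal (hyper_pmf m K k)"
  proof -
    have "K \<le> 2 * m" using Suc.prems by (simp add: m_def)
    then have "emeasure gaussian {z. split_up m K z = k} = ennreal (hyper_pmf m K k)"
      using m Kk(2) by (intro measure_split_up)
    then show ?thesis by (subst emeasure_gseq_coord) measurable
  qed
  also have "ennreal (hyper_pmf m K k) * (ennreal (1 / real (m choose k)) * ennreal (1 / real (m choose (K - k))))
     = ennreal (hyper_pmf m K k * (1 / real (m choose k) * (1 / real (m choose (K - k)))))"
  proof -
    have "0 \<le> 1 / real (m choose k)" "0 \<le> 1 / real (m choose (K - k))" by simp_all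
    then show ?thesis by (simp only: ennreal_mult hyper_pmf_nonneg mult_nonneg_nonneg)
  qed
  also have "hyper_pmf m K k * (1 / real (m choose k) * (1 / real (m choose (K - k)))) = 1 / real (2 ^ Suc J choose K)"
    using k_le Kk by (simp add: hyper_pmf_def m_def)
  finally show ?case .
qed

definition top_up :: "nat \<Rightarrow> real \<Rightarrow> nat" where
  "top_up J z = quantile (binom_pmf (2 ^ J)) (2 ^ J) z"

lemma measurable_top_up [measurable]: "top_up J \<in> measurable borel (count_space UNIV)"
  unfolding top_up_def[abs_def] by (rule measurable_quantile) (simp add: binom_pmf_def)

lemma top_up_le: "top_up J z \<le> 2 ^ J"
  unfolding top_up_def by (rule quantile_le)

lemma measurable_top_walk [measurable]:
  "(\<lambda>\<zeta>. walk J 0 (top_up J (\<zeta> 0)) \<zeta> i) \<in> measurable gseq (count_space UNIV)"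
  by (rule measurable_compose_countable[OF measurable_walk]) measurable

lemma top_walk_law:
  assumes b: "\<And>i. b i \<le> 1"
  shows "emeasure gseq {\<zeta>. \<forall>i\<in>{..<2 ^ J}. walk J 0 (top_up J (\<zeta> 0)) \<zeta> i = b i} = ennreal (1 / 2 ^ (2 ^ J))"
proof -
  define n where "n = (2::nat) ^ J"
  define k where "k = sum b {0..<0 + n}"
  have k_le: "k \<le> n" using sum_bounded_above[of "{0..<0 + n}" b 1] b by (auto simp: k_def)
  let ?E = "{\<zeta>. \<forall>i\<in>{0..<0 + 2 ^ J}. walk J 0 k \<zeta> i = b i}"
  let ?C = "{\<zeta>. \<zeta> 0 \<in> {z. top_up J z = k}}"
  have [measurable]: "{z. top_up J z = k} \<in> sets borel"
    using measurable_sets[OF measurable_top_up, of "{k}" J] by (simp add: vimage_def)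
  have C [measurable]: "?C \<in> sets gseq"
    using measurable_sets[OF measurable_gseq_coord[of 0], of "{z. top_up J z = k}"] by (simp add: vimage_def)
  have eq: "{\<zeta>. \<forall>i\<in>{..<2 ^ J}. walk J 0 (top_up J (\<zeta> 0)) \<zeta> i = b i} = ?C \<inter> ?E"
  proof (rule set_eqI)
    fix \<zeta>
    have "top_up J (\<zeta> 0) = k" if "\<forall>i\<in>{..<2 ^ J}. walk J 0 (top_up J (\<zeta> 0)) \<zeta> i = b i"
      using walk_sum[OF top_up_le[of J "\<zeta> 0"], of 0 \<zeta>] that by (simp add: k_def n_def atLeast0LessThan)
    then show "\<zeta> \<in> {\<zeta>. \<forall>i\<in>{..<2 ^ J}. walk J 0 (top_up J (\<zeta> 0)) \<zeta> i = b i} \<longleftrightarrow> \<zeta> \<in> ?C \<inter> ?E" by auto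
  qed
  have "emeasure gseq {\<zeta>. \<forall>i\<in>{..<2 ^ J}. walk J 0 (top_up J (\<zeta> 0)) \<zeta> i = b i} = emeasure gseq ?C * emeasure gseq ?E"
    unfolding eq
  proof (rule emeasure_gseq_indep[where A = "{0}"])
    fix \<omega> \<omega>' :: "nat \<Rightarrow> real" assume "\<And>i. i \<notin> {0} \<Longrightarrow> \<omega> i = \<omega>' i"
    then have "walk J 0 k \<omega> i = walk J 0 k \<omega>' i" for i by (intro walk_cong) auto
    then show "\<omega> \<in> ?E \<longleftrightarrow> \<omega>' \<in> ?E" by simp
  next
    show "?C \<in> sets gseq" by (rule C)
    show "?E \<in> sets gseq" by (rule sets_walk_eq) simp
    fix \<omega> \<omega>' :: "nat \<Rightarrow> real" assume "\<And>i. i \<in> {0} \<Longrightarrow> \<omega> i = \<omega>' i"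
    then show "\<omega> \<in> ?C \<longleftrightarrow> \<omega>' \<in> ?C" by simp
  qed
  also have "emeasure gseq ?C = ennreal (binom_pmf n k)"
  proof -
    have "0 \<le> binom_pmf n i" for i by (simp add: binom_pmf_def)
    from measure_quantile[OF this symmetric_pmf.p_sum[OF binom_symmetric_pmf[of n]] k_le]
    have "emeasure gaussian {z. top_up J z = k} = ennreal (binom_pmf n k)"
      unfolding top_up_def n_def gaussian.emeasure_eq_measure by (rule arg_cong)
    then show ?thesis by (subst emeasure_gseq_coord) measurable
  qed
  also have "emeasure gseq ?E = ennreal (1 / real (n choose k))"
    unfolding n_def by (rule walk_law) (use b k_le in \<open>auto simp: k_def n_def\<close>)
  also have "ennreal (binom_pmf n k) * ennreal (1 / real (n choose k)) = ennreal (binom_pmf n k * (1 / real (n choose k)))"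
    by (rule ennreal_mult[symmetric]) (simp_all add: binom_pmf_def)
  also have "binom_pmf n k * (1 / real (n choose k)) = 1 / 2 ^ (2 ^ J)"
    using k_le by (simp add: binom_pmf_def n_def)
  finally show ?thesis .
qed

section \<open>Exponential moments of the coupling error\<close>

lemma gaussian_exp_square: "(\<integral>\<^sup>+x. ennreal (exp (x\<^sup>2 / 4)) \<partial>gaussian) = ennreal (sqrt 2)"
proof -
  have "std_normal_density x * exp (x\<^sup>2 / 4) = sqrt 2 * normal_density 0 (sqrt 2) x" for x
  proof -
    have "exp (- x\<^sup>2 / 2) * exp (x\<^sup>2 / 4) = exp (- x\<^sup>2 / 4)"
      by (simp flip: exp_add)
    then have "std_normal_density x * exp (x\<^sup>2 / 4) = 1 / sqrt (2 * pi) * exp (- x\<^sup>2 / 4)"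
      unfolding std_normal_density_def by (simp only: mult.assoc)
    moreover have "sqrt 2 * normal_density 0 (sqrt 2) x = 1 / sqrt (2 * pi) * exp (- x\<^sup>2 / 4)"
      by (simp add: normal_density_def real_sqrt_mult field_simps)
    ultimately show ?thesis by simp
  qed
  then have "(\<integral>\<^sup>+x. ennreal (exp (x\<^sup>2 / 4)) \<partial>gaussian) = (\<integral>\<^sup>+x. ennreal (sqrt 2) * ennreal (normal_density 0 (sqrt 2) x) \<partial>lborel)"
    by (subst nn_integral_gaussian) (simp_all flip: ennreal_mult)
  also have "\<dots> = ennreal (sqrt 2) * emeasure (density lborel (normal_density 0 (sqrt 2))) UNIV"
    by (simp add: nn_integral_cmult emeasure_density)
  also have "emeasure (density lborel (normal_density 0 (sqrt 2))) UNIV = 1"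
    using prob_space.emeasure_space_1[OF prob_space_normal_density[of "sqrt 2" 0]] by simp
  finally show ?thesis by simp
qed

text \<open>The exponent of the moment bounds: \<open>4 * 1510 * rate = 1\<close>.\<close>

definition rate :: real where "rate = 1 / 6040"

text \<open>The growth factor of one level: 2 for the two halves, \<open>sqrt 2\<close> from the
  moment of \<open>exp (x\<^sup>2 / 4)\<close>, and an exponential of the additive constants, which
  are 1798 and 1542 below.\<close>

lemma exp_const_le: "0 \<le> c \<Longrightarrow> c \<le> 1800 \<Longrightarrow> 2 * exp (rate * c) * sqrt 2 \<le> 8"
proof -
  assume c: "0 \<le> c" "c \<le> 1800"
  have "rate * c \<le> 1 / 3" "0 \<le> rate * c" using c by (auto simp: rate_def)
  then have "1 - 1 / 3 \<le> exp (- (rate * c))" using exp_ge_add_one_self[of "- (rate * c)"] by linarith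
  then have "exp (rate * c) \<le> 3 / 2" by (simp add: exp_minus field_simps)
  moreover have "sqrt 2 \<le> 3 / 2" by (rule real_le_lsqrt) (auto simp: power2_eq_square)
  ultimately have "exp (rate * c) * sqrt 2 \<le> (3 / 2) * (3 / 2)" by (intro mult_mono) auto
  moreover have "2 * exp (rate * c) * sqrt 2 = 2 * (exp (rate * c) * sqrt 2)" by simp
  ultimately show ?thesis by linarith
qed

definition spread :: "nat \<Rightarrow> nat \<Rightarrow> real" where
  "spread J K = (2 * real K - 2 ^ J)\<^sup>2 / 2 ^ J"

text \<open>Without fluctuation the split would halve the normalised squared imbalance. The
  inequality \<open>(h + s)\<^sup>2 \<le> 3 / 2 * h\<^sup>2 + 3 * s\<^sup>2\<close> admits the
  fluctuation and still leaves the factor 3/4; that it is below 1 closes the induction in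
  \<open>err_moment\<close>.\<close>

lemma spread_split:
  fixes z :: real
  assumes K: "K \<le> 2 ^ Suc J"
  defines "q \<equiv> split_up (2 ^ J) K z"
  shows "spread J q \<le> 3 / 4 * spread (Suc J) K + 24 + 6 * z\<^sup>2"
    "spread J (K - q) \<le> 3 / 4 * spread (Suc J) K + 24 + 6 * z\<^sup>2"
    "\<bar>split_err (2 ^ J) K z\<bar> \<le> 1414 * (1 + z\<^sup>2) + 4 * spread (Suc J) K"
proof -
  define m :: nat where "m = 2 ^ J"
  have m: "1 \<le> m" "(2::real) ^ J = real m" by (auto simp: m_def)
  have K2: "K \<le> 2 * m" using K by (simp add: m_def)
  have qK: "q \<le> K" using split_up_le[OF m(1) K2, of z] by (simp add: q_def m_def)
  define h where "h = real K - real m"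
  define u where "u = 2 * real q - real K"
  have V: "spread (Suc J) K = 2 * (h\<^sup>2 / real m)"
  proof -
    have "spread (Suc J) K = (2 * real K - 2 * real m)\<^sup>2 / (2 * real m)"
      by (simp only: spread_def power_Suc m)
    also have "(2 * real K - 2 * real m)\<^sup>2 = 4 * h\<^sup>2" by (simp add: h_def power2_eq_square algebra_simps)
    finally show ?thesis by simp
  qed
  have "\<bar>u\<bar> \<le> 2 + sqrt (real m) * \<bar>z\<bar>"
    using hyper_quantile_bound[OF m(1) K2, of z] by (simp add: u_def q_def split_up_def m_def)
  then have "\<bar>u\<bar>\<^sup>2 \<le> (2 + sqrt (real m) * \<bar>z\<bar>)\<^sup>2" by (intro power_mono) auto
  also have "\<dots> \<le> 8 + 2 * (sqrt (real m) * \<bar>z\<bar>)\<^sup>2"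
    using zero_le_power2[of "2 - sqrt (real m) * \<bar>z\<bar>"] by (simp add: power2_eq_square algebra_simps)
  also have "(sqrt (real m) * \<bar>z\<bar>)\<^sup>2 = real m * z\<^sup>2" by (simp add: power_mult_distrib)
  also have "8 + 2 * (real m * z\<^sup>2) \<le> real m * (8 + 2 * z\<^sup>2)"
    using m by (simp add: algebra_simps)
  finally have u: "u\<^sup>2 / real m \<le> 8 + 2 * z\<^sup>2" using m by (simp add: pos_divide_le_eq mult.commute)
  have sq: "(h + s)\<^sup>2 / real m \<le> 3 / 2 * (h\<^sup>2 / real m) + 3 * (s\<^sup>2 / real m)" for s
  proof -
    have "(h + s)\<^sup>2 \<le> 3 / 2 * h\<^sup>2 + 3 * s\<^sup>2"
      using zero_le_power2[of "h - 2 * s"] by (simp add: power2_eq_square algebra_simps)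
    then have "(h + s)\<^sup>2 / real m \<le> (3 / 2 * h\<^sup>2 + 3 * s\<^sup>2) / real m" using m by (intro divide_right_mono) auto
    then show ?thesis by (simp add: add_divide_distrib)
  qed
  have "2 * real q - 2 ^ J = h + u" "2 * real (K - q) - 2 ^ J = h + (- u)"
    using qK by (simp_all add: m h_def u_def of_nat_diff)
  then have "spread J q = (h + u)\<^sup>2 / real m" "spread J (K - q) = (h + (- u))\<^sup>2 / real m"
    by (simp_all only: spread_def m)
  then show "spread J q \<le> 3 / 4 * spread (Suc J) K + 24 + 6 * z\<^sup>2"
    "spread J (K - q) \<le> 3 / 4 * spread (Suc J) K + 24 + 6 * z\<^sup>2"
    using sq[of u] sq[of "- u"] u by (simp_all add: V)
  show "\<bar>split_err (2 ^ J) K z\<bar> \<le> 1414 * (1 + z\<^sup>2) + 4 * spread (Suc J) K"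
    using hyper_quantile_close[OF m(1) K2, of z]
    unfolding m_def[symmetric] split_err_def split_up_def V h_def by simp
qed

lemma measurable_split_err [measurable]: "split_err m K \<in> borel_measurable borel"
  unfolding split_err_def[abs_def] by measurable

text \<open>The weight 16 solves \<open>4 + 16 * (3 / 4) = 16\<close>, with 4 from the split error
  and 3/4 from the contraction of \<open>spread\<close>. The node variable enters with
  \<open>1414 + 16 * 6 = 1510\<close> times its square, which \<open>rate\<close> turns into
  \<open>x\<^sup>2 / 4\<close>; the constants add up to
  \<open>1414 + 16 * 24 = 1798\<close>.\<close>

lemma err_moment:
  "K \<le> 2 ^ J \<Longrightarrow>
    (\<integral>\<^sup>+\<zeta>. ennreal (exp (rate * err J a K \<zeta>)) \<partial>gseq) \<le> ennreal (8 ^ J * exp (16 * rate * spread J K))"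
proof (induction J arbitrary: a K)
  case 0
  have "(1::real) \<le> exp (16 * rate * spread 0 K)" by (simp add: rate_def spread_def)
  then show ?case using gseq.emeasure_space_1 by simp
next
  case (Suc J)
  define m :: nat where "m = 2 ^ J"
  define V where "V = spread (Suc J) K"
  define F :: "real \<Rightarrow> (nat \<Rightarrow> real) \<Rightarrow> ennreal" where
    "F x \<zeta> = ennreal (exp (rate * \<bar>split_err m K x\<bar>)) *
      (ennreal (exp (rate * err J a (split_up m K x) \<zeta>)) +
       ennreal (exp (rate * err J (a + m) (K - split_up m K x) \<zeta>)))" for x \<zeta>
  have V: "0 \<le> V" by (simp add: V_def spread_def)
  have [measurable]: "(\<lambda>z. err J a (split_up m K (fst z)) (snd z)) \<in> borel_measurable (borel \<Otimes>\<^sub>M gseq)"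
    "(\<lambda>z. err J (a + m) (K - split_up m K (fst z)) (snd z)) \<in> borel_measurable (borel \<Otimes>\<^sub>M gseq)"
    by (rule measurable_compose_countable[where f = "\<lambda>k z. err J a k (snd z)"]; measurable)
      (rule measurable_compose_countable[where f = "\<lambda>k z. err J (a + m) (K - k) (snd z)"]; measurable)
  have Fm: "case_prod F \<in> borel_measurable (borel \<Otimes>\<^sub>M gseq)"
    unfolding F_def[abs_def] case_prod_beta' by measurable
  have "(\<integral>\<^sup>+\<zeta>. ennreal (exp (rate * err (Suc J) a K \<zeta>)) \<partial>gseq) \<le> (\<integral>\<^sup>+\<zeta>. F (\<zeta> (a + m)) \<zeta> \<partial>gseq)"
  proof (rule nn_integral_mono)
    fix \<zeta>
    let ?e1 = "err J a (split_up m K (\<zeta> (a + m))) \<zeta>" and ?e2 = "err J (a + m) (K - split_up m K (\<zeta> (a + m))) \<zeta>"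
    have "exp (rate * err (Suc J) a K \<zeta>) = exp (rate * \<bar>split_err m K (\<zeta> (a + m))\<bar>) * exp (rate * max ?e1 ?e2)"
      by (simp add: m_def distrib_left flip: exp_add)
    \<comment> \<open>Bounding the maximum by a sum of exponentials costs a factor 2 per level,
      hence a constant power of the number of leaves, which only affects the constant in front of
      the logarithm.\<close>
    also have "\<dots> \<le> exp (rate * \<bar>split_err m K (\<zeta> (a + m))\<bar>) * (exp (rate * ?e1) + exp (rate * ?e2))"
      by (intro mult_left_mono) (auto simp: max_def)
    finally show "ennreal (exp (rate * err (Suc J) a K \<zeta>)) \<le> F (\<zeta> (a + m)) \<zeta>"
      unfolding F_def by (simp flip: ennreal_mult ennreal_plus)
  qed
  also have "\<dots> = (\<integral>\<^sup>+x. \<integral>\<^sup>+\<zeta>. F x \<zeta> \<partial>gseq \<partial>gaussian)"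
  proof (rule nn_integral_gseq_freeze[OF Fm])
    fix x y :: real and w :: "nat \<Rightarrow> real"
    have "err J a k (w(a + m := y)) = err J a k w" "err J (a + m) k (w(a + m := y)) = err J (a + m) k w" for k
      by (rule err_cong; simp add: m_def)+
    then show "F x (w(a + m := y)) = F x w" by (simp add: F_def)
  qed
  also have "\<dots> \<le> (\<integral>\<^sup>+x. ennreal (2 * 8 ^ J * exp (rate * 1798) * exp (16 * rate * V)) * ennreal (exp (x\<^sup>2 / 4)) \<partial>gaussian)"
  proof (rule nn_integral_mono)
    fix x :: real
    let ?q = "split_up m K x"
    have q: "?q \<le> m" "K - ?q \<le> m" using split_up_le[of m K x] Suc.prems by (auto simp: m_def)
    note sp = spread_split[OF Suc.prems, of x, folded m_def V_def]
    let ?W = "3 / 4 * V + 24 + 6 * x\<^sup>2"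
    have r: "0 \<le> rate" by (simp add: rate_def)
    have IH: "(\<integral>\<^sup>+\<zeta>. ennreal (exp (rate * err J a' k \<zeta>)) \<partial>gseq) \<le> ennreal (8 ^ J * exp (16 * rate * ?W))"
      if "k \<le> m" "spread J k \<le> ?W" for a' k
    proof -
      have "16 * rate * spread J k \<le> 16 * rate * ?W" using that r by (intro mult_left_mono) auto
      then have "8 ^ J * exp (16 * rate * spread J k) \<le> 8 ^ J * exp (16 * rate * ?W)" by simp
      then show ?thesis
        using Suc.IH[of k a'] that(1) by (auto simp: m_def intro: order_trans ennreal_leI)
    qed
    have "(\<integral>\<^sup>+\<zeta>. F x \<zeta> \<partial>gseq) = ennreal (exp (rate * \<bar>split_err m K x\<bar>)) *
       ((\<integral>\<^sup>+\<zeta>. ennreal (exp (rate * err J a ?q \<zeta>)) \<partial>gseq) + (\<integral>\<^sup>+\<zeta>. ennreal (exp (rate * err J (a + m) (K - ?q) \<zeta>)) \<partial>gseq))"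
      unfolding F_def by (simp add: nn_integral_cmult nn_integral_add)
    also have "\<dots> \<le> ennreal (exp (rate * (1414 * (1 + x\<^sup>2) + 4 * V))) *
       (ennreal (8 ^ J * exp (16 * rate * ?W)) + ennreal (8 ^ J * exp (16 * rate * ?W)))"
      using sp r q by (intro mult_mono add_mono IH ennreal_leI) (auto intro!: mult_left_mono)
    also have "\<dots> = ennreal (exp (rate * (1414 * (1 + x\<^sup>2) + 4 * V)) * (2 * 8 ^ J * exp (16 * rate * ?W)))"
      by (simp flip: ennreal_mult ennreal_plus)
    also have "exp (rate * (1414 * (1 + x\<^sup>2) + 4 * V)) * (2 * 8 ^ J * exp (16 * rate * ?W))
      = 2 * 8 ^ J * (exp (rate * (1414 * (1 + x\<^sup>2) + 4 * V)) * exp (16 * rate * ?W))" by simp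
    also have "exp (rate * (1414 * (1 + x\<^sup>2) + 4 * V)) * exp (16 * rate * ?W) = exp (rate * 1798) * exp (16 * rate * V) * exp (x\<^sup>2 / 4)"
      unfolding exp_add[symmetric] by (simp add: rate_def algebra_simps)
    also have "ennreal (2 * 8 ^ J * (exp (rate * 1798) * exp (16 * rate * V) * exp (x\<^sup>2 / 4)))
       = ennreal (2 * 8 ^ J * exp (rate * 1798) * exp (16 * rate * V)) * ennreal (exp (x\<^sup>2 / 4))"
      by (simp flip: ennreal_mult add: mult.assoc)
    finally show "(\<integral>\<^sup>+\<zeta>. F x \<zeta> \<partial>gseq) \<le> ennreal (2 * 8 ^ J * exp (rate * 1798) * exp (16 * rate * V)) * ennreal (exp (x\<^sup>2 / 4))" .
  qed
  also have "\<dots> = ennreal (2 * 8 ^ J * exp (rate * 1798) * exp (16 * rate * V) * sqrt 2)"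
  proof -
    have "(\<lambda>x::real. exp (x\<^sup>2 / 4)) \<in> borel_measurable borel"
      by (intro borel_measurable_continuous_onI continuous_intros) auto
    then have "(\<lambda>x. ennreal (exp (x\<^sup>2 / 4))) \<in> borel_measurable gaussian"
      unfolding measurable_cong_sets[OF sets_gaussian refl] by (rule measurable_compose) simp
    then show ?thesis
      by (subst nn_integral_cmult) (simp_all only: gaussian_exp_square, simp flip: ennreal_mult)
  qed
  also have "\<dots> \<le> ennreal (8 ^ Suc J * exp (16 * rate * V))"
  proof (rule ennreal_leI)
    have "(2 * exp (rate * 1798) * sqrt 2) * (8 ^ J * exp (16 * rate * V)) \<le> 8 * (8 ^ J * exp (16 * rate * V))"
      by (intro mult_right_mono exp_const_le) auto
    then show "2 * 8 ^ J * exp (rate * 1798) * exp (16 * rate * V) * sqrt 2 \<le> 8 ^ Suc J * exp (16 * rate * V)"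
      by (simp add: mult_ac)
  qed
  finally show ?case by (simp add: V_def)
qed

section \<open>The Haar transform and the signs built from it\<close>

fun haar :: "nat \<Rightarrow> nat \<Rightarrow> (nat \<Rightarrow> real) \<Rightarrow> nat \<Rightarrow> real" where
  "haar 0 a w = w"
| "haar (Suc J) a w = rot a (a + 2 ^ J) (haar J (a + 2 ^ J) (haar J a w))"

lemma preserving_haar: "preserving (haar J a)"
proof (induction J arbitrary: a)
  case 0
  have "haar 0 a = (\<lambda>w. w)" by (simp add: fun_eq_iff)
  then show ?case by (simp add: preserving_id)
next
  case (Suc J)
  have "preserving (\<lambda>w. rot a (a + 2 ^ J) (haar J (a + 2 ^ J) (haar J a w)))"
    by (intro preserving_comp[OF preserving_rot] preserving_comp[OF Suc.IH Suc.IH]) simp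
  moreover have "haar (Suc J) a = (\<lambda>w. rot a (a + 2 ^ J) (haar J (a + 2 ^ J) (haar J a w)))"
    by (simp add: fun_eq_iff)
  ultimately show ?case by simp
qed

lemma haar_outside: "i \<notin> {a..<a + 2 ^ J} \<Longrightarrow> haar J a w i = w i"
proof (induction J arbitrary: a w)
  case (Suc J)
  have "i \<notin> {a..<a + 2 ^ J}" "i \<notin> {a + 2 ^ J..<(a + 2 ^ J) + 2 ^ J}" "i \<noteq> a" "i \<noteq> a + 2 ^ J"
    using Suc.prems by auto
  then show ?case using Suc.IH by (simp add: rot_def)
qed simp

lemma haar_local:
  "(\<And>i. i \<in> {a..<a + 2 ^ J} \<Longrightarrow> w i = w' i) \<Longrightarrow> i \<in> {a..<a + 2 ^ J} \<Longrightarrow> haar J a w i = haar J a w' i"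
proof (induction J arbitrary: a w w' i)
  case (Suc J)
  let ?L = "{a..<a + 2 ^ J}" and ?R = "{a + 2 ^ J..<(a + 2 ^ J) + 2 ^ J}"
  have L: "haar J a w i = haar J a w' i" if "i \<in> ?L" for i
    using Suc.IH[of a w w' i] Suc.prems(1) that by auto
  have agree: "haar J a w i = haar J a w' i" if "i \<in> ?L \<union> ?R" for i
    using L[of i] haar_outside[of i a J w] haar_outside[of i a J w'] Suc.prems(1)[of i] that by (cases "i \<in> ?L") auto
  have "haar J (a + 2 ^ J) (haar J a w) i = haar J (a + 2 ^ J) (haar J a w') i" if "i \<in> ?L \<union> ?R" for i
  proof (cases "i \<in> ?R")
    case True
    show ?thesis by (rule Suc.IH) (use True agree in auto)
  next
    case False
    then show ?thesis using agree[OF that] by (simp only: haar_outside[OF False])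
  qed
  note this[of i] this[of a] this[of "a + 2 ^ J"]
  moreover have "i \<in> ?L \<union> ?R" using Suc.prems(2) by auto
  ultimately show ?case by (simp add: rot_def)
qed simp

text \<open>After the transform a block from \<open>a\<close> on keeps its normalised sum at
  \<open>a\<close> and the normalised difference of its halves at the midpoint, exactly where
  \<open>gtree\<close> reads them. So \<open>gtree\<close> inverts \<open>haar\<close>, and the
  Gaussian leaves of the coupling are the given variables.\<close>

lemma gtree_haar:
  "i \<in> {a..<a + 2 ^ J} \<Longrightarrow> gtree J a (sqrt (2 ^ J) * haar J a w a) (haar J a w) i = w i"
proof (induction J arbitrary: a w i)
  case (Suc J)
  define m where "m = (2::nat) ^ J"
  have m: "1 \<le> m" "(2::real) ^ J = real m" "(2::nat) ^ J = m" by (auto simp: m_def)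
  define u where "u = haar J (a + m) (haar J a w)"
  define z where "z = haar (Suc J) a w"
  have z: "z = rot a (a + m) u" by (simp add: z_def u_def m_def)
  have uL: "u i = haar J a w i" if "i \<in> {a..<a + m}" for i
    unfolding u_def by (rule haar_outside) (use that in \<open>auto simp: m\<close>)
  have uR: "u i = haar J (a + m) w i" if "i \<in> {a + m..<(a + m) + m}" for i
    unfolding u_def
  proof (rule haar_local)
    show "haar J a w j = w j" if "j \<in> {a + m..<a + m + 2 ^ J}" for j
      by (rule haar_outside) (use that in \<open>auto simp: m\<close>)
  qed (use that in \<open>auto simp: m\<close>)
  have za: "z a = (u a + u (a + m)) / sqrt 2" "z (a + m) = (u a - u (a + m)) / sqrt 2"
    using m(1) by (auto simp: z rot_def)
  have zo: "z i = u i" if "i \<noteq> a" "i \<noteq> a + m" for i using that by (simp add: z rot_def)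
  define s where "s = sqrt (real m)"
  have s: "sqrt (2 ^ Suc J) = sqrt 2 * s" "sqrt (2 ^ J / 2) = s / sqrt 2" "sqrt (2 ^ J) = s"
    by (simp_all add: s_def m real_sqrt_mult real_sqrt_divide)
  have t: "sqrt (2 ^ Suc J) * z a = s * (u a + u (a + m))" "sqrt (2 ^ J / 2) * z (a + m) = s * (u a - u (a + m)) / 2"
    unfolding s za by simp_all
  have tL: "sqrt (2 ^ Suc J) * z a / 2 + sqrt (2 ^ J / 2) * z (a + m) = s * u a"
    and tR: "sqrt (2 ^ Suc J) * z a / 2 - sqrt (2 ^ J / 2) * z (a + m) = s * u (a + m)"
    unfolding t by (simp_all add: field_simps)
  show ?case
  proof (cases "i < a + m")
    case True
    have "gtree (Suc J) a (sqrt (2 ^ Suc J) * z a) z i = gtree J a (s * u a) z i"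
      using True tL by (simp add: m)
    also have "u a = haar J a w a" using m(1) by (intro uL) auto
    also have "gtree J a (s * haar J a w a) z i = gtree J a (s * haar J a w a) (haar J a w) i"
      by (rule gtree_cong) (use zo uL in \<open>auto simp: m\<close>)
    also have "\<dots> = w i"
      using Suc.IH[of i a w] True Suc.prems by (simp add: s_def m)
    finally show ?thesis by (simp add: z_def)
  next
    case False
    have "gtree (Suc J) a (sqrt (2 ^ Suc J) * z a) z i = gtree J (a + m) (s * u (a + m)) z i"
      using False tR by (simp add: m)
    also have "u (a + m) = haar J (a + m) w (a + m)" using m(1) by (intro uR) auto
    also have "gtree J (a + m) (s * haar J (a + m) w (a + m)) z i = gtree J (a + m) (s * haar J (a + m) w (a + m)) (haar J (a + m) w) i"
      by (rule gtree_cong) (use zo uR in \<open>auto simp: m\<close>)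
    also have "\<dots> = w i"
      using Suc.IH[of i "a + m" w] False Suc.prems by (simp add: s_def m)
    finally show ?thesis by (simp add: z_def)
  qed
qed simp

lemma walk_le_1: "K \<le> 2 ^ J \<Longrightarrow> walk J a K \<zeta> i \<le> 1"
proof (induction J arbitrary: a K)
  case (Suc J)
  then show ?case
    using split_up_le[of "2 ^ J" K "\<zeta> (a + 2 ^ J)"] by simp
qed simp

definition total_err :: "nat \<Rightarrow> (nat \<Rightarrow> real) \<Rightarrow> real" where
  "total_err J \<zeta> = \<bar>2 * real (top_up J (\<zeta> 0)) - 2 ^ J - sqrt (2 ^ J) * \<zeta> 0\<bar> + err J 0 (top_up J (\<zeta> 0)) \<zeta>"

definition coupled :: "nat \<Rightarrow> (nat \<Rightarrow> real) \<Rightarrow> nat \<Rightarrow> nat" where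
  "coupled J w i = walk J 0 (top_up J (haar J 0 w 0)) (haar J 0 w) i"

lemma coupled_le_1: "coupled J w i \<le> 1"
  unfolding coupled_def by (rule walk_le_1[OF top_up_le])

text \<open>The discrepancy \<open>d\<close> of the totals spreads evenly over all leaves and
  contributes at most \<open>\<bar>d\<bar>\<close> to a partial sum; the rest is
  \<open>walk_gtree_err\<close> for the tree started from the total of the walk.\<close>

lemma coupled_close:
  assumes k: "k \<le> 2 ^ J"
  shows "\<bar>\<Sum>i<k. 2 * real (coupled J w i) - 1 - w i\<bar> \<le> total_err J (haar J 0 w)"
proof -
  define \<zeta> where "\<zeta> = haar J 0 w"
  define K where "K = top_up J (\<zeta> 0)"
  define N where "N = (2::real) ^ J"
  define d where "d = 2 * real K - N - sqrt N * \<zeta> 0"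
  have N: "1 \<le> N" "real k \<le> N" using k by (auto simp: N_def numeral_power_le_of_nat_cancel_iff of_nat_le_numeral_power_cancel_iff)
  let ?g = "\<lambda>i. 2 * real (walk J 0 K \<zeta> i) - 1 - gtree J 0 (2 * real K - 2 ^ J) \<zeta> i"
  have "(\<Sum>i<k. 2 * real (coupled J w i) - 1 - w i) = (\<Sum>i<k. ?g i + d / N)"
  proof (rule sum.cong[OF refl])
    fix i assume "i \<in> {..<k}"
    then have "w i = gtree J 0 (sqrt N * \<zeta> 0) \<zeta> i"
      using gtree_haar[of i 0 J w] k by (simp add: \<zeta>_def N_def)
    also have "\<dots> = (sqrt N * \<zeta> 0 - (2 * real K - N)) / N + gtree J 0 (2 * real K - N) \<zeta> i"
      unfolding N_def by (rule gtree_shift)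
    also have "sqrt N * \<zeta> 0 - (2 * real K - N) = - d" by (simp add: d_def)
    finally show "2 * real (coupled J w i) - 1 - w i = ?g i + d / N"
      by (simp add: coupled_def \<zeta>_def K_def N_def)
  qed
  also have "\<dots> = (\<Sum>i=0..<0 + k. ?g i) + real k / N * d"
    by (simp add: sum.distrib atLeast0LessThan)
  finally have e: "(\<Sum>i<k. 2 * real (coupled J w i) - 1 - w i) = (\<Sum>i=0..<0 + k. ?g i) + real k / N * d" .
  have "real k / N * \<bar>d\<bar> \<le> 1 * \<bar>d\<bar>" using N by (intro mult_right_mono) auto
  then have "\<bar>real k / N * d\<bar> \<le> \<bar>d\<bar>" using N by (simp add: abs_mult)
  moreover have "\<bar>\<Sum>i=0..<0 + k. ?g i\<bar> \<le> err J 0 K \<zeta>"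
    by (rule walk_gtree_err) (use k top_up_le in \<open>auto simp: K_def\<close>)
  ultimately have "\<bar>(\<Sum>i=0..<0 + k. ?g i) + real k / N * d\<bar> \<le> \<bar>d\<bar> + err J 0 K \<zeta>" by linarith
  then show ?thesis unfolding e by (simp add: total_err_def \<zeta>_def[symmetric] K_def N_def d_def)
qed

lemma measurable_total_err [measurable]: "total_err J \<in> borel_measurable gseq"
proof -
  have [measurable]: "(\<lambda>\<zeta>. err J 0 (top_up J (\<zeta> 0)) \<zeta>) \<in> borel_measurable gseq"
    by (rule measurable_compose_countable[OF measurable_err]) measurable
  show ?thesis unfolding total_err_def[abs_def] by measurable
qed

text \<open>One more conditioning, on the variable that determines the total: the constants are
  \<open>1414 + 16 * 8 = 1542\<close>, and the coefficient \<open>1414 + 16 * 4\<close> of the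
  square stays below 1510.\<close>

lemma total_err_moment:
  "(\<integral>\<^sup>+\<zeta>. ennreal (exp (rate * total_err J \<zeta>)) \<partial>gseq) \<le> ennreal (8 ^ Suc J)"
proof -
  define n where "n = (2::nat) ^ J"
  have n: "1 \<le> n" "(2::real) ^ J = real n" by (auto simp: n_def)
  define d where "d x = 2 * real (top_up J x) - 2 ^ J - sqrt (2 ^ J) * x" for x
  define F :: "real \<Rightarrow> (nat \<Rightarrow> real) \<Rightarrow> ennreal" where
    "F x \<zeta> = ennreal (exp (rate * \<bar>d x\<bar>)) * ennreal (exp (rate * err J 0 (top_up J x) \<zeta>))" for x \<zeta>
  have r: "0 \<le> rate" by (simp add: rate_def)
  have [measurable]: "d \<in> borel_measurable borel" unfolding d_def[abs_def] by measurable
  have [measurable]: "(\<lambda>z. err J 0 (top_up J (fst z)) (snd z)) \<in> borel_measurable (borel \<Otimes>\<^sub>M gseq)"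
    by (rule measurable_compose_countable[where f = "\<lambda>k z. err J 0 k (snd z)"]; measurable)
  have Fm: "case_prod F \<in> borel_measurable (borel \<Otimes>\<^sub>M gseq)"
    unfolding F_def[abs_def] case_prod_beta' by measurable
  have "(\<integral>\<^sup>+\<zeta>. ennreal (exp (rate * total_err J \<zeta>)) \<partial>gseq) = (\<integral>\<^sup>+\<zeta>. F (\<zeta> 0) \<zeta> \<partial>gseq)"
    by (simp add: F_def total_err_def d_def distrib_left exp_add ennreal_mult)
  also have "\<dots> = (\<integral>\<^sup>+x. \<integral>\<^sup>+\<zeta>. F x \<zeta> \<partial>gseq \<partial>gaussian)"
  proof (rule nn_integral_gseq_freeze[OF Fm])
    fix x y :: real and w :: "nat \<Rightarrow> real"
    have "err J 0 k (w(0 := y)) = err J 0 k w" for k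
      by (rule err_cong) simp
    then show "F x (w(0 := y)) = F x w" by (simp add: F_def)
  qed
  also have "\<dots> \<le> (\<integral>\<^sup>+x. ennreal (8 ^ J * exp (rate * 1542)) * ennreal (exp (x\<^sup>2 / 4)) \<partial>gaussian)"
  proof (rule nn_integral_mono)
    fix x :: real
    let ?u = "2 * real (top_up J x) - real n"
    have dx: "\<bar>d x\<bar> \<le> 1414 * (1 + x\<^sup>2)"
      using binom_quantile_close[of n x] by (simp add: d_def top_up_def n_def)
    have "\<bar>?u\<bar> \<le> 2 + sqrt (real n + 1) * \<bar>x\<bar>"
      using binom_quantile_bound[of n x] by (simp add: top_up_def n_def)
    then have "\<bar>?u\<bar>\<^sup>2 \<le> (2 + sqrt (real n + 1) * \<bar>x\<bar>)\<^sup>2" by (intro power_mono) auto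
    also have "\<dots> \<le> 8 + 2 * (sqrt (real n + 1) * \<bar>x\<bar>)\<^sup>2"
      using zero_le_power2[of "2 - sqrt (real n + 1) * \<bar>x\<bar>"] by (simp add: power2_eq_square algebra_simps)
    also have "(sqrt (real n + 1) * \<bar>x\<bar>)\<^sup>2 = (real n + 1) * x\<^sup>2" by (simp add: power_mult_distrib)
    also have "8 + 2 * ((real n + 1) * x\<^sup>2) \<le> real n * (8 + 4 * x\<^sup>2)"
    proof -
      have "1 * x\<^sup>2 \<le> real n * x\<^sup>2" using n by (intro mult_right_mono) auto
      moreover have "8 \<le> real n * 8" using n by simp
      ultimately show ?thesis by (simp add: algebra_simps)
    qed
    finally have sp: "spread J (top_up J x) \<le> 8 + 4 * x\<^sup>2"
      using n(1) unfolding spread_def n(2) by (simp add: pos_divide_le_eq mult.commute)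
    have "(\<integral>\<^sup>+\<zeta>. F x \<zeta> \<partial>gseq) = ennreal (exp (rate * \<bar>d x\<bar>)) * (\<integral>\<^sup>+\<zeta>. ennreal (exp (rate * err J 0 (top_up J x) \<zeta>)) \<partial>gseq)"
      unfolding F_def by (simp add: nn_integral_cmult)
    also have "\<dots> \<le> ennreal (exp (rate * (1414 * (1 + x\<^sup>2)))) * ennreal (8 ^ J * exp (16 * rate * (8 + 4 * x\<^sup>2)))"
    proof (intro mult_mono)
      show "ennreal (exp (rate * \<bar>d x\<bar>)) \<le> ennreal (exp (rate * (1414 * (1 + x\<^sup>2))))"
        using dx r by (auto intro!: ennreal_leI mult_left_mono)
      have "16 * rate * spread J (top_up J x) \<le> 16 * rate * (8 + 4 * x\<^sup>2)"
        using sp r by (intro mult_left_mono) auto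
      then have "ennreal (8 ^ J * exp (16 * rate * spread J (top_up J x))) \<le> ennreal (8 ^ J * exp (16 * rate * (8 + 4 * x\<^sup>2)))"
        by (intro ennreal_leI mult_left_mono) auto
      with err_moment[OF top_up_le]
      show "(\<integral>\<^sup>+\<zeta>. ennreal (exp (rate * err J 0 (top_up J x) \<zeta>)) \<partial>gseq) \<le> ennreal (8 ^ J * exp (16 * rate * (8 + 4 * x\<^sup>2)))"
        by (rule order_trans)
    qed auto
    also have "\<dots> = ennreal (8 ^ J * (exp (rate * (1414 * (1 + x\<^sup>2))) * exp (16 * rate * (8 + 4 * x\<^sup>2))))"
      by (simp flip: ennreal_mult add: mult_ac)
    also have "\<dots> \<le> ennreal (8 ^ J * (exp (rate * 1542) * exp (x\<^sup>2 / 4)))"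
      unfolding exp_add[symmetric] by (intro ennreal_leI mult_left_mono) (auto simp: rate_def algebra_simps)
    also have "\<dots> = ennreal (8 ^ J * exp (rate * 1542)) * ennreal (exp (x\<^sup>2 / 4))"
      by (simp flip: ennreal_mult add: mult.assoc)
    finally show "(\<integral>\<^sup>+\<zeta>. F x \<zeta> \<partial>gseq) \<le> ennreal (8 ^ J * exp (rate * 1542)) * ennreal (exp (x\<^sup>2 / 4))" .
  qed
  also have "\<dots> = ennreal (8 ^ J * exp (rate * 1542) * sqrt 2)"
  proof -
    have "(\<lambda>x::real. exp (x\<^sup>2 / 4)) \<in> borel_measurable borel"
      by (intro borel_measurable_continuous_onI continuous_intros) auto
    then have "(\<lambda>x. ennreal (exp (x\<^sup>2 / 4))) \<in> borel_measurable gaussian"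
      unfolding measurable_cong_sets[OF sets_gaussian refl] by (rule measurable_compose) simp
    then show ?thesis
      by (subst nn_integral_cmult) (simp_all only: gaussian_exp_square, simp flip: ennreal_mult)
  qed
  also have "\<dots> \<le> ennreal (8 ^ Suc J)"
  proof (rule ennreal_leI)
    have "2 * exp (rate * 1542) * sqrt 2 \<le> 8" by (rule exp_const_le) auto
    moreover have "exp (rate * 1542) * sqrt 2 \<le> 2 * exp (rate * 1542) * sqrt 2" by simp
    ultimately have "exp (rate * 1542) * sqrt 2 \<le> 8" by linarith
    then have "8 ^ J * (exp (rate * 1542) * sqrt 2) \<le> 8 ^ J * 8" by (intro mult_left_mono) auto
    then show "8 ^ J * exp (rate * 1542) * sqrt 2 \<le> 8 ^ Suc J" by (simp only: mult.assoc power_Suc2)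
  qed
  finally show ?thesis .
qed

text \<open>Exponential Markov inequality. Since \<open>42280 = 7 * 6040\<close>, the threshold has
  exponent \<open>7 * (J + 1)\<close>; \<open>exp 7 \<ge> 128 = 8 * 16\<close> beats the growth 8
  per level and leaves a factor 1/16 for each.\<close>

lemma total_err_tail:
  "measure gseq {\<zeta>. 42280 * (real J + 1) \<le> total_err J \<zeta>} \<le> (1 / 16) ^ Suc J"
proof -
  let ?y = "42280 * (real J + 1)"
  have m: "{\<zeta>. ?y \<le> total_err J \<zeta>} \<in> sets gseq"
  proof -
    have "{\<zeta> \<in> space gseq. ?y \<le> total_err J \<zeta>} \<in> sets gseq" by measurable
    then show ?thesis by simp
  qed
  have "emeasure gseq {\<zeta>. ?y \<le> total_err J \<zeta>} = (\<integral>\<^sup>+\<zeta>. indicator {\<zeta>. ?y \<le> total_err J \<zeta>} \<zeta> \<partial>gseq)"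
    using m by simp
  also have "\<dots> \<le> (\<integral>\<^sup>+\<zeta>. ennreal (exp (- (rate * ?y))) * ennreal (exp (rate * total_err J \<zeta>)) \<partial>gseq)"
  proof (rule nn_integral_mono)
    fix \<zeta>
    have "1 \<le> exp (- (rate * ?y) + rate * total_err J \<zeta>)" if "?y \<le> total_err J \<zeta>"
      using mult_left_mono[OF that, of rate] by (simp add: rate_def)
    then show "indicator {\<zeta>. ?y \<le> total_err J \<zeta>} \<zeta> \<le> ennreal (exp (- (rate * ?y))) * ennreal (exp (rate * total_err J \<zeta>))"
      by (auto simp: indicator_def simp flip: ennreal_mult exp_add)
  qed
  also have "\<dots> = ennreal (exp (- (rate * ?y))) * (\<integral>\<^sup>+\<zeta>. ennreal (exp (rate * total_err J \<zeta>)) \<partial>gseq)"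
    by (rule nn_integral_cmult) measurable
  also have "\<dots> \<le> ennreal (exp (- (rate * ?y))) * ennreal (8 ^ Suc J)"
    by (intro mult_left_mono total_err_moment) auto
  also have "\<dots> = ennreal (exp (- (rate * ?y)) * 8 ^ Suc J)"
    by (simp flip: ennreal_mult)
  also have "\<dots> \<le> ennreal ((1 / 16) ^ Suc J)"
  proof (rule ennreal_leI)
    have "(2::real) ^ 7 \<le> exp 1 ^ 7" using exp_ge_add_one_self[of 1] by (intro power_mono) auto
    then have "128 \<le> exp (7::real)" by (simp flip: exp_of_nat_mult)
    then have e: "exp (- 7 :: real) * 8 \<le> 1 / 16" by (simp add: exp_minus field_simps)
    have "- (rate * ?y) = real (Suc J) * (- 7)" by (simp add: rate_def add_divide_distrib)
    then have "exp (- (rate * ?y)) * 8 ^ Suc J = (exp (- 7) * 8) ^ Suc J"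
      by (simp only: exp_of_nat_mult power_mult_distrib)
    also have "\<dots> \<le> (1 / 16) ^ Suc J" using e by (intro power_mono) auto
    finally show "exp (- (rate * ?y)) * 8 ^ Suc J \<le> (1 / 16) ^ Suc J" .
  qed
  finally show ?thesis unfolding gseq.emeasure_eq_measure by (simp add: ennreal_le_iff)
qed

section \<open>Independence and fairness of the signs\<close>

lemma measurable_coupled [measurable]:
  assumes "preserving H"
  shows "(\<lambda>w. coupled J (H w) i) \<in> measurable gseq (count_space UNIV)"
proof -
  have "(\<lambda>w. haar J 0 (H w)) \<in> measurable gseq gseq"
    by (rule preserving_measurable[OF preserving_comp[OF preserving_haar assms]])
  then show ?thesis unfolding coupled_def by (rule measurable_compose[OF _ measurable_top_walk])
qed

lemma coupled_law:
  assumes H: "preserving H" and b: "\<And>i. b i \<le> 1"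
  shows "measure gseq {w. \<forall>i\<in>{..<2 ^ J}. coupled J (H w) i = b i} = 1 / 2 ^ (2 ^ J)"
proof -
  let ?h = "\<lambda>w. haar J 0 (H w)"
  let ?E = "{\<zeta>. \<forall>i\<in>{..<2 ^ J}. walk J 0 (top_up J (\<zeta> 0)) \<zeta> i = b i}"
  have h: "preserving ?h" by (rule preserving_comp[OF preserving_haar H])
  have E: "?E \<in> sets gseq"
  proof -
    have "{\<zeta> \<in> space gseq. \<forall>i\<in>{..<2 ^ J}. walk J 0 (top_up J (\<zeta> 0)) \<zeta> i = b i} \<in> sets gseq" by measurable
    then show ?thesis by simp
  qed
  have "emeasure gseq {w. \<forall>i\<in>{..<2 ^ J}. coupled J (H w) i = b i} = emeasure gseq (?h -` ?E \<inter> space gseq)"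
    by (simp add: coupled_def vimage_def)
  also have "\<dots> = emeasure (distr gseq gseq ?h) ?E"
    using h E by (intro emeasure_distr[symmetric]) (auto simp: preserving_def)
  also have "\<dots> = ennreal (1 / 2 ^ (2 ^ J))"
    using h top_walk_law[OF b] by (simp add: preserving_def)
  finally show ?thesis unfolding gseq.emeasure_eq_measure by simp
qed

text \<open>The event splits into equally likely configurations, and
  \<open>card (B i \<inter> {0, 1}) / 2\<close> is the probability of \<open>B i\<close> under a
  fair coin with values 0 and 1.\<close>

lemma coupled_box_all:
  assumes H: "preserving H"
  shows "measure gseq {w. \<forall>i\<in>{..<2 ^ J}. coupled J (H w) i \<in> B i} = (\<Prod>i<2 ^ J. real (card (B i \<inter> {0, 1})) / 2)"
proof -
  let ?P = "PiE {..<2 ^ J} (\<lambda>i. B i \<inter> {0, 1})"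
  let ?S = "\<lambda>b. {w. \<forall>i\<in>{..<2 ^ J}. coupled J (H w) i = b i}"
  have fin: "finite ?P" by (intro finite_PiE) auto
  have SM: "?S b \<in> sets gseq" for b
  proof -
    note measurable_coupled[OF H, measurable]
    have "{w \<in> space gseq. \<forall>i\<in>{..<2 ^ J}. coupled J (H w) i = b i} \<in> sets gseq" by measurable
    then show ?thesis by simp
  qed
  have "{w. \<forall>i\<in>{..<2 ^ J}. coupled J (H w) i \<in> B i} = (\<Union>b\<in>?P. ?S b)"
  proof (intro set_eqI iffI)
    fix w assume w: "w \<in> {w. \<forall>i\<in>{..<2 ^ J}. coupled J (H w) i \<in> B i}"
    have "coupled J (H w) i \<in> {0, 1}" for i using coupled_le_1[of J "H w" i] by auto
    then have "restrict (coupled J (H w)) {..<2 ^ J} \<in> ?P" using w by auto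
    moreover have "w \<in> ?S (restrict (coupled J (H w)) {..<2 ^ J})" by simp
    ultimately show "w \<in> (\<Union>b\<in>?P. ?S b)" by blast
  qed (auto simp: PiE_iff)
  then have "measure gseq {w. \<forall>i\<in>{..<2 ^ J}. coupled J (H w) i \<in> B i} = measure gseq (\<Union>b\<in>?P. ?S b)" by simp
  also have "\<dots> = (\<Sum>b\<in>?P. measure gseq (?S b))"
  proof (rule gseq.finite_measure_finite_Union[OF fin])
    show "disjoint_family_on ?S ?P"
      unfolding disjoint_family_on_def
    proof (intro ballI impI)
      fix b b' assume b: "b \<in> ?P" "b' \<in> ?P" "b \<noteq> b'"
      then obtain i where "i \<in> {..<2 ^ J}" "b i \<noteq> b' i" using PiE_ext[of b _ _ b'] by blast
      then show "?S b \<inter> ?S b' = {}" by auto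
    qed
    show "?S ` ?P \<subseteq> sets gseq" using SM by blast
  qed
  also have "\<dots> = (\<Sum>b\<in>?P. 1 / 2 ^ (2 ^ J))"
  proof (rule sum.cong[OF refl])
    fix b assume b: "b \<in> ?P"
    \<comment> \<open>\<open>b\<close> is \<open>undefined\<close> outside the index range, whereas
      \<open>coupled_law\<close> asks for values at most 1 everywhere.\<close>
    define b' where "b' i = (if i < 2 ^ J then b i else 0)" for i
    have "b' i \<le> 1" for i using PiE_mem[OF b, of i] by (auto simp: b'_def)
    moreover have "?S b = ?S b'" by (auto simp: b'_def)
    ultimately show "measure gseq (?S b) = 1 / 2 ^ (2 ^ J)" using coupled_law[OF H, of b' J] by simp
  qed
  also have "\<dots> = real (card ?P) / 2 ^ (2 ^ J)" by simp
  also have "\<dots> = (\<Prod>i<2 ^ J. real (card (B i \<inter> {0, 1})) / 2)"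
    by (subst card_PiE) (simp_all add: prod_dividef)
  finally show ?thesis .
qed

lemma coupled_box:
  assumes H: "preserving H" and I: "I \<subseteq> {..<2 ^ J}"
  shows "measure gseq {w. \<forall>i\<in>I. coupled J (H w) i \<in> B i} = (\<Prod>i\<in>I. real (card (B i \<inter> {0, 1})) / 2)"
proof -
  define B' where "B' i = (if i \<in> I then B i else UNIV)" for i
  have "{w. \<forall>i\<in>I. coupled J (H w) i \<in> B i} = {w. \<forall>i\<in>{..<2 ^ J}. coupled J (H w) i \<in> B' i}"
    using I by (auto simp: B'_def)
  then have "measure gseq {w. \<forall>i\<in>I. coupled J (H w) i \<in> B i} = (\<Prod>i<2 ^ J. real (card (B' i \<inter> {0, 1})) / 2)"
    using coupled_box_all[OF H, of J B'] by simp
  also have "\<dots> = (\<Prod>i\<in>I. real (card (B' i \<inter> {0, 1})) / 2)"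
    using I by (intro prod.mono_neutral_right) (auto simp: B'_def)
  finally show ?thesis by (simp add: B'_def)
qed

text \<open>Steps are numbered from 1 as in \<open>ell\<close>, leaves of the tree from 0.\<close>

definition sign_step :: "nat \<Rightarrow> (nat \<Rightarrow> real) \<Rightarrow> nat \<Rightarrow> real" where
  "sign_step J w k = 2 * real (coupled J w (k - 1)) - 1"

lemma sign_step_in: "sign_step J w k \<in> {- 1, 1}"
  using coupled_le_1[of J w "k - 1"] by (auto simp: sign_step_def le_Suc_eq)

lemma measurable_sign_step [measurable]:
  "preserving H \<Longrightarrow> (\<lambda>w. sign_step J (H w) k) \<in> borel_measurable gseq"
  unfolding sign_step_def by (drule measurable_coupled) (erule measurable_compose, simp)

lemma sign_step_box:
  assumes H: "preserving H" and I: "I \<subseteq> {1..2 ^ J}"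
  shows "measure gseq {w. \<forall>k\<in>I. sign_step J (H w) k \<in> A k}
    = (\<Prod>k\<in>I. real (card ({c. 2 * real c - 1 \<in> A k} \<inter> {0, 1})) / 2)"
proof -
  let ?I = "(\<lambda>k. k - 1) ` I"
  have S: "Suc (k - 1) = k" "k - 1 < 2 ^ J" if "k \<in> I" for k
    using subsetD[OF I that] by auto
  have inj: "inj_on (\<lambda>k. k - 1) I" by (rule inj_onI) (metis S(1))
  have sub: "?I \<subseteq> {..<2 ^ J}" using S(2) by auto
  have "{w. \<forall>k\<in>I. sign_step J (H w) k \<in> A k} = {w. \<forall>i\<in>?I. coupled J (H w) i \<in> {c. 2 * real c - 1 \<in> A (Suc i)}}"
    using S by (auto simp: sign_step_def)
  then have "measure gseq {w. \<forall>k\<in>I. sign_step J (H w) k \<in> A k}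
     = (\<Prod>i\<in>?I. real (card ({c. 2 * real c - 1 \<in> A (Suc i)} \<inter> {0, 1})) / 2)"
    using coupled_box[OF H sub, of "\<lambda>i. {c. 2 * real c - 1 \<in> A (Suc i)}"] by simp
  also have "\<dots> = (\<Prod>k\<in>I. real (card ({c. 2 * real c - 1 \<in> A k} \<inter> {0, 1})) / 2)"
    using S by (subst prod.reindex[OF inj]) (auto intro!: prod.cong)
  finally show ?thesis .
qed

lemma sign_step_single:
  assumes H: "preserving H" and k: "k \<in> {1..2 ^ J}"
  shows "measure gseq {w. sign_step J (H w) k \<in> A} = real (card ({c. 2 * real c - 1 \<in> A} \<inter> {0, 1})) / 2"
  using sign_step_box[OF H, of "{k}" J "\<lambda>_. A"] k by simp

lemma sign_step_half:
  assumes H: "preserving H" and k: "k \<in> {1..2 ^ J}"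
  shows "measure gseq {w. sign_step J (H w) k = 1} = 1 / 2" "measure gseq {w. sign_step J (H w) k = - 1} = 1 / 2"
proof -
  have "{c. 2 * real c - 1 \<in> {1}} \<inter> {0, 1} = {1}" "{c. 2 * real c - 1 \<in> {- 1}} \<inter> {0, 1} = {0}" by auto
  with sign_step_single[OF H k, of "{1}"] sign_step_single[OF H k, of "{- 1}"]
  show "measure gseq {w. sign_step J (H w) k = 1} = 1 / 2" "measure gseq {w. sign_step J (H w) k = - 1} = 1 / 2"
    by simp_all
qed

lemma sign_step_indep:
  assumes H: "preserving H" and n: "1 \<le> n" "n \<le> 2 ^ J"
  shows "gseq.indep_vars (\<lambda>_. borel) (\<lambda>k w. sign_step J (H w) k) {1..n}"
proof (subst gseq.indep_vars_finite[where E = "\<lambda>_. sets borel"])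
  show "\<forall>A\<in>Pi {1..n} (\<lambda>_. sets borel). measure gseq (\<Inter>j\<in>{1..n}. (\<lambda>w. sign_step J (H w) j) -` A j \<inter> space gseq)
     = (\<Prod>j\<in>{1..n}. measure gseq ((\<lambda>w. sign_step J (H w) j) -` A j \<inter> space gseq))"
  proof
    fix A :: "nat \<Rightarrow> real set"
    have "(\<Inter>j\<in>{1..n}. (\<lambda>w. sign_step J (H w) j) -` A j \<inter> space gseq) = {w. \<forall>k\<in>{1..n}. sign_step J (H w) k \<in> A k}"
      using n by auto
    then have "measure gseq (\<Inter>j\<in>{1..n}. (\<lambda>w. sign_step J (H w) j) -` A j \<inter> space gseq)
       = (\<Prod>k\<in>{1..n}. real (card ({c. 2 * real c - 1 \<in> A k} \<inter> {0, 1})) / 2)"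
      using sign_step_box[OF H, of "{1..n}" J A] n by simp
    also have "\<dots> = (\<Prod>j\<in>{1..n}. measure gseq ((\<lambda>w. sign_step J (H w) j) -` A j \<inter> space gseq))"
    proof (rule prod.cong[OF refl])
      fix k assume "k \<in> {1..n}"
      then show "real (card ({c. 2 * real c - 1 \<in> A k} \<inter> {0, 1})) / 2 = measure gseq ((\<lambda>w. sign_step J (H w) k) -` A k \<inter> space gseq)"
        using sign_step_single[OF H, of k J "A k"] n by (simp add: vimage_def)
    qed
    finally show "measure gseq (\<Inter>j\<in>{1..n}. (\<lambda>w. sign_step J (H w) j) -` A j \<inter> space gseq)
     = (\<Prod>j\<in>{1..n}. measure gseq ((\<lambda>w. sign_step J (H w) j) -` A j \<inter> space gseq))" .
  qed
qed (use n H in \<open>auto simp: Int_stable_def sets.sigma_sets_eq[of borel, simplified]\<close>)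

section \<open>Brownian motion by midpoint refinement\<close>

text \<open>\<open>\<bar>x\<bar> \<le> 1 + x\<^sup>2 / 4\<close> reduces the claim to the moment of
  \<open>exp (x\<^sup>2 / 4)\<close>, and \<open>exp 1 * sqrt 2 \<le> 5\<close>. An exponential tail
  suffices for chaining, because the thresholds grow linearly in the level.\<close>

lemma measure_abs_gaussian_gt: "measure gaussian {x. y < \<bar>x\<bar>} \<le> 5 * exp (- y)"
proof -
  have [measurable]: "(\<lambda>x::real. exp (x\<^sup>2 / 4)) \<in> borel_measurable borel"
    by (intro borel_measurable_continuous_onI continuous_intros) auto
  have "emeasure gaussian {x. y < \<bar>x\<bar>} = (\<integral>\<^sup>+x. indicator {x. y < \<bar>x\<bar>} x \<partial>gaussian)"
    by (rule nn_integral_indicator[symmetric]) simp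
  also have "\<dots> \<le> (\<integral>\<^sup>+x. ennreal (exp (1 - y)) * ennreal (exp (x\<^sup>2 / 4)) \<partial>gaussian)"
  proof (rule nn_integral_mono)
    fix x :: real
    have "\<bar>x\<bar> \<le> 1 + x\<^sup>2 / 4"
      using zero_le_power2[of "\<bar>x\<bar> / 2 - 1"] by (simp add: power2_eq_square algebra_simps)
    then have "1 \<le> exp ((1 - y) + x\<^sup>2 / 4)" if "y < \<bar>x\<bar>" using that by simp
    then show "indicator {x. y < \<bar>x\<bar>} x \<le> ennreal (exp (1 - y)) * ennreal (exp (x\<^sup>2 / 4))"
      by (auto simp: indicator_def simp flip: ennreal_mult exp_add)
  qed
  also have "\<dots> = ennreal (exp (1 - y) * sqrt 2)"
  proof -
    have "(\<lambda>x. ennreal (exp (x\<^sup>2 / 4))) \<in> borel_measurable gaussian"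
      unfolding measurable_cong_sets[OF sets_gaussian refl] by measurable
    then show ?thesis
      by (subst nn_integral_cmult) (simp_all only: gaussian_exp_square, simp flip: ennreal_mult)
  qed
  also have "\<dots> \<le> ennreal (5 * exp (- y))"
  proof (rule ennreal_leI)
    have "sqrt 2 \<le> 3 / 2" by (rule real_le_lsqrt) (auto simp: power2_eq_square)
    then have "exp 1 * sqrt 2 \<le> 3 * (3 / 2)" using exp_le by (intro mult_mono) auto
    then have "exp (- y) * (exp 1 * sqrt 2) \<le> exp (- y) * 5" by (intro mult_left_mono) auto
    moreover have "exp (1 - y) = exp (- y) * exp 1" by (simp flip: exp_add)
    ultimately show "exp (1 - y) * sqrt 2 \<le> 5 * exp (- y)" by (simp add: mult.assoc mult.commute[of 5])
  qed
  finally show ?thesis unfolding gaussian.emeasure_eq_measure by simp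
qed

definition std_gaussian_rv :: "((nat \<Rightarrow> real) \<Rightarrow> real) \<Rightarrow> bool" where
  "std_gaussian_rv X \<longleftrightarrow> X \<in> borel_measurable gseq \<and> distr gseq borel X = gaussian"

lemma std_gaussian_rv_preserving: "preserving H \<Longrightarrow> std_gaussian_rv (\<lambda>w. H w i)"
proof -
  assume H: "preserving H"
  then have m: "H \<in> measurable gseq gseq" by (rule preserving_measurable)
  have "distr gseq borel ((\<lambda>w. w i) \<circ> H) = distr (distr gseq gseq H) borel (\<lambda>w. w i)"
    by (rule distr_distr[symmetric]) (use m in auto)
  also have "\<dots> = gaussian" using H by (simp add: preserving_def distr_gseq_coord)
  finally show ?thesis
    using measurable_compose[OF m measurable_gseq_coord, of i] by (simp add: std_gaussian_rv_def comp_def)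
qed

lemma std_gaussian_rv_tail:
  assumes "std_gaussian_rv X"
  shows "measure gseq {w. y < \<bar>X w\<bar>} \<le> 5 * exp (- y)"
proof -
  have "measure gseq {w. y < \<bar>X w\<bar>} = measure (distr gseq borel X) {x. y < \<bar>x\<bar>}"
    using assms by (subst measure_distr) (auto simp: std_gaussian_rv_def vimage_def)
  then show ?thesis using assms measure_abs_gaussian_gt[of y] by (simp add: std_gaussian_rv_def)
qed

text \<open>Union bound over the dyadic grid points of all levels; the linear growth of the threshold in
  the level beats the number of grid points.\<close>

lemma grid_tail:
  fixes K :: nat
  assumes X: "\<And>j i. std_gaussian_rv (X j i)" and y: "2 \<le> y"
  defines "E \<equiv> {w. \<exists>j. \<exists>i<K * 2 ^ j. y * (real j + 1) < \<bar>X j i w\<bar>}"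
  shows "E \<in> sets gseq" "measure gseq E \<le> 10 * real K * exp (- y)"
proof -
  define A where "A j i = {w. y * (real j + 1) < \<bar>X j i w\<bar>}" for j i
  have A: "A j i \<in> sets gseq" for j i
  proof -
    have [measurable]: "X j i \<in> borel_measurable gseq" using X by (simp add: std_gaussian_rv_def)
    have "{w \<in> space gseq. y * (real j + 1) < \<bar>X j i w\<bar>} \<in> sets gseq" by measurable
    then show ?thesis by (simp add: A_def)
  qed
  define B where "B j = (\<Union>i<K * 2 ^ j. A j i)" for j
  have B: "B j \<in> sets gseq" for j unfolding B_def using A by auto
  have E: "E = (\<Union>j. B j)" unfolding E_def B_def A_def by auto
  show "E \<in> sets gseq" unfolding E using B by auto
  have B_le: "measure gseq (B j) \<le> 5 * real K * exp (- y) * (1 / 2) ^ j" for j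
  proof -
    have "measure gseq (B j) \<le> (\<Sum>i<K * 2 ^ j. measure gseq (A j i))"
      unfolding B_def by (rule gseq.finite_measure_subadditive_finite) (use A in auto)
    also have "\<dots> \<le> (\<Sum>i<K * 2 ^ j. 5 * exp (- (y * (real j + 1))))"
      unfolding A_def by (intro sum_mono std_gaussian_rv_tail X)
    also have "\<dots> = 5 * real K * (2 ^ j * exp (- (y * (real j + 1))))" by simp
    also have "2 ^ j * exp (- (y * (real j + 1))) = exp (- y) * (2 * exp (- y)) ^ j"
      by (simp add: power_mult_distrib exp_of_nat_mult[symmetric] algebra_simps flip: exp_add)
    also have "5 * real K * (exp (- y) * (2 * exp (- y)) ^ j) \<le> 5 * real K * (exp (- y) * (1 / 2) ^ j)"
    proof -
      have "(2::real) ^ 2 \<le> exp 1 ^ 2" using exp_ge_add_one_self[of 1] by (intro power_mono) auto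
      also have "exp 1 ^ 2 = exp (2::real)" by (simp flip: exp_of_nat_mult)
      also have "exp (2::real) \<le> exp y" using y by simp
      finally have "2 * exp (- y) \<le> 1 / 2" by (simp add: exp_minus field_simps)
      then show ?thesis by (intro mult_left_mono power_mono) auto
    qed
    finally show ?thesis by (simp only: mult.assoc)
  qed
  have sums: "(\<lambda>j. 5 * real K * exp (- y) * (1 / 2) ^ j) sums (10 * real K * exp (- y))"
    using sums_mult[OF geometric_sums[of "1 / 2 :: real"], of "5 * real K * exp (- y)"] by (simp add: mult_ac)
  have summ: "summable (\<lambda>j. measure gseq (B j))"
    by (rule summable_comparison_test[OF _ sums_summable[OF sums]]) (use B_le in auto)
  have "measure gseq E \<le> (\<Sum>j. measure gseq (B j))"
    unfolding E by (rule gseq.finite_measure_subadditive_countably) (use B summ in auto)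
  also have "\<dots> \<le> (\<Sum>j. 5 * real K * exp (- y) * (1 / 2) ^ j)"
    by (rule suminf_le[OF B_le summ sums_summable[OF sums]])
  also have "\<dots> = 10 * real K * exp (- y)" by (rule sums_unique[OF sums, symmetric])
  finally show "measure gseq E \<le> 10 * real K * exp (- y)" .
qed

text \<open>One step of Levy's midpoint refinement. The variables with index \<open>prod_encode (0, i)\<close> are the
  normalised increments on the current grid, those with index \<open>prod_encode (Suc j, i)\<close> are still
  unused; a step consumes level 1 and shifts the higher levels down.\<close>

definition refine :: "(nat \<Rightarrow> real) \<Rightarrow> nat \<Rightarrow> real" where
  "refine w m = (case prod_decode m of
     (0, i) \<Rightarrow> (if even i then (w (prod_encode (0, i div 2)) + w (prod_encode (1, i div 2))) / sqrt 2
       else (w (prod_encode (0, i div 2)) - w (prod_encode (1, i div 2))) / sqrt 2)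
   | (Suc j, i) \<Rightarrow> w (prod_encode (Suc (Suc j), i)))"

fun rots :: "nat \<Rightarrow> (nat \<Rightarrow> real) \<Rightarrow> nat \<Rightarrow> real" where
  "rots 0 w = w"
| "rots (Suc n) w = rot (prod_encode (0, n)) (prod_encode (1, n)) (rots n w)"

lemma preserving_rots: "preserving (rots n)"
proof (induction n)
  case 0
  have "rots 0 = (\<lambda>w. w)" by (simp add: fun_eq_iff)
  then show ?case by (simp add: preserving_id)
next
  case (Suc n)
  have "preserving (\<lambda>w. rot (prod_encode (0, n)) (prod_encode (1, n)) (rots n w))"
    by (intro preserving_comp[OF preserving_rot Suc]) simp
  moreover have "rots (Suc n) = (\<lambda>w. rot (prod_encode (0, n)) (prod_encode (1, n)) (rots n w))"
    by (simp add: fun_eq_iff)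
  ultimately show ?case by simp
qed

lemma rots_apply:
  "rots n w (prod_encode (j, k)) =
    (if k < n \<and> j = 0 then (w (prod_encode (0, k)) + w (prod_encode (1, k))) / sqrt 2
     else if k < n \<and> j = 1 then (w (prod_encode (0, k)) - w (prod_encode (1, k))) / sqrt 2
     else w (prod_encode (j, k)))"
  by (induction n arbitrary: j k) (auto simp: rot_def less_Suc_eq)

text \<open>On finitely many coordinates \<open>refine\<close> agrees with \<open>rots n\<close>
  followed by the reindexing \<open>\<beta>\<close>, which sends an even child to the sum and an odd
  child to the difference stored for its parent.\<close>

lemma preserving_refine: "preserving refine"
proof (rule preserving_local)
  fix J :: "nat set" assume J: "finite J"
  define \<beta> where "\<beta> m = (case prod_decode m of
     (0, i) \<Rightarrow> prod_encode (if even i then 0 else 1, i div 2)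
   | (Suc j, i) \<Rightarrow> prod_encode (Suc (Suc j), i))" for m
  have "inj \<beta>"
  proof (rule injI)
    fix m m' assume eq: "\<beta> m = \<beta> m'"
    obtain j i where m: "prod_decode m = (j, i)" by fastforce
    obtain j' i' where m': "prod_decode m' = (j', i')" by fastforce
    have "(j, i) = (j', i')"
    proof (cases j; cases j')
      assume "j = 0" "j' = 0"
      then have "even i = even i'" "i div 2 = i' div 2"
        using eq m m' by (auto simp: \<beta>_def split: if_splits)
      then show ?thesis using \<open>j = 0\<close> \<open>j' = 0\<close> by (metis div_mult_mod_eq even_iff_mod_2_eq_zero odd_iff_mod_2_eq_one)
    qed (use eq m m' in \<open>auto simp: \<beta>_def split: if_splits\<close>)
    then show "m = m'" using m m' prod_decode_inverse by metis
  qed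
  define n where "n = Suc (Max (insert 0 ((\<lambda>m. snd (prod_decode m) div 2) ` J)))"
  have n: "snd (prod_decode m) div 2 < n" if "m \<in> J" for m
    unfolding n_def less_Suc_eq_le using that J by (intro Max_ge) auto
  have "refine w m = rots n w (\<beta> m)" if "m \<in> J" for w m
  proof -
    obtain j i where m: "prod_decode m = (j, i)" by fastforce
    then show ?thesis using n[OF that] by (cases j) (auto simp: refine_def \<beta>_def rots_apply)
  qed
  moreover have "preserving (\<lambda>w m. rots n w (\<beta> m))"
    using preserving_comp[OF preserving_reindex[OF \<open>inj \<beta>\<close>] preserving_rots[of n]] by simp
  ultimately show "\<exists>g. preserving g \<and> (\<forall>w. \<forall>m\<in>J. refine w m = g w m)" by blast
qed

text \<open>The future path increment over the \<open>k\<close>-th dyadic interval of length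
  \<open>2 ^ - j\<close>, normalised to variance 1. Accordingly \<open>grid j w k\<close> below is
  the value of the path at \<open>k / 2 ^ j\<close>.\<close>

definition incr :: "nat \<Rightarrow> (nat \<Rightarrow> real) \<Rightarrow> nat \<Rightarrow> real" where
  "incr j w k = (refine ^^ j) w (prod_encode (0, k))"

lemma preserving_incr: "preserving (incr j)"
proof -
  have "preserving (\<lambda>w. (refine ^^ j) w)"
  proof (induction j)
    case (Suc j)
    then show ?case using preserving_comp[OF preserving_refine Suc] by simp
  qed (simp add: preserving_id)
  moreover have "inj (\<lambda>k. prod_encode (0, k))" by (auto simp: inj_def)
  ultimately have "preserving (\<lambda>w k. (refine ^^ j) w (prod_encode (0, k)))"
    using preserving_comp[OF preserving_reindex, of "\<lambda>k. prod_encode (0, k)" "refine ^^ j"] by simp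
  then show ?thesis by (simp add: incr_def[abs_def])
qed

lemma incr_Suc: "incr (Suc j) w (2 * k) + incr (Suc j) w (Suc (2 * k)) = sqrt 2 * incr j w k"
proof -
  have "(a + b) / sqrt 2 + (a - b) / sqrt 2 = sqrt 2 * a" for a b :: real
    by (simp add: field_simps)
  then show ?thesis by (simp add: incr_def refine_def)
qed

definition grid :: "nat \<Rightarrow> (nat \<Rightarrow> real) \<Rightarrow> nat \<Rightarrow> real" where
  "grid j w k = (1 / sqrt 2) ^ j * (\<Sum>i<k. incr j w i)"

lemma grid_0 [simp]: "grid j w 0 = 0"
  by (simp add: grid_def)

lemma grid_Suc_diff: "grid j w (Suc k) - grid j w k = (1 / sqrt 2) ^ j * incr j w k"
  by (simp add: grid_def algebra_simps)

lemma grid_double: "grid (Suc j) w (2 * k) = grid j w k"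
proof -
  have "(\<Sum>i<2 * k. incr (Suc j) w i) = sqrt 2 * (\<Sum>i<k. incr j w i)"
  proof (induction k)
    case (Suc k)
    have "(\<Sum>i<2 * Suc k. incr (Suc j) w i) = (\<Sum>i<2 * k. incr (Suc j) w i) + (incr (Suc j) w (2 * k) + incr (Suc j) w (Suc (2 * k)))"
      by simp
    then show ?case unfolding Suc incr_Suc by (simp add: distrib_left)
  qed simp
  then show ?thesis by (simp add: grid_def)
qed

lemma measurable_grid [measurable]: "(\<lambda>w. grid j w k) \<in> borel_measurable gseq"
proof -
  have [measurable]: "(\<lambda>w. incr j w i) \<in> borel_measurable gseq" for i
    using std_gaussian_rv_preserving[OF preserving_incr] by (simp add: std_gaussian_rv_def)
  show ?thesis unfolding grid_def by measurable
qed

text \<open>Linear growth in the level, on every bounded range of times, makes the dyadic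
  approximations converge uniformly there. Both bounds range over natural numbers, so that the event
  is a countable combination of measurable ones.\<close>

definition tame :: "(nat \<Rightarrow> real) \<Rightarrow> bool" where
  "tame w \<longleftrightarrow> (\<forall>K::nat. \<exists>C::nat. \<forall>j. \<forall>i<K * 2 ^ j. \<bar>incr j w i\<bar> \<le> real C * (real j + 1))"

lemma measurable_tame [measurable]: "Measurable.pred gseq tame"
proof -
  have [measurable]: "(\<lambda>w. incr j w i) \<in> borel_measurable gseq" for i j
    using std_gaussian_rv_preserving[OF preserving_incr] by (simp add: std_gaussian_rv_def)
  show ?thesis unfolding tame_def[abs_def] by measurable
qed

lemma AE_tame: "AE w in gseq. tame w"
  unfolding tame_def AE_all_countable
proof
  fix K :: nat
  define E where "E C = {w. \<exists>j. \<exists>i<K * 2 ^ j. real C * (real j + 1) < \<bar>incr j w i\<bar>}" for C :: nat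
  have E: "E C \<in> sets gseq" "measure gseq (E C) \<le> 10 * real K * exp (- real C)" if "2 \<le> C" for C
    using grid_tail[OF std_gaussian_rv_preserving[OF preserving_incr], of "real C" K] that by (auto simp: E_def)
  define N where "N = (\<Inter>C\<in>{2..}. E C)"
  have N: "N \<in> sets gseq" unfolding N_def using E(1) by (intro sets.countable_INT') auto
  have "measure gseq N \<le> 10 * real K * exp (- real C)" if "2 \<le> C" for C
    using gseq.finite_measure_mono[of N "E C"] E[OF that] that by (force simp: N_def)
  then have "measure gseq N \<le> 0"
  proof (intro tendsto_lowerbound[of "\<lambda>C::nat. 10 * real K * exp (- real C)" 0 sequentially])
    show "(\<lambda>C::nat. 10 * real K * exp (- real C)) \<longlonglongrightarrow> 0" by real_asymp
    show "\<forall>\<^sub>F C in sequentially. measure gseq N \<le> 10 * real K * exp (- real C)"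
      using \<open>\<And>C. 2 \<le> C \<Longrightarrow> measure gseq N \<le> 10 * real K * exp (- real C)\<close>
      by (intro eventually_sequentiallyI[of 2])
  qed simp
  then have "emeasure gseq N = 0"
    using measure_nonneg[of gseq N] by (simp add: gseq.emeasure_eq_measure)
  then show "AE w in gseq. \<exists>C::nat. \<forall>j. \<forall>i<K * 2 ^ j. \<bar>incr j w i\<bar> \<le> real C * (real j + 1)"
    using N by (intro AE_I[of _ _ N]) (auto simp: N_def E_def not_le)
qed

section \<open>Limits along dyadic points and continuity of the paths\<close>

definition dyadic_index :: "nat \<Rightarrow> real \<Rightarrow> nat" where
  "dyadic_index j t = nat \<lfloor>2 ^ j * t\<rfloor>"

lemma dyadic_index_bounds:
  assumes "0 \<le> t"
  shows "real (dyadic_index j t) \<le> 2 ^ j * t" "2 ^ j * t < real (dyadic_index j t) + 1"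
proof -
  have "real (dyadic_index j t) = of_int \<lfloor>2 ^ j * t\<rfloor>" using assms by (simp add: dyadic_index_def)
  then show "real (dyadic_index j t) \<le> 2 ^ j * t" "2 ^ j * t < real (dyadic_index j t) + 1" by linarith+
qed

lemma dyadic_index_less:
  assumes "0 \<le> t" "t < real K" shows "dyadic_index j t < K * 2 ^ j"
proof -
  have "real (dyadic_index j t) \<le> 2 ^ j * t" by (rule dyadic_index_bounds[OF assms(1)])
  also have "\<dots> < 2 ^ j * real K" using assms by simp
  also have "\<dots> = real (K * 2 ^ j)" by simp
  finally show ?thesis by linarith
qed

lemma dyadic_index_mono: "s \<le> t \<Longrightarrow> dyadic_index j s \<le> dyadic_index j t"
  unfolding dyadic_index_def by (intro nat_mono floor_mono mult_left_mono) auto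

lemma dyadic_index_Suc:
  assumes "0 \<le> t"
  shows "dyadic_index (Suc j) t = 2 * dyadic_index j t \<or> dyadic_index (Suc j) t = Suc (2 * dyadic_index j t)"
proof -
  have "real (2 * dyadic_index j t) < real (dyadic_index (Suc j) t) + 1"
    "real (dyadic_index (Suc j) t) < real (2 * dyadic_index j t) + 2"
    using dyadic_index_bounds[OF assms, of j] dyadic_index_bounds[OF assms, of "Suc j"] by auto
  then have "2 * dyadic_index j t < dyadic_index (Suc j) t + 1" "dyadic_index (Suc j) t < 2 * dyadic_index j t + 2"
    by linarith+
  then show ?thesis by linarith
qed

lemma dyadic_index_near:
  assumes "0 \<le> s" "s \<le> t" "2 ^ j * (t - s) \<le> 1"
  shows "dyadic_index j t = dyadic_index j s \<or> dyadic_index j t = Suc (dyadic_index j s)"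
proof -
  have "real (dyadic_index j t) < real (dyadic_index j s) + 2"
    using dyadic_index_bounds[of t j] dyadic_index_bounds[of s j] assms by (simp add: algebra_simps)
  then show ?thesis using dyadic_index_mono[OF assms(2), of j] by linarith
qed

definition level_width :: "nat \<Rightarrow> real" where
  "level_width j = (real j + 1) * (1 / sqrt 2) ^ j"

lemma level_width_nonneg: "0 \<le> level_width j"
  by (simp add: level_width_def)

text \<open>The differentiated geometric series at \<open>1 / sqrt 2\<close>. Its terms are the
  bounds for single increments of tame paths, and its sum is the later
  \<open>chain_const\<close>.\<close>

lemma level_width_sums: "level_width sums (1 / (1 - 1 / sqrt 2)\<^sup>2)"
proof -
  have "norm (1 / sqrt 2 :: real) < 1" by simp
  from geometric_deriv_sums[OF this] show ?thesis
    by (simp add: level_width_def[abs_def] add.commute)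
qed

lemma level_width_summable: "summable level_width"
  by (rule sums_summable[OF level_width_sums])

text \<open>Outside the almost sure event \<open>tame\<close> the path is set to 0, so that
  continuity holds on the whole sample space.\<close>

definition bpath :: "(nat \<Rightarrow> real) \<Rightarrow> real \<Rightarrow> real" where
  "bpath w t = (if tame w then lim (\<lambda>j. grid j w (dyadic_index j t)) else 0)"

text \<open>From level \<open>j\<close> to the next, the dyadic point below \<open>t\<close> stays
  or moves by one interval of the finer level, so consecutive approximations differ by at most
  \<open>C * level_width (Suc j)\<close>.\<close>

lemma bpath_limit:
  assumes C: "\<And>j i. i < K * 2 ^ j \<Longrightarrow> \<bar>incr j w i\<bar> \<le> C * (real j + 1)" and t: "0 \<le> t" "t < real K"
    and w: "tame w"
  shows "(\<lambda>j. grid j w (dyadic_index j t)) \<longlonglongrightarrow> bpath w t"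
    "\<bar>bpath w t - grid j w (dyadic_index j t)\<bar> \<le> C * (\<Sum>i. level_width (i + Suc j))"
proof -
  define g where "g j = grid j w (dyadic_index j t)" for j
  have C0: "0 \<le> C" using C[of 0 0] t by (cases K) auto
  have step: "\<bar>g (Suc j) - g j\<bar> \<le> C * level_width (Suc j)" for j
  proof -
    let ?k = "dyadic_index j t"
    have "\<bar>g (Suc j) - g j\<bar> \<le> \<bar>(1 / sqrt 2) ^ Suc j * incr (Suc j) w (2 * ?k)\<bar>"
      using dyadic_index_Suc[OF t(1), of j] grid_Suc_diff[of "Suc j" w "2 * ?k"] grid_double[of j w ?k]
      by (auto simp: g_def)
    also have "\<dots> = (1 / sqrt 2) ^ Suc j * \<bar>incr (Suc j) w (2 * ?k)\<bar>" by (simp add: abs_mult)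
    also have "\<dots> \<le> (1 / sqrt 2) ^ Suc j * (C * (real (Suc j) + 1))"
      using dyadic_index_less[OF t, of j] by (intro mult_left_mono C) auto
    finally show ?thesis by (simp add: level_width_def mult_ac)
  qed
  have summ: "summable (\<lambda>i. C * level_width (Suc i))"
    using level_width_summable by (intro summable_mult) (simp add: summable_Suc_iff)
  have sumd: "summable (\<lambda>i. g (Suc i) - g i)"
    by (rule summable_comparison_test[OF _ summ]) (use step in auto)
  have "convergent g"
    using sumd telescope_summable' summable_LIMSEQ' by (simp add: summable_iff_convergent sum_lessThan_telescope convergent_diff_const_right_iff)
  then have lim: "g \<longlonglongrightarrow> lim g" by (simp add: convergent_LIMSEQ_iff)
  have p: "bpath w t = lim g" using w by (simp add: bpath_def g_def[abs_def])
  show "(\<lambda>j. grid j w (dyadic_index j t)) \<longlonglongrightarrow> bpath w t"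
    using lim by (simp add: p g_def[abs_def])
  have bound: "\<bar>g (j + n) - g j\<bar> \<le> C * (\<Sum>i<n. level_width (i + Suc j))" for n
  proof (induction n)
    case (Suc n)
    have "\<bar>g (j + Suc n) - g j\<bar> \<le> \<bar>g (Suc (j + n)) - g (j + n)\<bar> + \<bar>g (j + n) - g j\<bar>" by simp
    also have "\<dots> \<le> C * level_width (Suc (j + n)) + C * (\<Sum>i<n. level_width (i + Suc j))"
      by (intro add_mono step Suc)
    finally show ?case by (simp add: algebra_simps)
  qed simp
  have summ2: "summable (\<lambda>i. level_width (i + Suc j))"
    by (rule summable_ignore_initial_segment[OF level_width_summable])
  have "\<bar>g (j + n) - g j\<bar> \<le> C * (\<Sum>i. level_width (i + Suc j))" for n
  proof -
    have "(\<Sum>i<n. level_width (i + Suc j)) \<le> (\<Sum>i. level_width (i + Suc j))"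
      by (rule sum_le_suminf[OF summ2]) (auto simp: level_width_nonneg)
    with bound[of n] C0 show ?thesis by (meson mult_left_mono order_trans)
  qed
  moreover have "(\<lambda>n. \<bar>g (j + n) - g j\<bar>) \<longlonglongrightarrow> \<bar>lim g - g j\<bar>"
    by (intro tendsto_intros LIMSEQ_ignore_initial_segment[OF lim, of j, simplified add.commute[of _ j]])
  ultimately have "\<bar>lim g - g j\<bar> \<le> C * (\<Sum>i. level_width (i + Suc j))"
    by (intro LIMSEQ_le_const2) auto
  then show "\<bar>bpath w t - grid j w (dyadic_index j t)\<bar> \<le> C * (\<Sum>i. level_width (i + Suc j))"
    by (simp add: p g_def)
qed

lemma bpath_0: "bpath w 0 = 0"
  by (simp add: bpath_def dyadic_index_def)

text \<open>At level \<open>j\<close> the dyadic indices of \<open>s\<close> and \<open>t\<close>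
  are equal or adjacent: one increment of this level, and the tail of the series for each of the two
  points.\<close>

lemma bpath_modulus:
  assumes C: "\<And>j i. i < K * 2 ^ j \<Longrightarrow> \<bar>incr j w i\<bar> \<le> C * (real j + 1)" and w: "tame w"
    and st: "0 \<le> s" "s \<le> t" "t < real K" "2 ^ j * (t - s) \<le> 1"
  shows "\<bar>bpath w t - bpath w s\<bar> \<le> C * (2 * (\<Sum>i. level_width (i + Suc j)) + level_width j)"
proof -
  let ?k = "dyadic_index j s"
  have C0: "0 \<le> C" using C[of 0 0] st by (cases K) auto
  have "\<bar>grid j w (dyadic_index j t) - grid j w ?k\<bar> \<le> \<bar>(1 / sqrt 2) ^ j * incr j w ?k\<bar>"
    using dyadic_index_near[OF st(1,2,4)] grid_Suc_diff[of j w ?k] by auto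
  also have "\<dots> = (1 / sqrt 2) ^ j * \<bar>incr j w ?k\<bar>" by (simp add: abs_mult)
  also have "\<dots> \<le> (1 / sqrt 2) ^ j * (C * (real j + 1))"
    using dyadic_index_less[of s K j] st by (intro mult_left_mono C) auto
  finally have "\<bar>grid j w (dyadic_index j t) - grid j w ?k\<bar> \<le> C * level_width j"
    by (simp add: level_width_def mult_ac)
  moreover have "\<bar>bpath w t - grid j w (dyadic_index j t)\<bar> \<le> C * (\<Sum>i. level_width (i + Suc j))"
    by (rule bpath_limit(2)[OF C _ _ w]) (use st in auto)
  moreover have "\<bar>bpath w s - grid j w ?k\<bar> \<le> C * (\<Sum>i. level_width (i + Suc j))"
    by (rule bpath_limit(2)[OF C _ _ w]) (use st in auto)
  ultimately show ?thesis by (simp add: algebra_simps) 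
qed

lemma modulus_tendsto_0: "(\<lambda>j. C * (2 * (\<Sum>i. level_width (i + Suc j)) + level_width j)) \<longlonglongrightarrow> 0"
proof -
  have "(\<lambda>j. \<Sum>i. level_width (i + j)) \<longlonglongrightarrow> 0"
    by (rule suminf_exist_split2[OF level_width_summable])
  then have "(\<lambda>j. \<Sum>i. level_width (i + Suc j)) \<longlonglongrightarrow> 0"
    by (rule LIMSEQ_Suc)
  moreover have "level_width \<longlonglongrightarrow> 0" by (rule summable_LIMSEQ_zero[OF level_width_summable])
  ultimately have "(\<lambda>j. C * (2 * (\<Sum>i. level_width (i + Suc j)) + level_width j)) \<longlonglongrightarrow> C * (2 * 0 + 0)"
    by (intro tendsto_intros)
  then show ?thesis by simp
qed

lemma continuous_on_bpath: "continuous_on {0..} (bpath w)"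
proof (cases "tame w")
  case False
  then have "bpath w = (\<lambda>_. 0)" by (simp add: bpath_def fun_eq_iff)
  then show ?thesis by simp
next
  case True
  show ?thesis
  proof (rule continuous_on_iff[THEN iffD2], intro ballI allI impI)
    fix t e :: real assume t: "t \<in> {0..}" and e: "0 < e"
    \<comment> \<open>This leaves room for every \<open>s\<close> within distance 1 of
      \<open>t\<close>.\<close>
    define K where "K = nat \<lceil>t\<rceil> + 2"
    have K: "t + 1 < real K" using t by (simp add: K_def) linarith
    obtain C :: nat where C: "\<And>j i. i < K * 2 ^ j \<Longrightarrow> \<bar>incr j w i\<bar> \<le> real C * (real j + 1)"
      using True unfolding tame_def by blast
    obtain j where j: "real C * (2 * (\<Sum>i. level_width (i + Suc j)) + level_width j) < e"
      using order_tendstoD(2)[OF modulus_tendsto_0 e, of "real C"] by (auto simp: eventually_sequentially)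
    show "\<exists>d>0. \<forall>s\<in>{0..}. dist s t < d \<longrightarrow> dist (bpath w s) (bpath w t) < e"
    proof (intro exI[of _ "(1 / 2) ^ j"] conjI ballI impI)
      fix s :: real assume s: "s \<in> {0..}" "dist s t < (1 / 2) ^ j"
      have le1: "(1 / 2 :: real) ^ j \<le> 1" by (simp add: power_le_one)
      have d: "\<bar>s - t\<bar> < (1 / 2) ^ j" using s by (simp add: dist_real_def)
      have d2: "2 ^ j * \<bar>s - t\<bar> \<le> 1"
        using mult_left_mono[OF less_imp_le[OF d], of "2 ^ j"] by (simp add: power_one_over)
      have "\<bar>bpath w s - bpath w t\<bar> \<le> real C * (2 * (\<Sum>i. level_width (i + Suc j)) + level_width j)"
      proof (cases "s \<le> t")
        case True
        then show ?thesis
          using bpath_modulus[where s = s and t = t and j = j, OF C \<open>tame w\<close>] s d2 K by (simp add: abs_minus_commute)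
      next
        case False
        then show ?thesis
          using bpath_modulus[where s = t and t = s and j = j, OF C \<open>tame w\<close>] t d le1 d2 K by simp
      qed
      then show "dist (bpath w s) (bpath w t) < e" using j by (simp add: dist_real_def)
    qed simp
  qed
qed

lemma measurable_bpath [measurable]: "(\<lambda>w. bpath w t) \<in> borel_measurable gseq"
proof -
  have [measurable]: "(\<lambda>w. lim (\<lambda>j. grid j w (dyadic_index j t))) \<in> borel_measurable gseq"
    by (rule borel_measurable_lim_metric) (rule measurable_grid)
  show ?thesis unfolding bpath_def by measurable
qed

lemma AE_path_limit:
  assumes t: "0 \<le> t"
  shows "AE w in gseq. (\<lambda>j. grid j w (dyadic_index j t)) \<longlonglongrightarrow> bpath w t"
  using AE_tame
proof eventually_elim
  case (elim w)
  define K where "K = nat \<lceil>t\<rceil> + 1"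
  have K: "t < real K" using t by (simp add: K_def) linarith
  obtain C :: nat where C: "\<And>j i. i < K * 2 ^ j \<Longrightarrow> \<bar>incr j w i\<bar> \<le> real C * (real j + 1)"
    using elim unfolding tame_def by blast
  show ?case by (rule bpath_limit(1)[OF C t K elim])
qed

section \<open>Joint law of the increments of the path\<close>

lemma measurable_gaussian_eq [simp]: "measurable gaussian N = measurable borel N"
  by (rule measurable_cong_sets) simp_all

lemma nn_integral_gseq_indep:
  assumes [measurable]: "X \<in> borel_measurable gseq" "Y \<in> borel_measurable gseq"
    and X: "\<And>\<omega> \<omega>'. (\<And>i. i \<in> A \<Longrightarrow> \<omega> i = \<omega>' i) \<Longrightarrow> X \<omega> = X \<omega>'"
    and Y: "\<And>\<omega> \<omega>'. (\<And>i. i \<notin> A \<Longrightarrow> \<omega> i = \<omega>' i) \<Longrightarrow> Y \<omega> = (Y \<omega>' :: ennreal)"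
  shows "(\<integral>\<^sup>+\<omega>. X \<omega> * Y \<omega> \<partial>gseq) = (\<integral>\<^sup>+\<omega>. X \<omega> \<partial>gseq) * (\<integral>\<^sup>+\<omega>. Y \<omega> \<partial>gseq)"
proof -
  have "(\<integral>\<^sup>+\<omega>. X \<omega> * Y \<omega> \<partial>gseq)
     = (\<integral>\<^sup>+x. \<integral>\<^sup>+y. X (\<lambda>i. if i \<in> A then x i else y i) * Y (\<lambda>i. if i \<in> A then x i else y i) \<partial>gseq \<partial>gseq)"
    by (rule nn_integral_resample) measurable
  also have "\<dots> = (\<integral>\<^sup>+x. \<integral>\<^sup>+y. X x * Y y \<partial>gseq \<partial>gseq)"
  proof (intro nn_integral_cong)
    fix x y
    have "X (\<lambda>i. if i \<in> A then x i else y i) = X x" by (rule X) simp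
    moreover have "Y (\<lambda>i. if i \<in> A then x i else y i) = Y y" by (rule Y) simp
    ultimately show "X (\<lambda>i. if i \<in> A then x i else y i) * Y (\<lambda>i. if i \<in> A then x i else y i) = X x * Y y" by simp
  qed
  also have "\<dots> = (\<integral>\<^sup>+\<omega>. X \<omega> \<partial>gseq) * (\<integral>\<^sup>+\<omega>. Y \<omega> \<partial>gseq)"
    by (simp add: nn_integral_cmult nn_integral_multc)
  finally show ?thesis .
qed

lemma coordinates_indep:
  assumes I: "finite I" "I \<noteq> {}"
  shows "gseq.indep_vars (\<lambda>_. borel) (\<lambda>i w. w i) I"
proof (subst gseq.indep_vars_finite[where E = "\<lambda>_. sets borel"])
  have single: "measure gseq {w. w j \<in> B} = measure gaussian B" if "B \<in> sets borel" for j and B :: "real set"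
    using emeasure_gseq_coord[OF that, of j] by (simp add: measure_def)
  show "\<forall>A\<in>Pi I (\<lambda>_. sets borel). measure gseq (\<Inter>j\<in>I. (\<lambda>w. w j) -` A j \<inter> space gseq)
     = (\<Prod>j\<in>I. measure gseq ((\<lambda>w. w j) -` A j \<inter> space gseq))"
  proof
    fix A :: "nat \<Rightarrow> real set" assume A: "A \<in> Pi I (\<lambda>_. sets borel)"
    have "(\<Inter>j\<in>I. (\<lambda>w. w j) -` A j \<inter> space gseq) = {w. \<forall>j\<in>I. w j \<in> A j}"
      using I by auto
    moreover have "emeasure gseq {w. \<forall>j\<in>I. w j \<in> A j} = (\<Prod>j\<in>I. emeasure gaussian (A j))"
      using A I by (intro emeasure_gseq_box) (auto simp: Pi_iff)
    then have "measure gseq {w. \<forall>j\<in>I. w j \<in> A j} = (\<Prod>j\<in>I. measure gaussian (A j))"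
      unfolding gaussian.emeasure_eq_measure gseq.emeasure_eq_measure
      by (simp add: prod_ennreal prod_nonneg)
    ultimately have "measure gseq (\<Inter>j\<in>I. (\<lambda>w. w j) -` A j \<inter> space gseq) = (\<Prod>j\<in>I. measure gaussian (A j))"
      by simp
    also have "\<dots> = (\<Prod>j\<in>I. measure gseq ((\<lambda>w. w j) -` A j \<inter> space gseq))"
      using A by (intro prod.cong) (auto simp: single vimage_def Pi_iff)
    finally show "measure gseq (\<Inter>j\<in>I. (\<lambda>w. w j) -` A j \<inter> space gseq)
     = (\<Prod>j\<in>I. measure gseq ((\<lambda>w. w j) -` A j \<inter> space gseq))" .
  qed
qed (use I in \<open>auto simp: Int_stable_def sets.sigma_sets_eq[of borel, simplified]\<close>)

lemma distributed_gaussian: "distributed gaussian lborel (\<lambda>x. x) std_normal_density"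
proof -
  have "distr gaussian lborel (\<lambda>x. x) = gaussian" by (rule distr_id2) simp
  then show ?thesis by (simp add: distributed_def) (simp add: gaussian_def)
qed

lemma distr_scaled_gaussian:
  assumes "0 < s"
  shows "distr gaussian lborel (\<lambda>x. s * x) = density lborel (normal_density 0 s)"
  using gaussian.normal_density_affine[OF distributed_gaussian, of s 0] assms by (simp add: distributed_def)

text \<open>The law of the block sum appears as a scaled standard normal variable and not through a
  density, so that an empty block is included.\<close>

lemma nn_integral_block:
  assumes f [measurable]: "f \<in> borel_measurable borel" and ab: "a \<le> b"
  shows "(\<integral>\<^sup>+w. f (\<Sum>l=a..<b. w l) \<partial>gseq) = (\<integral>\<^sup>+x. f (sqrt (real (b - a)) * x) \<partial>gaussian)"
proof (cases "a = b")
  case True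
  then show ?thesis using gseq.emeasure_space_1 gaussian.emeasure_space_1 by simp
next
  case False
  have coord: "distributed gseq lborel (\<lambda>w. w i) (normal_density 0 1)" for i
  proof -
    have "distr gseq lborel (\<lambda>w. w i) = distr gseq borel (\<lambda>w. w i)" by (rule distr_cong) auto
    then show ?thesis by (simp add: distributed_def distr_gseq_coord gaussian_def)
  qed
  have "distributed gseq lborel (\<lambda>w. \<Sum>l=a..<b. w l) (normal_density (\<Sum>l=a..<b. 0) (sqrt (\<Sum>l=a..<b. 1\<^sup>2)))"
    by (rule gseq.sum_indep_normal) (use False ab coordinates_indep coord in auto)
  then have d: "distr gseq lborel (\<lambda>w. \<Sum>l=a..<b. w l) = density lborel (normal_density 0 (sqrt (real (b - a))))"
    by (simp add: distributed_def)
  have "(\<integral>\<^sup>+w. f (\<Sum>l=a..<b. w l) \<partial>gseq) = (\<integral>\<^sup>+y. f y \<partial>distr gseq lborel (\<lambda>w. \<Sum>l=a..<b. w l))"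
    by (subst nn_integral_distr) auto
  also have "\<dots> = (\<integral>\<^sup>+y. f y \<partial>distr gaussian lborel (\<lambda>x. sqrt (real (b - a)) * x))"
    using False ab by (subst d, subst distr_scaled_gaussian) auto
  also have "\<dots> = (\<integral>\<^sup>+x. f (sqrt (real (b - a)) * x) \<partial>gaussian)"
    by (subst nn_integral_distr) auto
  finally show ?thesis .
qed

lemma nn_integral_blocks:
  fixes k :: "nat \<Rightarrow> nat"
  assumes f: "\<And>i. f i \<in> borel_measurable borel"
  shows "mono_on {..m} k \<Longrightarrow>
    (\<integral>\<^sup>+w. (\<Prod>i<m. f i (\<Sum>l=k i..<k (Suc i). w l)) \<partial>gseq)
      = (\<Prod>i<m. \<integral>\<^sup>+x. f i (sqrt (real (k (Suc i) - k i)) * x) \<partial>gaussian)"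
proof (induction m)
  case 0
  then show ?case using gseq.emeasure_space_1 by simp
next
  case (Suc m)
  note f [measurable]
  have km: "mono_on {..m} k" by (rule mono_on_subset[OF Suc.prems]) auto
  have le: "k i \<le> k j" if "i \<le> j" "j \<le> Suc m" for i j
    using mono_onD[OF Suc.prems, of i j] that by simp
  have "(\<integral>\<^sup>+w. (\<Prod>i<Suc m. f i (\<Sum>l=k i..<k (Suc i). w l)) \<partial>gseq)
     = (\<integral>\<^sup>+w. (\<Prod>i<m. f i (\<Sum>l=k i..<k (Suc i). w l)) * f m (\<Sum>l=k m..<k (Suc m). w l) \<partial>gseq)"
    by simp
  also have "\<dots> = (\<integral>\<^sup>+w. (\<Prod>i<m. f i (\<Sum>l=k i..<k (Suc i). w l)) \<partial>gseq) * (\<integral>\<^sup>+w. f m (\<Sum>l=k m..<k (Suc m). w l) \<partial>gseq)"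
  proof (rule nn_integral_gseq_indep[where A = "{..<k m}"])
    fix \<omega> \<omega>' :: "nat \<Rightarrow> real" assume eq: "\<And>i. i \<in> {..<k m} \<Longrightarrow> \<omega> i = \<omega>' i"
    have "(\<Sum>l=k i..<k (Suc i). \<omega> l) = (\<Sum>l=k i..<k (Suc i). \<omega>' l)" if "i < m" for i
      using le[of "Suc i" m] that by (intro sum.cong eq) auto
    then show "(\<Prod>i<m. f i (\<Sum>l=k i..<k (Suc i). \<omega> l)) = (\<Prod>i<m. f i (\<Sum>l=k i..<k (Suc i). \<omega>' l))"
      by (intro prod.cong) auto
  next
    fix \<omega> \<omega>' :: "nat \<Rightarrow> real" assume eq: "\<And>i. i \<notin> {..<k m} \<Longrightarrow> \<omega> i = \<omega>' i"
    then have "(\<Sum>l=k m..<k (Suc m). \<omega> l) = (\<Sum>l=k m..<k (Suc m). \<omega>' l)" by (intro sum.cong eq) auto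
    then show "f m (\<Sum>l=k m..<k (Suc m). \<omega> l) = f m (\<Sum>l=k m..<k (Suc m). \<omega>' l)" by simp
  qed (measurable, measurable)
  also have "(\<integral>\<^sup>+w. (\<Prod>i<m. f i (\<Sum>l=k i..<k (Suc i). w l)) \<partial>gseq) = (\<Prod>i<m. \<integral>\<^sup>+x. f i (sqrt (real (k (Suc i) - k i)) * x) \<partial>gaussian)"
    by (rule Suc.IH[OF km])
  also have "(\<integral>\<^sup>+w. f m (\<Sum>l=k m..<k (Suc m). w l) \<partial>gseq) = (\<integral>\<^sup>+x. f m (sqrt (real (k (Suc m) - k m)) * x) \<partial>gaussian)"
    by (rule nn_integral_block[OF f]) (rule le, auto)
  finally show ?case by simp
qed

lemma grid_diff: "a \<le> b \<Longrightarrow> grid j w b - grid j w a = (1 / sqrt 2) ^ j * (\<Sum>l=a..<b. incr j w l)"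
proof -
  assume "a \<le> b"
  then have S: "sum (incr j w) {..<b} = sum (incr j w) {..<a} + sum (incr j w) {a..<b}"
    using sum.atLeastLessThan_concat[of 0 a b "incr j w"] by (simp add: atLeast0LessThan)
  show ?thesis unfolding grid_def S by (simp only: distrib_left add_diff_cancel_left')
qed

lemma nn_integral_grid:
  fixes k :: "nat \<Rightarrow> nat"
  assumes f: "\<And>i. f i \<in> borel_measurable borel" and k: "mono_on {..m} k"
  shows "(\<integral>\<^sup>+w. (\<Prod>i<m. f i (grid j w (k (Suc i)) - grid j w (k i))) \<partial>gseq)
      = (\<Prod>i<m. \<integral>\<^sup>+x. f i ((1 / sqrt 2) ^ j * sqrt (real (k (Suc i) - k i)) * x) \<partial>gaussian)"
proof -
  note f [measurable]
  let ?z = "(1 / sqrt 2 :: real) ^ j"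
  have le: "k i \<le> k (Suc i)" if "i < m" for i
    using mono_onD[OF k, of i "Suc i"] that by simp
  have "(\<integral>\<^sup>+w. (\<Prod>i<m. f i (grid j w (k (Suc i)) - grid j w (k i))) \<partial>gseq)
     = (\<integral>\<^sup>+w. (\<Prod>i<m. f i (?z * (\<Sum>l=k i..<k (Suc i). incr j w l))) \<partial>gseq)"
    using le by (intro nn_integral_cong prod.cong) (auto simp: grid_diff)
  also have "\<dots> = (\<integral>\<^sup>+w. (\<Prod>i<m. f i (?z * (\<Sum>l=k i..<k (Suc i). w l))) \<partial>gseq)"
    by (rule preserving_nn_integral[OF preserving_incr[of j], of "\<lambda>w. \<Prod>i<m. f i (?z * (\<Sum>l=k i..<k (Suc i). w l))"]) measurable
  also have "\<dots> = (\<Prod>i<m. \<integral>\<^sup>+x. f i (?z * (sqrt (real (k (Suc i) - k i)) * x)) \<partial>gaussian)"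
    by (rule nn_integral_blocks[OF _ k, of "\<lambda>i y. f i (?z * y)"]) measurable
  finally show ?thesis by (simp add: mult.assoc)
qed

lemma dyadic_index_limit:
  assumes "0 \<le> t"
  shows "(\<lambda>j. real (dyadic_index j t) / 2 ^ j) \<longlonglongrightarrow> t"
proof (rule tendsto_sandwich)
  show "\<forall>\<^sub>F j in sequentially. t - (1 / 2) ^ j \<le> real (dyadic_index j t) / 2 ^ j"
  proof (intro always_eventually allI)
    fix j
    have "2 ^ j * t / 2 ^ j \<le> (real (dyadic_index j t) + 1) / 2 ^ j"
      using dyadic_index_bounds(2)[OF assms, of j] by (intro divide_right_mono) auto
    then show "t - (1 / 2) ^ j \<le> real (dyadic_index j t) / 2 ^ j"
      by (simp add: add_divide_distrib power_one_over)
  qed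
  show "\<forall>\<^sub>F j in sequentially. real (dyadic_index j t) / 2 ^ j \<le> t"
    using dyadic_index_bounds(1)[OF assms] by (auto intro!: always_eventually simp: field_simps)
  show "(\<lambda>j. t - (1 / 2) ^ j) \<longlonglongrightarrow> t"
    using tendsto_diff[OF tendsto_const LIMSEQ_power_zero[of "1 / 2 :: real"], of t] by simp
qed simp

text \<open>On the grid of level \<open>j\<close> the identity is exact with \<open>s j i\<close> as
  standard deviation. Both sides pass to the limit by dominated convergence, because the test
  functions are continuous and bounded.\<close>

lemma bpath_increments_integral:
  fixes f :: "nat \<Rightarrow> real \<Rightarrow> real"
  assumes f: "\<And>i. continuous_on UNIV (f i)" "\<And>i x. 0 \<le> f i x" "\<And>i x. f i x \<le> 1"
    and \<tau>: "0 \<le> \<tau> 0" "mono_on {..m} \<tau>"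
  shows "(LINT w|gseq. (\<Prod>i<m. f i (bpath w (\<tau> (Suc i)) - bpath w (\<tau> i))))
    = (\<Prod>i<m. LINT x|gaussian. f i (sqrt (\<tau> (Suc i) - \<tau> i) * x))"
proof -
  have [measurable]: "f i \<in> borel_measurable borel" for i
    by (rule borel_measurable_continuous_onI[OF f(1)])
  have \<tau>_le: "\<tau> i \<le> \<tau> j" if "i \<le> j" "j \<le> m" for i j
    using mono_onD[OF \<tau>(2), of i j] that by simp
  have \<tau>0: "0 \<le> \<tau> i" if "i \<le> m" for i using \<tau>(1) \<tau>_le[of 0 i] that by simp
  define k where "k j i = dyadic_index j (\<tau> i)" for j i
  have k_mono: "mono_on {..m} (k j)" for j
    by (rule mono_onI) (auto simp: k_def intro!: dyadic_index_mono \<tau>_le)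
  define s where "s j i = (1 / sqrt 2) ^ j * sqrt (real (k j (Suc i) - k j i))" for j i
  define Y where "Y j w = (\<Prod>i<m. f i (grid j w (k j (Suc i)) - grid j w (k j i)))" for j w
  have prod01: "0 \<le> (\<Prod>i<m. f i (u i))" "(\<Prod>i<m. f i (u i)) \<le> 1" for u
    using f(2,3) by (auto intro!: prod_nonneg prod_le_1)
  have eq: "(LINT w|gseq. Y j w) = (\<Prod>i<m. LINT x|gaussian. f i (s j i * x))" for j
  proof -
    have "(LINT w|gseq. Y j w) = enn2real (\<integral>\<^sup>+w. ennreal (Y j w) \<partial>gseq)"
      by (rule integral_eq_nn_integral) (auto simp: Y_def prod01)
    also have "(\<integral>\<^sup>+w. ennreal (Y j w) \<partial>gseq) = (\<integral>\<^sup>+w. (\<Prod>i<m. ennreal (f i (grid j w (k j (Suc i)) - grid j w (k j i)))) \<partial>gseq)"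
      unfolding Y_def by (simp add: prod_ennreal f(2))
    also have "\<dots> = (\<Prod>i<m. \<integral>\<^sup>+x. ennreal (f i (s j i * x)) \<partial>gaussian)"
      unfolding s_def by (rule nn_integral_grid[OF _ k_mono, of "\<lambda>i y. ennreal (f i y)"]) measurable
    also have "enn2real \<dots> = (\<Prod>i<m. enn2real (\<integral>\<^sup>+x. ennreal (f i (s j i * x)) \<partial>gaussian))"
      by (induction m) (simp_all add: enn2real_mult)
    also have "\<dots> = (\<Prod>i<m. LINT x|gaussian. f i (s j i * x))"
      by (intro prod.cong refl integral_eq_nn_integral[symmetric]) (auto simp: f(2))
    finally show ?thesis .
  qed
  have lim_bpath: "AE w in gseq. \<forall>i\<in>{..m}. (\<lambda>j. grid j w (k j i)) \<longlonglongrightarrow> bpath w (\<tau> i)"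
    using AE_path_limit[OF \<tau>0] by (intro AE_finite_allI) (auto simp: k_def)
  have cont: "(\<lambda>j. f i (u j)) \<longlonglongrightarrow> f i l" if "u \<longlonglongrightarrow> l" for i u l
    using continuous_on_tendsto_compose[OF f(1) that] by simp
  have L: "(\<lambda>j. LINT w|gseq. Y j w) \<longlonglongrightarrow> (LINT w|gseq. (\<Prod>i<m. f i (bpath w (\<tau> (Suc i)) - bpath w (\<tau> i))))"
  proof (rule integral_dominated_convergence[where w = "\<lambda>_. 1"])
    show "AE w in gseq. (\<lambda>j. Y j w) \<longlonglongrightarrow> (\<Prod>i<m. f i (bpath w (\<tau> (Suc i)) - bpath w (\<tau> i)))"
      using lim_bpath by eventually_elim (auto simp: Y_def intro!: tendsto_prod cont tendsto_diff)
  qed (auto simp: Y_def prod01)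
  have s_lim: "(\<lambda>j. s j i) \<longlonglongrightarrow> sqrt (\<tau> (Suc i) - \<tau> i)" if "i < m" for i
  proof -
    have "s j i = sqrt (real (k j (Suc i)) / 2 ^ j - real (k j i) / 2 ^ j)" for j
    proof -
      have "k j i \<le> k j (Suc i)" using mono_onD[OF k_mono, of i "Suc i" j] that by simp
      moreover have "(1 / sqrt 2 :: real) ^ j = sqrt (1 / 2 ^ j)"
        by (simp add: real_sqrt_divide real_sqrt_power power_one_over)
      ultimately show ?thesis
        by (simp add: s_def of_nat_diff diff_divide_distrib flip: real_sqrt_mult)
    qed
    moreover have "(\<lambda>j. sqrt (real (k j (Suc i)) / 2 ^ j - real (k j i) / 2 ^ j)) \<longlonglongrightarrow> sqrt (\<tau> (Suc i) - \<tau> i)"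
      unfolding k_def using that by (intro tendsto_intros dyadic_index_limit \<tau>0) auto
    ultimately show ?thesis by simp
  qed
  have R: "(\<lambda>j. \<Prod>i<m. LINT x|gaussian. f i (s j i * x)) \<longlonglongrightarrow> (\<Prod>i<m. LINT x|gaussian. f i (sqrt (\<tau> (Suc i) - \<tau> i) * x))"
  proof (rule tendsto_prod)
    fix i assume "i \<in> {..<m}"
    then have i: "i < m" by simp
    show "(\<lambda>j. LINT x|gaussian. f i (s j i * x)) \<longlonglongrightarrow> (LINT x|gaussian. f i (sqrt (\<tau> (Suc i) - \<tau> i) * x))"
    proof (rule integral_dominated_convergence[where w = "\<lambda>_. 1"])
      show "AE x in gaussian. (\<lambda>j. f i (s j i * x)) \<longlonglongrightarrow> f i (sqrt (\<tau> (Suc i) - \<tau> i) * x)"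
        by (intro AE_I2 cont tendsto_intros s_lim[OF i])
    qed (auto simp: f(2,3))
  qed
  show ?thesis using LIMSEQ_unique[OF L] R by (simp add: eq)
qed

text \<open>Continuous approximations of the indicator of a closed set. The distance
  \<open>infdist\<close> to the empty set is 0 by convention and would give the value 1, hence the
  case distinction.\<close>

definition near :: "nat \<Rightarrow> real set \<Rightarrow> real \<Rightarrow> real" where
  "near n A x = (if A = {} then 0 else max 0 (1 - real n * infdist x A))"

lemma continuous_on_near: "continuous_on UNIV (near n A)"
  unfolding near_def[abs_def] by (cases "A = {}") (auto intro!: continuous_intros)

lemma near_bounds: "0 \<le> near n A x" "near n A x \<le> 1"
  by (auto simp: near_def infdist_nonneg)

lemma near_limit:
  assumes "closed A"
  shows "(\<lambda>n. near n A x) \<longlonglongrightarrow> indicator A x"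
proof (cases "A = {} \<or> x \<in> A")
  case True
  then have "near n A x = indicator A x" for n by (auto simp: near_def)
  then show ?thesis by simp
next
  case False
  then have d: "0 < infdist x A"
    using in_closed_iff_infdist_zero[OF assms, of x] infdist_nonneg[of x A] by force
  obtain N :: nat where N: "1 / infdist x A < real N" using reals_Archimedean2 by blast
  have "near n A x = 0" if "N \<le> n" for n
  proof -
    have "1 / infdist x A < real n" using N that by linarith
    then have "1 < real n * infdist x A" using d by (simp add: pos_divide_less_eq)
    then show ?thesis by (simp add: near_def)
  qed
  then have "eventually (\<lambda>n. near n A x = indicator A x) sequentially"
    using False by (intro eventually_sequentiallyI[of N]) auto
  then show ?thesis by (rule tendsto_eventually)
qed

lemma bpath_increments_closed:
  assumes A: "\<And>i. closed (A i)" and \<tau>: "0 \<le> \<tau> 0" "mono_on {..m} \<tau>"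
  shows "measure gseq {w. \<forall>i<m. bpath w (\<tau> (Suc i)) - bpath w (\<tau> i) \<in> A i}
    = (\<Prod>i<m. measure gaussian {x. sqrt (\<tau> (Suc i) - \<tau> i) * x \<in> A i})"
proof -
  have [measurable]: "A i \<in> sets borel" for i using A by (rule borel_closed)
  have [measurable]: "near n B \<in> borel_measurable borel" for n B
    by (rule borel_measurable_continuous_onI[OF continuous_on_near])
  define Y where "Y i w = bpath w (\<tau> (Suc i)) - bpath w (\<tau> i)" for i w
  define S where "S = {w. \<forall>i<m. Y i w \<in> A i}"
  have [measurable]: "Y i \<in> borel_measurable gseq" for i unfolding Y_def[abs_def] by measurable
  have S [measurable]: "S \<in> sets gseq"
  proof -
    have "{w \<in> space gseq. \<forall>i<m. Y i w \<in> A i} \<in> sets gseq" by measurable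
    then show ?thesis by (simp add: S_def)
  qed
  have eq: "(LINT w|gseq. (\<Prod>i<m. near n (A i) (Y i w))) = (\<Prod>i<m. LINT x|gaussian. near n (A i) (sqrt (\<tau> (Suc i) - \<tau> i) * x))" for n
    unfolding Y_def by (rule bpath_increments_integral[OF continuous_on_near near_bounds \<tau>])
  have "(\<lambda>n. LINT w|gseq. (\<Prod>i<m. near n (A i) (Y i w))) \<longlonglongrightarrow> (LINT w|gseq. (\<Prod>i<m. indicator (A i) (Y i w)))"
  proof (rule integral_dominated_convergence[where w = "\<lambda>_. 1"])
    show "AE w in gseq. (\<lambda>n. \<Prod>i<m. near n (A i) (Y i w)) \<longlonglongrightarrow> (\<Prod>i<m. indicator (A i) (Y i w))"
      by (intro AE_I2 tendsto_prod near_limit A)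
    show "AE w in gseq. norm (\<Prod>i<m. near n (A i) (Y i w)) \<le> 1" for n
      using near_bounds by (intro AE_I2) (auto simp: abs_prod intro!: prod_le_1)
  qed measurable
  moreover have "(\<lambda>n. \<Prod>i<m. LINT x|gaussian. near n (A i) (sqrt (\<tau> (Suc i) - \<tau> i) * x))
      \<longlonglongrightarrow> (\<Prod>i<m. LINT x|gaussian. indicator (A i) (sqrt (\<tau> (Suc i) - \<tau> i) * x))"
  proof (rule tendsto_prod)
    fix i
    show "(\<lambda>n. LINT x|gaussian. near n (A i) (sqrt (\<tau> (Suc i) - \<tau> i) * x))
      \<longlonglongrightarrow> (LINT x|gaussian. indicator (A i) (sqrt (\<tau> (Suc i) - \<tau> i) * x))"
    proof (rule integral_dominated_convergence[where w = "\<lambda>_. 1"])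
      show "AE x in gaussian. (\<lambda>n. near n (A i) (sqrt (\<tau> (Suc i) - \<tau> i) * x)) \<longlonglongrightarrow> indicator (A i) (sqrt (\<tau> (Suc i) - \<tau> i) * x)"
        by (intro AE_I2 near_limit A)
    qed (auto simp: near_bounds)
  qed
  ultimately have "(LINT w|gseq. (\<Prod>i<m. indicator (A i) (Y i w) :: real)) = (\<Prod>i<m. LINT x|gaussian. indicator (A i) (sqrt (\<tau> (Suc i) - \<tau> i) * x))"
    unfolding eq by (rule LIMSEQ_unique)
  moreover have "(\<Prod>i<m. indicator (A i) (Y i w)) = (indicator S w :: real)" for w
  proof (cases "w \<in> S")
    case False
    then obtain i where "i < m" "Y i w \<notin> A i" by (auto simp: S_def)
    then have "(\<Prod>i<m. indicator (A i) (Y i w)) = (0 :: real)" by (intro prod_zero) (auto intro!: bexI[of _ i])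
    then show ?thesis using False by simp
  qed (auto simp: S_def)
  moreover have "(LINT x|gaussian. indicator (A i) (c * x)) = measure gaussian {x. c * x \<in> A i}" for i and c :: real
  proof -
    have "(\<lambda>x. c * x) -` A i \<inter> space borel \<in> sets borel"
      by (rule measurable_sets[of _ borel borel]) auto
    then have "{x. c * x \<in> A i} \<in> sets borel" by (simp add: vimage_def)
    moreover have "(\<lambda>x. indicator (A i) (c * x) :: real) = indicator {x. c * x \<in> A i}" by (auto simp: indicator_def)
    ultimately show ?thesis by simp
  qed
  ultimately show ?thesis using S by (simp add: S_def Y_def)
qed

lemma sets_borel_closed: "sets borel = sigma_sets UNIV (Collect closed)"
  by (simp add: borel_eq_closed)

lemma Int_stable_closed: "Int_stable (Collect closed)"
  by (auto simp: Int_stable_def)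

text \<open>Closed sets are an intersection-stable generator, so
  \<open>bpath_increments_closed\<close> for one increment determines the law. The right side also
  makes sense for \<open>s = t\<close>, where there is no density.\<close>

lemma bpath_increment_law:
  assumes "0 \<le> s" "s \<le> t"
  shows "distr gseq borel (\<lambda>w. bpath w t - bpath w s) = distr gaussian borel (\<lambda>x. sqrt (t - s) * x)"
proof (rule measure_eqI_generator_eq[OF Int_stable_closed, where \<Omega> = UNIV and A = "\<lambda>_. UNIV"])
  fix X :: "real set" assume "X \<in> Collect closed"
  then have X: "closed X" by simp
  have m: "mono_on {..1} (\<lambda>i::nat. if i = 0 then s else t)" using assms by (auto simp: mono_on_def)
  have "measure gseq {w. bpath w t - bpath w s \<in> X} = measure gaussian {x. sqrt (t - s) * x \<in> X}"
    using bpath_increments_closed[of "\<lambda>_. X", OF X _ m] assms by simp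
  then show "emeasure (distr gseq borel (\<lambda>w. bpath w t - bpath w s)) X = emeasure (distr gaussian borel (\<lambda>x. sqrt (t - s) * x)) X"
    using borel_closed[OF X]
    by (simp add: emeasure_distr vimage_def gseq.emeasure_eq_measure gaussian.emeasure_eq_measure)
next
  show "sets (distr gseq borel (\<lambda>w. bpath w t - bpath w s)) = sigma_sets UNIV (Collect closed)"
    "sets (distr gaussian borel (\<lambda>x. sqrt (t - s) * x)) = sigma_sets UNIV (Collect closed)"
    by (simp_all only: sets_distr sets_borel_closed)
  have "prob_space (distr gseq borel (\<lambda>w. bpath w t - bpath w s))" by (rule gseq.prob_space_distr) simp
  then interpret prob_space "distr gseq borel (\<lambda>w. bpath w t - bpath w s)" .
  show "emeasure (distr gseq borel (\<lambda>w. bpath w t - bpath w s)) UNIV \<noteq> \<infinity>" by simp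
qed auto

lemma bpath_increments_indep:
  assumes \<tau>: "0 \<le> \<tau> 0" "mono_on {..m} \<tau>"
  shows "gseq.indep_vars (\<lambda>_. borel) (\<lambda>i w. bpath w (\<tau> (Suc i)) - bpath w (\<tau> i)) {..<m}"
proof (cases "m = 0")
  case True
  then show ?thesis by (simp add: gseq.indep_vars_def gseq.indep_sets_def)
next
  case False
  show ?thesis
  proof (subst gseq.indep_vars_finite[where E = "\<lambda>_. Collect closed"])
    let ?Y = "\<lambda>i w. bpath w (\<tau> (Suc i)) - bpath w (\<tau> i)"
    show "\<forall>A\<in>Pi {..<m} (\<lambda>_. Collect closed). measure gseq (\<Inter>j\<in>{..<m}. ?Y j -` A j \<inter> space gseq)
       = (\<Prod>j\<in>{..<m}. measure gseq (?Y j -` A j \<inter> space gseq))"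
    proof
      fix A :: "nat \<Rightarrow> real set" assume A: "A \<in> Pi {..<m} (\<lambda>_. Collect closed)"
      define B where "B i = (if i < m then A i else UNIV)" for i
      have B: "closed (B i)" for i using A by (auto simp: B_def Pi_iff)
      have "(\<Inter>j\<in>{..<m}. ?Y j -` A j \<inter> space gseq) = {w. \<forall>i<m. ?Y i w \<in> B i}"
        using False by (auto simp: B_def)
      then have "measure gseq (\<Inter>j\<in>{..<m}. ?Y j -` A j \<inter> space gseq)
         = (\<Prod>i<m. measure gaussian {x. sqrt (\<tau> (Suc i) - \<tau> i) * x \<in> B i})"
        using bpath_increments_closed[OF B \<tau>] by simp
      also have "\<dots> = (\<Prod>j\<in>{..<m}. measure gseq (?Y j -` A j \<inter> space gseq))"
      proof (rule prod.cong[OF refl])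
        fix j assume "j \<in> {..<m}"
        then have j: "j < m" by simp
        have "0 \<le> \<tau> j" "\<tau> j \<le> \<tau> (Suc j)"
          using mono_onD[OF \<tau>(2), of 0 j] mono_onD[OF \<tau>(2), of j "Suc j"] \<tau>(1) j by auto
        from bpath_increment_law[OF this]
        have "measure (distr gseq borel (?Y j)) (B j) = measure (distr gaussian borel (\<lambda>x. sqrt (\<tau> (Suc j) - \<tau> j) * x)) (B j)" by simp
        then show "measure gaussian {x. sqrt (\<tau> (Suc j) - \<tau> j) * x \<in> B j} = measure gseq (?Y j -` A j \<inter> space gseq)"
          using j borel_closed[OF B[of j]] by (simp add: measure_distr vimage_def B_def)
      qed
      finally show "measure gseq (\<Inter>j\<in>{..<m}. ?Y j -` A j \<inter> space gseq)
       = (\<Prod>j\<in>{..<m}. measure gseq (?Y j -` A j \<inter> space gseq))" .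
    qed
    show "sets borel = sigma_sets (space borel) (Collect closed :: real set set)"
      unfolding space_borel by (rule sets_borel_closed)
  qed (use False in \<open>auto simp: Int_stable_closed\<close>)
qed

lemma distributed_bpath_increment:
  assumes "0 \<le> s" "s < t"
  shows "distributed gseq lborel (\<lambda>w. bpath w t - bpath w s) (normal_density 0 (sqrt (t - s)))"
proof -
  have "distr gseq lborel (\<lambda>w. bpath w t - bpath w s) = distr gseq borel (\<lambda>w. bpath w t - bpath w s)"
    by (rule distr_cong) simp_all
  also have "\<dots> = distr gaussian borel (\<lambda>x. sqrt (t - s) * x)"
    using assms by (intro bpath_increment_law) simp_all
  also have "\<dots> = distr gaussian lborel (\<lambda>x. sqrt (t - s) * x)" by (rule distr_cong) simp_all
  also have "\<dots> = density lborel (normal_density 0 (sqrt (t - s)))"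
    using assms by (intro distr_scaled_gaussian) simp
  finally show ?thesis by (simp add: distributed_def)
qed

lemma standard_brownian_motion_bpath: "standard_brownian_motion gseq (\<lambda>t w. bpath w t)"
proof -
  have 1: "\<forall>t\<ge>0. (\<lambda>w. bpath w t) \<in> borel_measurable gseq" by simp
  have 2: "\<forall>w\<in>space gseq. bpath w 0 = 0" by (simp add: bpath_0)
  have 3: "\<forall>w\<in>space gseq. continuous_on {0..} (\<lambda>t. bpath w t)" by (simp add: continuous_on_bpath)
  have 4: "\<forall>s t. 0 \<le> s \<and> s < t \<longrightarrow>
      distributed gseq lborel (\<lambda>w. bpath w t - bpath w s) (normal_density 0 (sqrt (t - s)))"
    using distributed_bpath_increment by blast
  have 5: "\<forall>(m::nat) \<tau>. 0 \<le> \<tau> 0 \<and> mono_on {..m} \<tau> \<longrightarrow>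
      gseq.indep_vars (\<lambda>_. borel) (\<lambda>i w. bpath w (\<tau> (Suc i)) - bpath w (\<tau> i)) {..<m}"
    using bpath_increments_indep by blast
  show ?thesis
    unfolding standard_brownian_motion_def by (rule conjI[OF gseq.prob_space_axioms conjI[OF 1 conjI[OF 2 conjI[OF 3 conjI[OF 4 5]]]]])
qed

section \<open>Approximation of Brownian motion by the coupled walk\<close>

definition scaled :: "nat \<Rightarrow> (nat \<Rightarrow> real) \<Rightarrow> nat \<Rightarrow> real" where
  "scaled n w i = sqrt (real n) * (bpath w (real (Suc i) / real n) - bpath w (real i / real n))"

lemma std_gaussian_rv_increment:
  assumes st: "0 \<le> s" "s < t" and c: "c * sqrt (t - s) = 1"
  shows "std_gaussian_rv (\<lambda>w. c * (bpath w t - bpath w s))"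
proof -
  have "distr gseq borel (\<lambda>w. c * (bpath w t - bpath w s)) = distr (distr gseq borel (\<lambda>w. bpath w t - bpath w s)) borel ((*) c)"
    by (subst distr_distr) (simp_all add: comp_def)
  also have "\<dots> = distr (distr gaussian borel (\<lambda>x. sqrt (t - s) * x)) borel ((*) c)"
    using st by (subst bpath_increment_law) simp_all
  also have "\<dots> = distr gaussian borel (\<lambda>x. c * (sqrt (t - s) * x))"
    by (subst distr_distr) (simp_all add: comp_def)
  also have "(\<lambda>x. c * (sqrt (t - s) * x)) = (\<lambda>x. x)"
    using c by (simp add: fun_eq_iff mult.assoc[symmetric])
  also have "distr gaussian borel (\<lambda>x. x) = gaussian"
    by (rule distr_id2) simp
  finally show ?thesis by (simp add: std_gaussian_rv_def)
qed

lemma std_gaussian_rv_measure: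
  assumes "std_gaussian_rv X" "A \<in> sets borel"
  shows "measure gseq {w. X w \<in> A} = measure gaussian A"
proof -
  have "measure gaussian A = measure (distr gseq borel X) A" using assms by (simp add: std_gaussian_rv_def)
  also have "\<dots> = measure gseq (X -` A \<inter> space gseq)"
    using assms by (intro measure_distr) (auto simp: std_gaussian_rv_def)
  finally show ?thesis by (simp add: vimage_def)
qed

lemma std_gaussian_rv_scaled:
  assumes "1 \<le> n" shows "std_gaussian_rv (\<lambda>w. scaled n w i)"
  unfolding scaled_def
proof (rule std_gaussian_rv_increment)
  have "real (Suc i) / real n - real i / real n = 1 / real n" by (simp add: add_divide_distrib)
  then show "sqrt (real n) * sqrt (real (Suc i) / real n - real i / real n) = 1"
    using assms by (simp add: real_sqrt_divide)
qed (use assms in \<open>auto simp: divide_strict_right_mono\<close>)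

lemma preserving_scaled:
  assumes n: "1 \<le> n" shows "preserving (scaled n)"
proof -
  have m: "scaled n \<in> measurable gseq gseq"
    unfolding measurable_gseq_iff using std_gaussian_rv_scaled[OF n] by (simp add: std_gaussian_rv_def)
  have "distr gseq gseq (scaled n) = gseq"
  proof (rule gseq_eqI)
    fix A :: "nat \<Rightarrow> real set" and J :: "nat set"
    assume J: "finite J" and A: "\<And>i. i \<in> J \<Longrightarrow> A i \<in> sets borel"
    let ?B = "{\<omega>. \<forall>i\<in>J. \<omega> i \<in> A i}"
    obtain k where k: "J \<subseteq> {..<k}" using finite_nat_bounded[OF J] by blast
    define \<tau> where "\<tau> i = real i / real n" for i :: nat
    have \<tau>: "0 \<le> \<tau> 0" "mono_on {..k} \<tau>"
      by (auto simp: \<tau>_def mono_on_def divide_right_mono)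
    let ?Y = "\<lambda>i w. bpath w (\<tau> (Suc i)) - bpath w (\<tau> i)"
    let ?A = "\<lambda>i. {x. sqrt (real n) * x \<in> A i}"
    have A': "?A i \<in> sets borel" if "i \<in> J" for i
    proof -
      have "(\<lambda>x. sqrt (real n) * x) -` A i \<inter> space borel \<in> sets borel"
        using A[OF that] by (intro measurable_sets[of _ borel borel]) auto
      then show ?thesis by (simp add: vimage_def)
    qed
    have single: "measure gseq (?Y i -` ?A i \<inter> space gseq) = measure gaussian (A i)" if "i \<in> J" for i
      using std_gaussian_rv_measure[OF std_gaussian_rv_scaled[OF n, of i] A[OF that]]
      by (simp add: vimage_def scaled_def \<tau>_def)
    have "measure gseq {w. \<forall>i\<in>J. scaled n w i \<in> A i} = (\<Prod>i\<in>J. measure gaussian (A i))"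
    proof (cases "J = {}")
      case True
      then show ?thesis using gseq.prob_space by simp
    next
      case False
      have "{w. \<forall>i\<in>J. scaled n w i \<in> A i} = (\<Inter>i\<in>J. ?Y i -` ?A i \<inter> space gseq)"
        using False by (auto simp: scaled_def \<tau>_def)
      then have "measure gseq {w. \<forall>i\<in>J. scaled n w i \<in> A i} = (\<Prod>i\<in>J. measure gseq (?Y i -` ?A i \<inter> space gseq))"
        using gseq.indep_varsD[OF bpath_increments_indep[OF \<tau>] False J k, of ?A] A' by simp
      then show ?thesis using single by simp
    qed
    moreover have "emeasure (distr gseq gseq (scaled n)) ?B = emeasure gseq {w. \<forall>i\<in>J. scaled n w i \<in> A i}"
      using m J A by (subst emeasure_distr) (auto simp: vimage_def)
    ultimately show "emeasure (distr gseq gseq (scaled n)) ?B = (\<Prod>i\<in>J. emeasure gaussian (A i))"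
      by (simp add: gseq.emeasure_eq_measure gaussian.emeasure_eq_measure prod_ennreal)
  qed simp
  with m show ?thesis by (simp add: preserving_def)
qed

lemma scaled_sum: "(\<Sum>i<k. scaled n w i) = sqrt (real n) * bpath w (real k / real n)"
  by (induction k) (simp_all add: bpath_0 scaled_def algebra_simps)

text \<open>On the way to \<open>t\<close> through its dyadic approximations each level adds at most
  one increment. A general function \<open>b\<close> is treated because the cells between
  \<open>k / n\<close> and \<open>(k + 1) / n\<close> are not aligned with the dyadic grid on which
  the path was built.\<close>

lemma chaining_bound:
  fixes b :: "real \<Rightarrow> real" and a :: "nat \<Rightarrow> real"
  assumes b: "continuous_on {0..1} b" and a: "a sums c" "\<And>j. 0 \<le> a j"
    and incr: "\<And>j i. i < 2 ^ j \<Longrightarrow> \<bar>b (real (Suc i) / 2 ^ j) - b (real i / 2 ^ j)\<bar> \<le> a j"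
    and t: "0 \<le> t" "t \<le> 1"
  shows "\<bar>b t - b 0\<bar> \<le> c"
proof -
  have grid: "i \<le> 2 ^ j \<Longrightarrow> \<bar>b (real i / 2 ^ j) - b 0\<bar> \<le> (\<Sum>l\<le>j. a l)" for i j
  proof (induction j arbitrary: i)
    case 0
    then have "i = 0 \<or> i = 1" by auto
    then show ?case using incr[of 0 0] a(2)[of 0] by auto
  next
    case (Suc j)
    define q where "q = i div 2"
    have "i = 2 * q \<or> i = Suc (2 * q)" unfolding q_def by presburger
    moreover have "real (2 * q) / 2 ^ Suc j = real q / 2 ^ j" by simp
    moreover have "\<bar>b (real q / 2 ^ j) - b 0\<bar> \<le> (\<Sum>l\<le>j. a l)"
      using Suc by (intro Suc.IH) (auto simp: q_def)
    moreover have "\<bar>b (real (Suc (2 * q)) / 2 ^ Suc j) - b (real (2 * q) / 2 ^ Suc j)\<bar> \<le> a (Suc j)" if "i = Suc (2 * q)"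
      using Suc.prems that by (intro incr) auto
    ultimately show ?case using a(2)[of "Suc j"] by auto
  qed
  define u where "u j = real (dyadic_index j t) / 2 ^ j" for j
  have idx: "dyadic_index j t \<le> 2 ^ j" for j
  proof -
    have "real (dyadic_index j t) \<le> 2 ^ j * t" by (rule dyadic_index_bounds[OF t(1)])
    also have "\<dots> \<le> 2 ^ j * 1" using t by (intro mult_left_mono) auto
    finally have "real (dyadic_index j t) \<le> real (2 ^ j)" by simp
    then show ?thesis by (simp only: of_nat_le_iff)
  qed
  have u: "u \<longlonglongrightarrow> t" unfolding u_def using dyadic_index_limit[OF t(1)] by simp
  have u01: "u j \<in> {0..1}" for j
    using idx[of j] by (auto simp: u_def divide_le_eq_1 simp flip: of_nat_le_iff)
  have "(\<lambda>j. b (u j)) \<longlonglongrightarrow> b t"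
    using b u u01 t by (intro continuous_on_tendsto_compose[OF b u]) auto
  then have "(\<lambda>j. \<bar>b (u j) - b 0\<bar>) \<longlonglongrightarrow> \<bar>b t - b 0\<bar>" by (intro tendsto_intros)
  moreover have "\<bar>b (u j) - b 0\<bar> \<le> c" for j
  proof -
    have "\<bar>b (u j) - b 0\<bar> \<le> (\<Sum>l\<le>j. a l)" unfolding u_def by (rule grid[OF idx])
    also have "\<dots> \<le> suminf a" by (rule sum_le_suminf[OF sums_summable[OF a(1)]]) (use a(2) in auto)
    finally show ?thesis using sums_unique[OF a(1)] by simp
  qed
  ultimately show ?thesis by (intro LIMSEQ_le_const2) auto
qed

definition chain_const :: real where
  "chain_const = 1 / (1 - 1 / sqrt 2)\<^sup>2"

lemma chain_const_nonneg: "0 \<le> chain_const"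
  by (simp add: chain_const_def)

text \<open>Increments over the dyadic subdivision of the \<open>k\<close>-th cell of length
  \<open>1 / n\<close>, normalised to variance 1.\<close>

definition fine_incr :: "nat \<Rightarrow> nat \<Rightarrow> nat \<Rightarrow> nat \<Rightarrow> (nat \<Rightarrow> real) \<Rightarrow> real" where
  "fine_incr n k j i w = sqrt (real n * 2 ^ j) *
    (bpath w ((real k + real (Suc i) / 2 ^ j) / real n) - bpath w ((real k + real i / 2 ^ j) / real n))"

lemma std_gaussian_rv_fine_incr:
  assumes "1 \<le> n" shows "std_gaussian_rv (fine_incr n k j i)"
proof -
  have "(real k + real (Suc i) / 2 ^ j) / real n - (real k + real i / 2 ^ j) / real n = 1 / (real n * 2 ^ j)"
    using assms by (simp add: field_simps)
  then have "sqrt (real n * 2 ^ j) * sqrt ((real k + real (Suc i) / 2 ^ j) / real n - (real k + real i / 2 ^ j) / real n) = 1"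
    using assms by (simp add: real_sqrt_divide)
  then have "std_gaussian_rv (\<lambda>w. sqrt (real n * 2 ^ j) *
    (bpath w ((real k + real (Suc i) / 2 ^ j) / real n) - bpath w ((real k + real i / 2 ^ j) / real n)))"
    using assms by (intro std_gaussian_rv_increment) (auto simp: divide_strict_right_mono)
  then show ?thesis by (simp add: fine_incr_def[abs_def])
qed

lemma local_oscillation:
  assumes n: "1 \<le> n" and y: "0 \<le> y"
    and incr: "\<And>j i. i < 2 ^ j \<Longrightarrow> \<bar>fine_incr n k j i w\<bar> \<le> y * (real j + 1)"
    and t: "real k / real n \<le> t" "t \<le> real (Suc k) / real n"
  shows "\<bar>bpath w t - bpath w (real k / real n)\<bar> \<le> y * chain_const / sqrt (real n)"
proof -
  define b where "b s = bpath w ((real k + s) / real n)" for s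
  define x where "x = real n * t - real k"
  have x: "0 \<le> x" "x \<le> 1" using t n by (auto simp: x_def field_simps)
  have "\<bar>b x - b 0\<bar> \<le> y / sqrt (real n) * chain_const"
  proof (rule chaining_bound[where a = "\<lambda>j. y / sqrt (real n) * level_width j"])
    show "continuous_on {0..1} b"
      unfolding b_def
      by (rule continuous_on_compose2[OF continuous_on_bpath[of w]]) (use n in \<open>auto intro!: continuous_intros\<close>)
    show "(\<lambda>j. y / sqrt (real n) * level_width j) sums (y / sqrt (real n) * chain_const)"
      unfolding chain_const_def by (rule sums_mult[OF level_width_sums])
    show "0 \<le> y / sqrt (real n) * level_width j" for j using y by (simp add: level_width_nonneg)
    fix i j :: nat assume i: "i < 2 ^ j"
    let ?d = "b (real (Suc i) / 2 ^ j) - b (real i / 2 ^ j)"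
    have "sqrt (real n) * sqrt 2 ^ j * \<bar>?d\<bar> \<le> y * (real j + 1)"
      using incr[OF i] by (simp add: fine_incr_def b_def abs_mult real_sqrt_mult real_sqrt_power)
    then have "\<bar>?d\<bar> \<le> y * (real j + 1) / (sqrt (real n) * sqrt 2 ^ j)"
      using n by (simp add: pos_le_divide_eq mult.commute)
    also have "\<dots> = y / sqrt (real n) * level_width j"
      by (simp add: level_width_def power_one_over)
    finally show "\<bar>?d\<bar> \<le> y / sqrt (real n) * level_width j" .
  qed (use x in auto)
  moreover have "b x = bpath w t" "b 0 = bpath w (real k / real n)" using n by (auto simp: b_def x_def)
  ultimately show ?thesis by simp
qed

section \<open>Depth of the tree, exceptional event and final estimate\<close>

definition lev :: "nat \<Rightarrow> nat" where
  "lev n = (LEAST J. n \<le> 2 ^ J)"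

lemma lev_ge: "n \<le> 2 ^ lev n"
  unfolding lev_def by (rule LeastI[of _ n]) (rule less_imp_le[OF less_exp])

lemma ln_ge_half: "2 \<le> n \<Longrightarrow> 1 / 2 \<le> ln (real n)"
proof -
  assume n: "2 \<le> n"
  have "1 / 2 \<le> exp (- (1 / 2) :: real)" using exp_ge_add_one_self[of "- (1 / 2) :: real"] by simp
  then have "exp (1 / 2 :: real) \<le> 2" by (simp add: exp_minus field_simps)
  also have "\<dots> \<le> real n" using n by simp
  finally show ?thesis using n by (subst ln_ge_iff) auto
qed

text \<open>Minimality gives \<open>2 ^ (lev n - 1) \<le> n\<close> when \<open>lev n\<close> is
  positive, so \<open>lev n - 1\<close> is at most \<open>2 * ln n\<close> because
  \<open>ln 2 \<ge> 1 / 2\<close>; the remaining 2 is at most \<open>4 * ln n\<close>.\<close>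

lemma lev_le:
  assumes n: "2 \<le> n" shows "real (lev n) + 1 \<le> 6 * ln (real n)"
proof (cases "lev n")
  case 0
  then show ?thesis using ln_ge_half[OF n] by simp
next
  case (Suc j)
  then have "\<not> n \<le> 2 ^ j" unfolding lev_def by (intro not_less_Least) simp
  then have "(2::nat) ^ j \<le> n" by simp
  then have "(2::real) ^ j \<le> real n" by (metis of_nat_le_iff of_nat_numeral of_nat_power)
  then have "ln ((2::real) ^ j) \<le> ln (real n)" using n by (subst ln_le_cancel_iff) auto
  then have "real j * ln 2 \<le> ln (real n)" by (simp add: ln_realpow)
  moreover have "real j * (1 / 2) \<le> real j * ln 2" using ln_ge_half[of 2] by (intro mult_left_mono) auto
  ultimately show ?thesis using ln_ge_half[OF n] Suc by simp
qed

definition bad :: "nat \<Rightarrow> (nat \<Rightarrow> real) set" where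
  "bad n = {w. 42280 * (real (lev n) + 1) \<le> total_err (lev n) (haar (lev n) 0 (scaled n w))} \<union>
    (\<Union>k<n. {w. \<exists>j. \<exists>i<1 * 2 ^ j. 4 * ln (real n) * (real j + 1) < \<bar>fine_incr n k j i w\<bar>})"

text \<open>The coupling part has probability at most \<open>16 ^ - (lev n + 1)\<close>, and
  \<open>n \<le> 2 ^ lev n\<close> bounds this by \<open>1 / n\<^sup>2\<close>. The threshold
  \<open>4 * ln n\<close> gives each of the \<open>n\<close> cells at most
  \<open>10 / n ^ 4\<close>, in total at most \<open>10 / n\<^sup>2\<close>.\<close>

lemma bad_small:
  assumes n: "2 \<le> n"
  shows "bad n \<in> sets gseq" "measure gseq (bad n) \<le> 11 / (real n)\<^sup>2"
proof -
  let ?J = "lev n" and ?y = "4 * ln (real n)"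
  let ?T = "{\<zeta>. 42280 * (real ?J + 1) \<le> total_err ?J \<zeta>}"
  let ?H = "\<lambda>w. haar ?J 0 (scaled n w)"
  define E where "E k = {w. \<exists>j. \<exists>i<1 * 2 ^ j. ?y * (real j + 1) < \<bar>fine_incr n k j i w\<bar>}" for k
  have n1: "1 \<le> n" using n by simp
  have H: "preserving ?H" by (rule preserving_comp[OF preserving_haar preserving_scaled[OF n1]])
  have y: "2 \<le> ?y" using ln_ge_half[OF n] by simp
  have T: "?T \<in> sets gseq"
  proof -
    have "{\<zeta> \<in> space gseq. 42280 * (real ?J + 1) \<le> total_err ?J \<zeta>} \<in> sets gseq" by measurable
    then show ?thesis by simp
  qed
  have eq: "{w. 42280 * (real ?J + 1) \<le> total_err ?J (?H w)} = ?H -` ?T \<inter> space gseq" by auto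
  have B1: "?H -` ?T \<inter> space gseq \<in> sets gseq"
    by (rule measurable_sets[OF preserving_measurable[OF H] T])
  have "measure gseq (?H -` ?T \<inter> space gseq) = measure (distr gseq gseq ?H) ?T"
    using preserving_measurable[OF H] T by (rule measure_distr[symmetric])
  also have "\<dots> = measure gseq ?T" using H by (simp add: preserving_def)
  also have "\<dots> \<le> (1 / 16) ^ Suc ?J" by (rule total_err_tail)
  also have "\<dots> \<le> 1 / (real n)\<^sup>2"
  proof -
    have "real n \<le> real (2 ^ ?J)" by (simp only: of_nat_le_iff lev_ge)
    then have "(real n)\<^sup>2 \<le> (2 ^ ?J)\<^sup>2" using n by (intro power_mono) auto
    also have "\<dots> = (4::real) ^ ?J" by (simp add: power2_eq_square flip: power_mult_distrib)
    also have "\<dots> \<le> 16 ^ ?J" by (intro power_mono) auto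
    also have "\<dots> \<le> 16 ^ Suc ?J" by simp
    finally have "1 / 16 ^ Suc ?J \<le> 1 / (real n)\<^sup>2" using n by (intro divide_left_mono) auto
    then show ?thesis by (simp only: power_one_over)
  qed
  finally have M1: "measure gseq (?H -` ?T \<inter> space gseq) \<le> 1 / (real n)\<^sup>2" .
  have E: "E k \<in> sets gseq" "measure gseq (E k) \<le> 10 * exp (- ?y)" for k
    using grid_tail[where K = 1 and X = "fine_incr n k", OF std_gaussian_rv_fine_incr[OF n1] y]
    by (auto simp: E_def)
  have B2: "(\<Union>k<n. E k) \<in> sets gseq" using E(1) by auto
  have "measure gseq (\<Union>k<n. E k) \<le> (\<Sum>k<n. measure gseq (E k))"
    using E(1) by (intro gseq.finite_measure_subadditive_finite) auto
  also have "\<dots> \<le> (\<Sum>k<n. 10 * exp (- ?y))" by (intro sum_mono E(2))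
  also have "\<dots> = 10 * (real n * exp (- ?y))" by simp
  also have "\<dots> \<le> 10 / (real n)\<^sup>2"
  proof -
    have "exp ?y = exp (real 4 * ln (real n))" by simp
    also have "\<dots> = exp (ln (real n)) ^ 4" by (rule exp_of_nat_mult)
    finally have "exp (- ?y) = 1 / (real n) ^ 4" using n by (simp add: exp_minus inverse_eq_divide)
    then have "real n * exp (- ?y) = 1 / (real n * (real n)\<^sup>2)"
      using n by (simp add: power2_eq_square power4_eq_xxxx)
    also have "\<dots> \<le> 1 / (1 * (real n)\<^sup>2)" using n by (intro divide_left_mono mult_right_mono) auto
    finally show ?thesis by simp
  qed
  finally have M2: "measure gseq (\<Union>k<n. E k) \<le> 10 / (real n)\<^sup>2" .
  have bad: "bad n = (?H -` ?T \<inter> space gseq) \<union> (\<Union>k<n. E k)"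
    unfolding bad_def E_def eq ..
  show "bad n \<in> sets gseq" unfolding bad using B1 B2 by (rule sets.Un)
  have "measure gseq (bad n) \<le> 1 / (real n)\<^sup>2 + 10 / (real n)\<^sup>2"
    unfolding bad using measure_Un_le[OF B1 B2] M1 M2 by linarith
  then show "measure gseq (bad n) \<le> 11 / (real n)\<^sup>2" by simp
qed

text \<open>Three errors add up: the oscillation of the path within a cell, the coupling error at
  the grid point with constant \<open>42280 * 6 = 253680\<close>, and the interpolation of the walk,
  \<open>1 / sqrt n\<close>, which is at most \<open>2 * ln n / sqrt n\<close>.\<close>

lemma good_close:
  assumes n: "2 \<le> n" and w: "w \<notin> bad n" and t: "0 \<le> t" "t \<le> 1"
  shows "\<bar>bpath w t - ell n (\<lambda>k. sign_step (lev n) (scaled n w) k) t\<bar>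
    \<le> (253682 + 4 * chain_const) * (ln (real n) / sqrt (real n))"
proof -
  let ?J = "lev n" and ?X = "\<lambda>k. sign_step (lev n) (scaled n w) k"
  define r where "r = sqrt (real n)"
  define L where "L = ln (real n)"
  have r: "0 < r" "r * r = real n" using n by (auto simp: r_def)
  have L: "1 / 2 \<le> L" unfolding L_def by (rule ln_ge_half[OF n])
  define k where "k = nat \<lfloor>real n * t\<rfloor>"
  have k0: "real k = of_int \<lfloor>real n * t\<rfloor>" using t by (simp add: k_def)
  then have k: "real k \<le> real n * t" "real n * t < real k + 1" by linarith+
  have kn: "k \<le> n"
  proof -
    have "real n * t \<le> real n * 1" using t by (intro mult_left_mono) auto
    then have "real k \<le> real n" using k(1) by simp
    then show ?thesis by simp
  qed
  have kt: "real k / real n \<le> t" "t \<le> real (Suc k) / real n"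
    using k n by (simp_all add: field_simps)
  have osc: "\<bar>bpath w t - bpath w (real k / real n)\<bar> \<le> 4 * L * chain_const / r"
  proof (cases "k < n")
    case True
    show ?thesis unfolding r_def L_def
    proof (rule local_oscillation)
      fix j i :: nat assume "i < 2 ^ j"
      then show "\<bar>fine_incr n k j i w\<bar> \<le> 4 * ln (real n) * (real j + 1)"
        using w True unfolding bad_def by (force simp: not_le[symmetric])
    qed (use n L kt in \<open>auto simp: L_def\<close>)
  next
    \<comment> \<open>This is the time \<open>t = 1\<close>, where \<open>k = n\<close> is no index
      of a cell in \<open>bad n\<close>; no oscillation arises, because \<open>t\<close> is itself a
      grid point.\<close>
    case False
    then have "k = n" using kn by simp
    then have "t = real k / real n" using kt(1) t n by simp
    then show ?thesis using L r chain_const_nonneg by simp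
  qed
  have "\<bar>(\<Sum>i=1..k. ?X i) - r * bpath w (real k / real n)\<bar> \<le> 42280 * (6 * L)"
  proof -
    have "(\<Sum>i=1..k. ?X i) = (\<Sum>i<k. ?X (Suc i))"
      using sum.atLeast_Suc_atMost_Suc_shift[of ?X 0] by (simp add: sum.atLeast1_atMost_eq)
    also have "\<dots> = (\<Sum>i<k. 2 * real (coupled ?J (scaled n w) i) - 1)" by (simp add: sign_step_def)
    finally have "(\<Sum>i=1..k. ?X i) - r * bpath w (real k / real n) = (\<Sum>i<k. 2 * real (coupled ?J (scaled n w) i) - 1 - scaled n w i)"
      unfolding r_def scaled_sum[symmetric] by (simp add: sum_subtractf)
    also have "\<bar>\<dots>\<bar> \<le> total_err ?J (haar ?J 0 (scaled n w))"
      by (rule coupled_close) (rule order_trans[OF kn lev_ge])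
    also have "\<dots> \<le> 42280 * (real ?J + 1)" using w by (auto simp: bad_def)
    also have "\<dots> \<le> 42280 * (6 * L)" unfolding L_def using lev_le[OF n] by (intro mult_left_mono) auto
    finally show ?thesis .
  qed
  then have "\<bar>(\<Sum>i=1..k. ?X i) - r * bpath w (real k / real n)\<bar> / r \<le> 42280 * (6 * L) / r"
    using r by (intro divide_right_mono) auto
  moreover have "\<bar>(\<Sum>i=1..k. ?X i) - r * bpath w (real k / real n)\<bar> / r = \<bar>(\<Sum>i=1..k. ?X i) / r - bpath w (real k / real n)\<bar>"
    using r by (simp add: abs_div_pos diff_divide_distrib)
  ultimately have disc: "\<bar>(\<Sum>i=1..k. ?X i) / r - bpath w (real k / real n)\<bar> \<le> 253680 * L / r" by simp
  have interp: "\<bar>(t - real k / real n) * (?X (Suc k) * r)\<bar> \<le> 2 * L / r"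
  proof -
    have "\<bar>?X (Suc k)\<bar> = 1" using sign_step_in[of ?J "scaled n w" "Suc k"] by auto
    then have "\<bar>(t - real k / real n) * (?X (Suc k) * r)\<bar> = (t - real k / real n) * r"
      using kt(1) r by (simp add: abs_mult)
    also have "\<dots> \<le> 1 / real n * r"
      using kt(2) r by (intro mult_right_mono) (auto simp: add_divide_distrib)
    also have "\<dots> = 1 / r" unfolding r(2)[symmetric] using r(1) by simp
    also have "\<dots> \<le> 2 * L / r" using L r by (intro divide_right_mono) auto
    finally show ?thesis .
  qed
  have ell: "ell n ?X t = (\<Sum>i=1..k. ?X i) / r + (t - real k / real n) * (?X (Suc k) * r)"
    by (simp add: ell_def Let_def k_def r_def)
  have "\<bar>bpath w t - ell n ?X t\<bar> \<le> 4 * L * chain_const / r + 253680 * L / r + 2 * L / r"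
  proof -
    have "\<bar>a - (c + d)\<bar> \<le> A + B + C" if "\<bar>a - b\<bar> \<le> A" "\<bar>c - b\<bar> \<le> B" "\<bar>d\<bar> \<le> C" for a b c d A B C :: real
      using that by linarith
    from this[OF osc disc interp] show ?thesis unfolding ell .
  qed
  also have "\<dots> = (253682 + 4 * chain_const) * (L / r)"
    by (simp add: algebra_simps add_divide_distrib)
  finally show ?thesis by (simp add: L_def r_def)
qed

text \<open>The constant is larger by 1 than in \<open>good_close\<close>, so that off
  \<open>bad n\<close> the supremum lies strictly below the threshold. For \<open>n = 1\<close> the
  threshold is 0, and the bound 11 is trivial.\<close>

lemma sup_deviation:
  assumes n: "1 \<le> n"
  shows "measure gseq {w \<in> space gseq. (SUP t\<in>{0..1}. \<bar>bpath w t - ell n (\<lambda>k. sign_step (lev n) (scaled n w) k) t\<bar>)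
      \<ge> (253683 + 4 * chain_const) * (ln (real n) / sqrt (real n))} \<le> 11 / real n powr 2"
proof (cases "n = 1")
  case True
  then show ?thesis by (simp add: order_trans[OF gseq.prob_le_1])
next
  case False
  then have n2: "2 \<le> n" using n by simp
  let ?q = "ln (real n) / sqrt (real n)"
  have q: "0 < ?q" using ln_ge_half[OF n2] n2 by (intro divide_pos_pos) auto
  have "{w \<in> space gseq. (SUP t\<in>{0..1}. \<bar>bpath w t - ell n (\<lambda>k. sign_step (lev n) (scaled n w) k) t\<bar>)
      \<ge> (253683 + 4 * chain_const) * ?q} \<subseteq> bad n"
  proof
    fix w assume w: "w \<in> {w \<in> space gseq. (SUP t\<in>{0..1}. \<bar>bpath w t - ell n (\<lambda>k. sign_step (lev n) (scaled n w) k) t\<bar>)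
      \<ge> (253683 + 4 * chain_const) * ?q}"
    show "w \<in> bad n"
    proof (rule ccontr)
      assume nb: "w \<notin> bad n"
      have "(SUP t\<in>{0..1}. \<bar>bpath w t - ell n (\<lambda>k. sign_step (lev n) (scaled n w) k) t\<bar>) \<le> (253682 + 4 * chain_const) * ?q"
        by (rule cSUP_least) (use good_close[OF n2 nb] in auto)
      also have "\<dots> < (253683 + 4 * chain_const) * ?q" using q by (intro mult_strict_right_mono) auto
      finally show False using w by simp
    qed
  qed
  then have "measure gseq {w \<in> space gseq. (SUP t\<in>{0..1}. \<bar>bpath w t - ell n (\<lambda>k. sign_step (lev n) (scaled n w) k) t\<bar>)
      \<ge> (253683 + 4 * chain_const) * ?q} \<le> measure gseq (bad n)"
    by (rule gseq.finite_measure_mono[OF _ bad_small(1)[OF n2]])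
  also have "\<dots> \<le> 11 / (real n)\<^sup>2" by (rule bad_small(2)[OF n2])
  also have "\<dots> = 11 / real n powr 2" using n2 by (simp add: powr_realpow[of "real n" 2, simplified])
  finally show ?thesis .
qed

theorem theorem2p3:
  "\<exists>(c1::real) (c2::real) (\<alpha>::real). \<alpha> \<ge> 2 \<and>
     (\<exists>(M :: (nat \<Rightarrow> real) measure) (W :: real \<Rightarrow> (nat \<Rightarrow> real) \<Rightarrow> real)
        (X :: nat \<Rightarrow> nat \<Rightarrow> (nat \<Rightarrow> real) \<Rightarrow> real).
        prob_space M \<and> standard_brownian_motion M W \<and>
        (\<forall>n\<ge>1.
           (\<forall>k\<in>{1..n}. X k n \<in> borel_measurable M \<and> (\<forall>\<omega>\<in>space M. X k n \<omega> \<in> {-1, 1})) \<and>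
           prob_space.indep_vars M (\<lambda>_. borel) (\<lambda>k. X k n) {1..n} \<and>
           (\<forall>k\<in>{1..n}. \<P>(\<omega> in M. X k n \<omega> = 1) = 1 / 2 \<and> \<P>(\<omega> in M. X k n \<omega> = -1) = 1 / 2) \<and>
           \<P>(\<omega> in M. (SUP t\<in>{0..1}. \<bar>W t \<omega> - ell n (\<lambda>k. X k n \<omega>) t\<bar>)
                      \<ge> c1 * (ln (real n) / sqrt (real n)))
             \<le> c2 / real n powr \<alpha>))"
proof (rule exI[of _ "253683 + 4 * chain_const"], rule exI[of _ 11], rule exI[of _ 2], rule conjI, simp,
    rule exI[of _ gseq], rule exI[of _ "\<lambda>t w. bpath w t"],
    rule exI[of _ "\<lambda>k n w. sign_step (lev n) (scaled n w) k"], intro conjI allI impI ballI)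
  show "prob_space gseq" by (rule gseq.prob_space_axioms)
  show "standard_brownian_motion gseq (\<lambda>t w. bpath w t)" by (rule standard_brownian_motion_bpath)
  fix n :: nat assume n: "1 \<le> n"
  show "gseq.indep_vars (\<lambda>_. borel) (\<lambda>k w. sign_step (lev n) (scaled n w) k) {1..n}"
    by (rule sign_step_indep[OF preserving_scaled[OF n] n lev_ge])
  show "measure gseq {w \<in> space gseq. (SUP t\<in>{0..1}. \<bar>bpath w t - ell n (\<lambda>k. sign_step (lev n) (scaled n w) k) t\<bar>)
      \<ge> (253683 + 4 * chain_const) * (ln (real n) / sqrt (real n))} \<le> 11 / real n powr 2"
    by (rule sup_deviation[OF n])
  fix k assume k: "k \<in> {1..n}"
  show "(\<lambda>w. sign_step (lev n) (scaled n w) k) \<in> borel_measurable gseq"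
    by (rule measurable_sign_step[OF preserving_scaled[OF n]])
  show "sign_step (lev n) (scaled n w) k \<in> {- 1, 1}" for w by (rule sign_step_in)
  have "k \<in> {1..2 ^ lev n}" using k lev_ge[of n] by auto
  from sign_step_half[OF preserving_scaled[OF n] this]
  show "\<P>(w in gseq. sign_step (lev n) (scaled n w) k = 1) = 1 / 2"
    "\<P>(w in gseq. sign_step (lev n) (scaled n w) k = - 1) = 1 / 2" by simp_all
qed

end
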